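(* Let $\mathbb{V}_{con}$ be a Danielewski variety with constant coefficients, with defining polynomial $P(Z)\in\mathbb{K}[Z]$ monic of degree $d$, and let $D_{con}$ be its canonical locally nilpotent derivation. The isotropy subgroup $\mathrm{Aut}(D_{con})$ can be described as follows. (i) If $P(Z)=Z^d$, then $$\mathrm{Aut}(D_{con})\cong\mathbb{S}\ltimes\big((\mathbb{K}^* )^{m-1}\ltimes\mathbb{U}(D_{con})\big).$$ (ii) If $P(Z)\neq Z^d$ and $v$ is the maximal integer such that $P(Z)=Z^uQ(Z^v)$ for some polynomial $Q(Z)\in\mathbb{K}[Z]$ and some nonnegative integer $u$, then $$\mathrm{Aut}(D_{con})\cong\mathbb{S}\ltimes\Big(\big((\mathbb{K}^* )^{m-2}\times\mathbb{Z}_{sv}\big)\ltimes\mathbb{U}(D_{con})\Big),$$ where $s=\gcd(k_2,\dots,k_m)$.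
   Context: $\mathbb{K}$ is an algebraically closed field of characteristic zero; $d,m,k_2,\dots,k_m$ are integers $\geqslant 2$. The Danielewski variety with constant coefficients $\mathbb{V}_{con}\subseteq\mathbb{K}^{m+1}$ is the affine variety with coordinate ring $$\mathbb{K}[\mathbb{V}_{con}]=\mathbb{K}[Y_1,\dots,Y_m,Z]/(Y_1Y_2^{k_2}\cdots Y_m^{k_m}-P(Z)),$$ where $P(Z)=Z^d+s_{d-1}Z^{d-1}+\dots+s_0$ with all $s_i\in\mathbb{K}$; $y_1,\dots,y_m,z$ are the images of $Y_1,\dots,Y_m,Z$. The canonical locally nilpotent derivation $D_{con}$ is the $\mathbb{K}$-derivation with $D_{con}(y_1)=P'(z)$, $D_{con}(z)=y_2^{k_2}\cdots y_m^{k_m}$, $D_{con}(y_j)=0$ for $j\geqslant 2$; its kernel is $\mathbb{K}[y_2,\dots,y_m]$. $\mathrm{Aut}(D_{con})$ is the group of $\mathbb{K}$-algebra automorphisms of $\mathbb{K}[\mathbb{V}_{con}]$ commuting with $D_{con}$. The big unipotent group is $\mathbb{U}(D_{con})=\{\mathrm{Exp}(fD_{con}):f\in\mathrm{Ker}(D_{con})\}$, where $\mathrm{Exp}(\delta)=\sum_{i\geqslant 0}\frac{1}{i!}\delta^i$. $\mathbb{S}$ (the symmetric group of $\mathbb{V}_{con}$) is the group of automorphisms of $\mathbb{K}[\mathbb{V}_{con}]$ that fix $z$ and permute $y_1,\dots,y_m$ by permutations stabilizing the monomial $Y_1Y_2^{k_2}\cdots Y_m^{k_m}$. $\mathbb{Z}_N$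 is the cyclic group of order $N$.
   Formalization: The conditions P = Z^d, P ≠ Z^d and the integer v are read off P(Z − s_{d−1}/d), which is P itself when s_{d−1} = 0; as printed (ii) fails, e.g. for m = 2, P = (Z−1)^d, where Aut(D_con) contains a copy of K^*. *)

theory Defs
  imports
    "HOL-Library.Poly_Mapping"
    "HOL-Computational_Algebra.Polynomial"
    "HOL-Algebra.QuotRing"
    "HOL-Algebra.Bij"
    "HOL-Algebra.Product_Groups"
    "HOL-Algebra.Elementary_Groups"
    "HOL-Algebra.Algebraic_Closure_Type"
begin

text \<open>
  Polynomials over \<open>'a\<close> in variables indexed by \<open>nat\<close>: a finitely supported map
  from exponent vectors to coefficients, with the convolution product.
  Index 0 is the variable \<open>Z\<close>, index \<open>j \<ge> 1\<close> is \<open>Y\<^sub>j\<close>.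
\<close>

type_synonym 'a mpoly = "(nat \<Rightarrow>\<^sub>0 nat) \<Rightarrow>\<^sub>0 'a"

definition mconst :: "'a::comm_ring_1 \<Rightarrow> 'a mpoly"
  where "mconst c = Poly_Mapping.single 0 c"

definition mvar :: "nat \<Rightarrow> 'a::comm_ring_1 mpoly"
  where "mvar i = Poly_Mapping.single (Poly_Mapping.single i 1) 1"

abbreviation Zvar :: "'a::comm_ring_1 mpoly"
  where "Zvar \<equiv> mvar 0"

text \<open>\<open>K[Y\<^sub>1,\<dots>,Y\<^sub>m,Z]\<close>\<close>

definition mpoly_ring :: "nat \<Rightarrow> 'a::comm_ring_1 mpoly ring"
  where "mpoly_ring m =
    \<lparr>carrier = {p. \<forall>\<mu>\<in>Poly_Mapping.keys p. Poly_Mapping.keys \<mu> \<subseteq> {0..m}},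
     monoid.mult = (*), one = 1, zero = 0, add = (+)\<rparr>"

definition subst_Z :: "'a::comm_ring_1 poly \<Rightarrow> 'a mpoly"
  where "subst_Z p = poly (map_poly mconst p) Zvar"

text \<open>\<open>Y\<^bsub>\<sigma> 1\<^esub> Y\<^bsub>\<sigma> 2\<^esub>\<^bsup>k 2\<^esup> \<cdots> Y\<^bsub>\<sigma> m\<^esub>\<^bsup>k m\<^esup>\<close>; the defining monomial is the case \<open>\<sigma> = id\<close>.\<close>

definition perm_monomial :: "nat \<Rightarrow> (nat \<Rightarrow> nat) \<Rightarrow> (nat \<Rightarrow> nat) \<Rightarrow> 'a::comm_ring_1 mpoly"
  where "perm_monomial m k \<sigma> = mvar (\<sigma> 1) * (\<Prod>j\<in>{2..m}. mvar (\<sigma> j) ^ k j)"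

subsection \<open>The coordinate ring\<close>

definition dan_ideal :: "nat \<Rightarrow> (nat \<Rightarrow> nat) \<Rightarrow> 'a::comm_ring_1 poly \<Rightarrow> 'a mpoly set"
  where "dan_ideal m k P = PIdl\<^bsub>mpoly_ring m\<^esub> (perm_monomial m k id - subst_Z P)"

definition dan_ring :: "nat \<Rightarrow> (nat \<Rightarrow> nat) \<Rightarrow> 'a::comm_ring_1 poly \<Rightarrow> 'a mpoly set ring"
  where "dan_ring m k P = mpoly_ring m Quot dan_ideal m k P"

definition dan_class :: "nat \<Rightarrow> (nat \<Rightarrow> nat) \<Rightarrow> 'a::comm_ring_1 poly \<Rightarrow> 'a mpoly \<Rightarrow> 'a mpoly set"
  where "dan_class m k P p = dan_ideal m k P +>\<^bsub>mpoly_ring m\<^esub> p"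

subsection \<open>The canonical derivation\<close>

text \<open>Derivations are required to be extensional on the carrier, so that the values on
  the generators determine them uniquely and the description below is definite.\<close>

definition K_derivation ::
  "nat \<Rightarrow> (nat \<Rightarrow> nat) \<Rightarrow> 'a::comm_ring_1 poly \<Rightarrow> ('a mpoly set \<Rightarrow> 'a mpoly set) \<Rightarrow> bool"
  where "K_derivation m k P D \<longleftrightarrow>
    (let B = dan_ring m k P in
      D \<in> carrier B \<rightarrow>\<^sub>E carrier B \<and>
      (\<forall>a\<in>carrier B. \<forall>b\<in>carrier B. D (a \<oplus>\<^bsub>B\<^esub> b) = D a \<oplus>\<^bsub>B\<^esub> D b) \<and>
      (\<forall>a\<in>carrier B. \<forall>b\<in>carrier B. D (a \<otimes>\<^bsub>B\<^esub> b) = D a \<otimes>\<^bsub>B\<^esub> b \<oplus>\<^bsub>B\<^esub> a \<otimes>\<^bsub>B\<^esub> D b) \<and>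
      (\<forall>c. D (dan_class m k P (mconst c)) = \<zero>\<^bsub>B\<^esub>))"

definition D_con ::
  "nat \<Rightarrow> (nat \<Rightarrow> nat) \<Rightarrow> 'a::idom poly \<Rightarrow> 'a mpoly set \<Rightarrow> 'a mpoly set"
  where "D_con m k P = (THE D. K_derivation m k P D \<and>
      D (dan_class m k P (mvar 1)) = dan_class m k P (subst_Z (pderiv P)) \<and>
      D (dan_class m k P Zvar) = dan_class m k P (\<Prod>j\<in>{2..m}. mvar j ^ k j) \<and>
      (\<forall>j\<in>{2..m}. D (dan_class m k P (mvar j)) = \<zero>\<^bsub>dan_ring m k P\<^esub>))"

definition Ker_D :: "nat \<Rightarrow> (nat \<Rightarrow> nat) \<Rightarrow> 'a::idom poly \<Rightarrow> 'a mpoly set set"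
  where "Ker_D m k P =
    {f \<in> carrier (dan_ring m k P). D_con m k P f = \<zero>\<^bsub>dan_ring m k P\<^esub>}"

subsection \<open>Groups of automorphisms\<close>

definition alg_automorphisms ::
  "nat \<Rightarrow> (nat \<Rightarrow> nat) \<Rightarrow> 'a::comm_ring_1 poly \<Rightarrow> ('a mpoly set \<Rightarrow> 'a mpoly set) set"
  where "alg_automorphisms m k P =
    {\<phi> \<in> Bij (carrier (dan_ring m k P)).
      \<phi> \<in> ring_hom (dan_ring m k P) (dan_ring m k P) \<and>
      (\<forall>c. \<phi> (dan_class m k P (mconst c)) = dan_class m k P (mconst c))}"

definition Aut_D ::
  "nat \<Rightarrow> (nat \<Rightarrow> nat) \<Rightarrow> 'a::idom poly \<Rightarrow> ('a mpoly set \<Rightarrow> 'a mpoly set) monoid"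
  where "Aut_D m k P = (BijGroup (carrier (dan_ring m k P)))
    \<lparr>carrier := {\<phi> \<in> alg_automorphisms m k P.
       \<forall>b\<in>carrier (dan_ring m k P). \<phi> (D_con m k P b) = D_con m k P (\<phi> b)}\<rparr>"

definition sym_group ::
  "nat \<Rightarrow> (nat \<Rightarrow> nat) \<Rightarrow> 'a::comm_ring_1 poly \<Rightarrow> ('a mpoly set \<Rightarrow> 'a mpoly set) monoid"
  where "sym_group m k P = (BijGroup (carrier (dan_ring m k P)))
    \<lparr>carrier := {\<phi> \<in> alg_automorphisms m k P.
       \<phi> (dan_class m k P Zvar) = dan_class m k P Zvar \<and>
       (\<exists>\<sigma>. \<sigma> permutes {1..m} \<and>
          (perm_monomial m k \<sigma> :: 'a mpoly) = perm_monomial m k id \<and>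
          (\<forall>j\<in>{1..m}. \<phi> (dan_class m k P (mvar j)) = dan_class m k P (mvar (\<sigma> j))))}\<rparr>"

text \<open>For locally nilpotent \<open>\<delta>\<close> only finitely many \<open>\<delta>\<^sup>i b\<close> are nonzero, so the
  exponential series is a finite sum for each \<open>b\<close>.\<close>

definition Exp ::
  "nat \<Rightarrow> (nat \<Rightarrow> nat) \<Rightarrow> 'a::field_char_0 poly \<Rightarrow>
    ('a mpoly set \<Rightarrow> 'a mpoly set) \<Rightarrow> 'a mpoly set \<Rightarrow> 'a mpoly set"
  where "Exp m k P \<delta> =
    (let B = dan_ring m k P in
      (\<lambda>b\<in>carrier B. finsum B
        (\<lambda>i. dan_class m k P (mconst (1 / fact i)) \<otimes>\<^bsub>B\<^esub> (\<delta> ^^ i) b)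
        {i. (\<delta> ^^ i) b \<noteq> \<zero>\<^bsub>B\<^esub>}))"

definition big_unipotent ::
  "nat \<Rightarrow> (nat \<Rightarrow> nat) \<Rightarrow> 'a::field_char_0 poly \<Rightarrow> ('a mpoly set \<Rightarrow> 'a mpoly set) monoid"
  where "big_unipotent m k P = (BijGroup (carrier (dan_ring m k P)))
    \<lparr>carrier := {Exp m k P (\<lambda>b. f \<otimes>\<^bsub>dan_ring m k P\<^esub> D_con m k P b) | f. f \<in> Ker_D m k P}\<rparr>"

definition torus :: "nat \<Rightarrow> (nat \<Rightarrow> 'a::field) monoid"
  where "torus n = product_group {1..n} (\<lambda>_. units_of ring_of_type_algebra)"

subsection \<open>Semidirect products\<close>

text \<open>\<open>H \<ltimes> N\<close>, with the normal factor \<open>N\<close> on the right; the pair \<open>(h, n)\<close> stands for the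
  product \<open>n h\<close>, and \<open>h n h\<^sup>-\<^sup>1 = \<alpha> h n\<close>.\<close>

definition semidirect ::
  "'h monoid \<Rightarrow> ('h \<Rightarrow> 'n \<Rightarrow> 'n) \<Rightarrow> 'n monoid \<Rightarrow> ('h \<times> 'n) monoid"
  where "semidirect H \<alpha> N =
    \<lparr>carrier = carrier H \<times> carrier N,
     monoid.mult = (\<lambda>(h, n) (h', n'). (h \<otimes>\<^bsub>H\<^esub> h', n \<otimes>\<^bsub>N\<^esub> \<alpha> h n')),
     one = (\<one>\<^bsub>H\<^esub>, \<one>\<^bsub>N\<^esub>)\<rparr>"

text \<open>\<open>G \<cong> S \<ltimes> (T \<ltimes> U)\<close> for subgroups \<open>S\<close> and \<open>U\<close> of \<open>G\<close> and an abstract group \<open>T\<close>: the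
  isomorphism is the inclusion on \<open>S\<close> and on \<open>U\<close>. Consequently the actions are those by
  conjugation in \<open>G\<close>.\<close>

definition iso_iterated_semidirect ::
  "'g monoid \<Rightarrow> 'g monoid \<Rightarrow> 't monoid \<Rightarrow> 'g monoid \<Rightarrow> bool"
  where "iso_iterated_semidirect G S T U \<longleftrightarrow>
    (\<exists>\<beta>\<in>hom T (AutoGroup U).
     \<exists>\<alpha>\<in>hom S (AutoGroup (semidirect T \<beta> U)).
     \<exists>\<Psi>\<in>iso (semidirect S \<alpha> (semidirect T \<beta> U)) G.
       (\<forall>s\<in>carrier S. \<Psi> (s, (\<one>\<^bsub>T\<^esub>, \<one>\<^bsub>U\<^esub>)) = s) \<and>
       (\<forall>u\<in>carrier U. \<Psi> (\<one>\<^bsub>S\<^esub>, (\<one>\<^bsub>T\<^esub>, u)) = u))"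

subsection \<open>Normalisation of the defining polynomial\<close>

text \<open>
  The structure theorem for \<open>Aut(D_con)\<close> presupposes the usual normalisation \<open>s\<^bsub>d-1\<^esub> = 0\<close>, reached by the change of
  coordinate \<open>Z \<mapsto> Z - s\<^bsub>d-1\<^esub>/d\<close>, which carries \<open>D_con\<close> to \<open>D_con\<close>. Without it the
  case distinction is wrong: for \<open>P = (Z - 1)\<^sup>d\<close> one has \<open>P \<noteq> Z\<^sup>d\<close> and \<open>v = 1\<close>, yet all
  \<open>z - 1 \<mapsto> \<lambda> (z - 1)\<close>, \<open>\<lambda> \<in> K\<^sup>*\<close>, occur in \<open>Aut(D_con)\<close>; for
  \<open>P = Z (Z - 2)\<close> one has \<open>v = 1\<close>, yet \<open>z \<mapsto> 2 - z\<close> occurs. Instead of assuming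
  \<open>s\<^bsub>d-1\<^esub> = 0\<close>, the statement keeps \<open>P\<close> arbitrary and reads the case distinction and
  \<open>v\<close> off the normalised polynomial, which is \<open>P\<close> itself when \<open>s\<^bsub>d-1\<^esub> = 0\<close>.
\<close>

definition normalised :: "'a::field_char_0 poly \<Rightarrow> 'a poly"
  where "normalised P =
    pcompose P [:- coeff P (degree P - 1) / of_nat (degree P), 1:]"

lemma normalised_eq: "coeff P (degree P - 1) = 0 \<Longrightarrow> normalised P = P"
  by (simp add: normalised_def)

definition has_period_form :: "'a::field_char_0 poly \<Rightarrow> nat \<Rightarrow> bool"
  where "has_period_form P v \<longleftrightarrow> (\<exists>u Q. P = monom 1 u * pcompose Q (monom 1 v))"

end

theory Submission
  imports Defs
begin

text \<open>
  Solving the defining equation for \<open>y\<^sub>1\<close> embeds the coordinate ring into \<open>L[z]\<close>, where \<open>L\<close> is the ring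
  of Laurent polynomials in \<open>y\<^sub>2, \<dots>, y\<^sub>m\<close>. Write \<open>y\<^sup>k\<close> for the monomial \<open>y\<^sub>2\<^bsup>k 2\<^esup> \<cdots> y\<^sub>m\<^bsup>k m\<^esup>\<close>; then
  \<open>y\<^sub>1 = P(z) / y\<^sup>k\<close> and \<open>D_con\<close> becomes \<open>y\<^sup>k d/dz\<close>. Over \<open>A = K[y\<^sub>2, \<dots>, y\<^sub>m]\<close> the image is free on
  the elements \<open>y\<^sub>1\<^bsup>e div d\<^esup> z\<^bsup>e mod d\<^esup>\<close>, which have pairwise different \<open>z\<close>-degrees \<open>e\<close>; hence an element
  of the image whose \<open>z\<close>-degree is below \<open>d\<close> has all its coefficients in \<open>A\<close>.

  An automorphism commuting with \<open>D_con\<close> therefore preserves the kernel \<open>A\<close> and maps \<open>z\<close> to \<open>\<mu> z + g\<close>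
  with \<open>\<mu>\<close> and \<open>g\<close> in \<open>A\<close>. It multiplies \<open>y\<^sup>k\<close> by \<open>\<mu>\<close>, as does its inverse by a factor of its own, so \<open>\<mu>\<close> is a
  nonzero constant; since factors of monomials are monomials, \<open>y\<^sub>j\<close> goes to \<open>\<lambda>\<^sub>j y\<^bsub>\<sigma> j\<^esub>\<close> with
  \<open>k (\<sigma> j) = k j\<close>. Finally \<open>P(\<mu> z + g) - \<mu>\<^sup>d P(z)\<close> must be divisible by \<open>y\<^sup>k\<close>. Its coefficient at
  \<open>z\<^bsup>d-1\<^esup>\<close> (with \<open>P\<close> normalised) forces \<open>g\<close> to be a multiple of \<open>y\<^sup>k\<close>, and the others then force
  \<open>P(\<mu> z) = \<mu>\<^sup>d P(z)\<close>. So every automorphism is uniquely a shear \<open>Exp (f D_con)\<close> after a diagonal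
  substitution after a permutation. The diagonal substitutions form the whole torus if
  \<open>P = Z\<^sup>d\<close>, and otherwise the kernel of the character \<open>\<lambda> \<mapsto> (\<Prod>\<lambda>\<^sub>j\<^bsup>k j\<^esup>)\<^sup>v\<close>, which Euclid's algorithm on
  the exponents splits as a torus times a cyclic group.
\<close>

subsection \<open>Iterated semidirect products\<close>

text \<open>In \<open>L\<close> the monomial \<open>y^k\<close> is a unit, so divisibility by it
  says nothing there; it carries information only when the quotient is known to lie in the image of
  the coordinate ring. Hence the criterion by \<open>z\<close>-degree: below degree
  \<open>d\<close>, membership in the image forces coefficients in \<open>A\<close>, where exponents
  cannot be negative. The bound d \<ge> 2 brings the image of \<open>z\<close>, which has degree at
  most one, under this criterion. The coefficient of \<open>P(\<mu> z + g)\<close> at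
  \<open>z^(d-1)\<close> is \<open>d \<mu>^(d-1) g\<close> because the normalised polynomial has no
  such term, and \<open>d\<close> is invertible in characteristic zero; this is how \<open>g\<close>
  itself becomes a multiple of \<open>y^k\<close>. The bounds on the \<open>k j\<close> single out
  \<open>y_1\<close>: it alone has exponent 1 in the defining monomial, so permutations stabilising
  the monomial fix it. Shears are normal in the whole group and permutations normalise the diagonal
  substitutions, which dictates the nesting of the products. The torus factor enters only through an
  isomorphism onto the diagonal subgroup, so its coordinates may be changed freely; Euclid's
  algorithm uses this freedom.\<close>

lemma semidirect_embedding:
  assumes G: "group G" and H: "group H" and \<sigma>: "\<sigma> \<in> hom H G"
    and W: "\<And>x y. x \<in> carrier W \<Longrightarrow> y \<in> carrier W \<Longrightarrow> x \<otimes>\<^bsub>W\<^esub> y \<in> carrier W"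
    and \<omega>: "\<omega> \<in> hom W G" and inj: "inj_on \<omega> (carrier W)"
    and conj: "\<And>h w. h \<in> carrier H \<Longrightarrow> w \<in> carrier W \<Longrightarrow>
      \<sigma> h \<otimes>\<^bsub>G\<^esub> \<omega> w \<otimes>\<^bsub>G\<^esub> inv\<^bsub>G\<^esub> (\<sigma> h) \<in> \<omega> ` carrier W"
  obtains \<alpha> where "\<alpha> \<in> hom H (AutoGroup W)"
    and "(\<lambda>(h, w). \<omega> w \<otimes>\<^bsub>G\<^esub> \<sigma> h) \<in> hom (semidirect H \<alpha> W) G"
    and "\<And>x y. x \<in> carrier (semidirect H \<alpha> W) \<Longrightarrow> y \<in> carrier (semidirect H \<alpha> W) \<Longrightarrow>
      x \<otimes>\<^bsub>semidirect H \<alpha> W\<^esub> y \<in> carrier (semidirect H \<alpha> W)"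
proof -
  interpret G: group G by fact
  interpret H: group H by fact
  define c where "c h w = \<sigma> h \<otimes>\<^bsub>G\<^esub> \<omega> w \<otimes>\<^bsub>G\<^esub> inv\<^bsub>G\<^esub> (\<sigma> h)" for h w
  \<comment> \<open>Conjugation in \<open>G\<close>, pulled back along the injective
    \<open>\<omega>\<close>; the hypothesis \<open>conj\<close> keeps the conjugate inside the
    image. Each law for \<open>\<alpha>\<close> is then verified after applying
    \<open>\<omega>\<close>, as an identity in \<open>G\<close>. Restricting to the carrier gives
    the extensionality that \<open>Bij\<close> demands.\<close>
  define \<alpha> where "\<alpha> h = (\<lambda>w\<in>carrier W. inv_into (carrier W) \<omega> (c h w))" for h
  have \<sigma>c [simp]: "h \<in> carrier H \<Longrightarrow> \<sigma> h \<in> carrier G" for h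
    using \<sigma> by (auto simp: hom_def)
  have \<omega>c [simp]: "w \<in> carrier W \<Longrightarrow> \<omega> w \<in> carrier G" for w
    using \<omega> by (auto simp: hom_def)
  have \<sigma>m: "h \<in> carrier H \<Longrightarrow> h' \<in> carrier H \<Longrightarrow> \<sigma> (h \<otimes>\<^bsub>H\<^esub> h') = \<sigma> h \<otimes>\<^bsub>G\<^esub> \<sigma> h'" for h h'
    using \<sigma> by (auto simp: hom_def)
  have \<omega>m: "w \<in> carrier W \<Longrightarrow> w' \<in> carrier W \<Longrightarrow> \<omega> (w \<otimes>\<^bsub>W\<^esub> w') = \<omega> w \<otimes>\<^bsub>G\<^esub> \<omega> w'" for w w'
    using \<omega> by (auto simp: hom_def)
  have \<alpha>c [simp]: "\<alpha> h w \<in> carrier W" if "h \<in> carrier H" "w \<in> carrier W" for h w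
    using conj[OF that] that by (auto simp: \<alpha>_def c_def intro!: inv_into_into)
  have \<omega>\<alpha>: "\<omega> (\<alpha> h w) = c h w" if "h \<in> carrier H" "w \<in> carrier W" for h w
    using conj[OF that] that by (auto simp: \<alpha>_def c_def f_inv_into_f)
  have eqI: "x = y" if "\<omega> x = \<omega> y" "x \<in> carrier W" "y \<in> carrier W" for x y
    using inj that by (auto dest: inj_onD)
  have \<sigma>inv: "h \<in> carrier H \<Longrightarrow> \<sigma> (inv\<^bsub>H\<^esub> h) = inv\<^bsub>G\<^esub> (\<sigma> h)" for h
    using \<sigma> G H by (simp add: group_hom.hom_inv group_hom_axioms.intro group_hom_def)
  have comp: "\<alpha> (h \<otimes>\<^bsub>H\<^esub> h') w = \<alpha> h (\<alpha> h' w)" if "h \<in> carrier H" "h' \<in> carrier H" "w \<in> carrier W" for h h' w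
    using that by (intro eqI) (simp_all add: \<omega>\<alpha> c_def \<sigma>m G.m_assoc G.inv_mult_group)
  have \<alpha>1: "\<alpha> \<one>\<^bsub>H\<^esub> w = w" if "w \<in> carrier W" for w
  proof -
    have "\<sigma> \<one>\<^bsub>H\<^esub> = \<one>\<^bsub>G\<^esub>"
      using \<sigma> G H by (simp add: group_hom.hom_one group_hom_axioms.intro group_hom_def)
    then show ?thesis using that by (intro eqI) (simp_all add: \<omega>\<alpha> c_def)
  qed
  have bij: "bij_betw (\<alpha> h) (carrier W) (carrier W)" if h: "h \<in> carrier H" for h
    by (rule bij_betw_byWitness[where f' = "\<alpha> (inv\<^bsub>H\<^esub> h)"]) (auto simp: h comp[symmetric] \<alpha>1)
  have hm: "\<alpha> h (w \<otimes>\<^bsub>W\<^esub> w') = \<alpha> h w \<otimes>\<^bsub>W\<^esub> \<alpha> h w'"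
    if "h \<in> carrier H" "w \<in> carrier W" "w' \<in> carrier W" for h w w'
  proof (rule eqI)
    have *: "inv\<^bsub>G\<^esub> (\<sigma> h) \<otimes>\<^bsub>G\<^esub> (\<sigma> h \<otimes>\<^bsub>G\<^esub> x) = x" if "x \<in> carrier G" for x
      using that \<open>h \<in> carrier H\<close> by (simp flip: G.m_assoc)
    show "\<omega> (\<alpha> h (w \<otimes>\<^bsub>W\<^esub> w')) = \<omega> (\<alpha> h w \<otimes>\<^bsub>W\<^esub> \<alpha> h w')"
      using that by (simp add: \<omega>\<alpha> \<omega>m W c_def * G.m_assoc)
  qed (use that W in auto)
  have \<alpha>B: "\<alpha> h \<in> Bij (carrier W)" if "h \<in> carrier H" for h
    using bij[OF that] by (auto simp: Bij_def \<alpha>_def)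
  have aut: "\<alpha> h \<in> auto W" if "h \<in> carrier H" for h
    using \<alpha>B[OF that] hm[OF that] that by (auto simp: auto_def hom_def)
  have "\<alpha> \<in> hom H (AutoGroup W)"
  proof (rule homI)
    fix x y assume xy: "x \<in> carrier H" "y \<in> carrier H"
    have "\<alpha> (x \<otimes>\<^bsub>H\<^esub> y) \<in> extensional (carrier W)"
      by (simp add: \<alpha>_def)
    then have "\<alpha> (x \<otimes>\<^bsub>H\<^esub> y) = compose (carrier W) (\<alpha> x) (\<alpha> y)"
      by (rule extensionalityI[OF _ compose_extensional]) (simp add: comp xy compose_def)
    then show "\<alpha> (x \<otimes>\<^bsub>H\<^esub> y) = \<alpha> x \<otimes>\<^bsub>AutoGroup W\<^esub> \<alpha> y"
      using xy \<alpha>B by (simp add: AutoGroup_def BijGroup_def)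
  qed (simp add: AutoGroup_def aut)
  moreover have "(\<lambda>(h, w). \<omega> w \<otimes>\<^bsub>G\<^esub> \<sigma> h) \<in> hom (semidirect H \<alpha> W) G"
  proof (rule homI)
    fix x y assume "x \<in> carrier (semidirect H \<alpha> W)" "y \<in> carrier (semidirect H \<alpha> W)"
    then obtain h w h' w' where xy: "x = (h, w)" "y = (h', w')" "h \<in> carrier H" "h' \<in> carrier H"
      "w \<in> carrier W" "w' \<in> carrier W" by (auto simp: semidirect_def)
    have *: "inv\<^bsub>G\<^esub> (\<sigma> h) \<otimes>\<^bsub>G\<^esub> (\<sigma> h \<otimes>\<^bsub>G\<^esub> x) = x" if "x \<in> carrier G" for x
      using that xy by (simp flip: G.m_assoc)
    show "(\<lambda>(h, w). \<omega> w \<otimes>\<^bsub>G\<^esub> \<sigma> h) (x \<otimes>\<^bsub>semidirect H \<alpha> W\<^esub> y) =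
        (\<lambda>(h, w). \<omega> w \<otimes>\<^bsub>G\<^esub> \<sigma> h) x \<otimes>\<^bsub>G\<^esub> (\<lambda>(h, w). \<omega> w \<otimes>\<^bsub>G\<^esub> \<sigma> h) y"
      using xy by (simp add: semidirect_def \<omega>m \<sigma>m \<omega>\<alpha> c_def * G.m_assoc)
  qed (auto simp: semidirect_def)
  ultimately show ?thesis
    by (rule that) (auto simp: semidirect_def W)
qed

text \<open>Since \<open>U\<close> is normal and \<open>S\<close> normalises \<open>V\<close>, the
  products \<open>u v\<close> are stable under conjugation by \<open>S\<close>. So
  \<open>semidirect_embedding\<close> applies twice: to \<open>T\<close> acting on \<open>U\<close>,
  and to \<open>S\<close> acting on the result, which is why it also delivers closure of the product
  it builds. Existence and uniqueness of the factorisation \<open>u v s\<close> give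
  bijectivity.\<close>

lemma iso_iterated_semidirectI:
  assumes G: "group G" and S: "subgroup S G" and V: "subgroup V G" and U: "subgroup U G"
    and T: "group T" and \<tau>: "\<tau> \<in> iso T (G\<lparr>carrier := V\<rparr>)"
    and VU: "\<And>g u. g \<in> carrier G \<Longrightarrow> u \<in> U \<Longrightarrow> g \<otimes>\<^bsub>G\<^esub> u \<otimes>\<^bsub>G\<^esub> inv\<^bsub>G\<^esub> g \<in> U"
    and SV: "\<And>s v. s \<in> S \<Longrightarrow> v \<in> V \<Longrightarrow> s \<otimes>\<^bsub>G\<^esub> v \<otimes>\<^bsub>G\<^esub> inv\<^bsub>G\<^esub> s \<in> V"
    and gen: "\<And>g. g \<in> carrier G \<Longrightarrow> \<exists>u\<in>U. \<exists>v\<in>V. \<exists>s\<in>S. g = u \<otimes>\<^bsub>G\<^esub> v \<otimes>\<^bsub>G\<^esub> s"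
    and uniq: "\<And>u v s u' v' s'. u \<in> U \<Longrightarrow> v \<in> V \<Longrightarrow> s \<in> S \<Longrightarrow> u' \<in> U \<Longrightarrow> v' \<in> V \<Longrightarrow> s' \<in> S \<Longrightarrow>
      u \<otimes>\<^bsub>G\<^esub> v \<otimes>\<^bsub>G\<^esub> s = u' \<otimes>\<^bsub>G\<^esub> v' \<otimes>\<^bsub>G\<^esub> s' \<Longrightarrow> u = u' \<and> v = v' \<and> s = s'"
  shows "iso_iterated_semidirect G (G\<lparr>carrier := S\<rparr>) T (G\<lparr>carrier := U\<rparr>)"
proof -
  interpret G: group G by fact
  interpret T: group T by fact
  let ?S = "G\<lparr>carrier := S\<rparr>" and ?U = "G\<lparr>carrier := U\<rparr>"
  have mem [simp]: "x \<in> carrier G" if "x \<in> S \<or> x \<in> V \<or> x \<in> U" for x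
    using that S V U by (auto dest: subgroup.mem_carrier)
  have one [simp]: "\<one>\<^bsub>G\<^esub> \<in> S" "\<one>\<^bsub>G\<^esub> \<in> V" "\<one>\<^bsub>G\<^esub> \<in> U"
    using S V U by (auto dest: subgroup.one_closed)
  have \<tau>V: "t \<in> carrier T \<Longrightarrow> \<tau> t \<in> V" for t
    using \<tau> by (auto simp: iso_def hom_def)
  have \<tau>c [simp]: "t \<in> carrier T \<Longrightarrow> \<tau> t \<in> carrier G" for t
    using \<tau>V by auto
  have \<tau>hom: "\<tau> \<in> hom T G"
    using \<tau> by (auto simp: iso_def hom_def)
  have \<tau>inj: "inj_on \<tau> (carrier T)" and \<tau>im: "\<tau> ` carrier T = V"
    using \<tau> by (auto simp: iso_def bij_betw_def)
  have \<tau>1: "\<tau> \<one>\<^bsub>T\<^esub> = \<one>\<^bsub>G\<^esub>"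
    using \<tau>hom G T by (simp add: group_hom.hom_one group_hom_axioms.intro group_hom_def)
  obtain \<beta> where \<beta>: "\<beta> \<in> hom T (AutoGroup ?U)"
      and \<beta>hom: "(\<lambda>(t, u). id u \<otimes>\<^bsub>G\<^esub> \<tau> t) \<in> hom (semidirect T \<beta> ?U) G"
      and \<beta>cl: "\<And>x y. x \<in> carrier (semidirect T \<beta> ?U) \<Longrightarrow> y \<in> carrier (semidirect T \<beta> ?U) \<Longrightarrow>
      x \<otimes>\<^bsub>semidirect T \<beta> ?U\<^esub> y \<in> carrier (semidirect T \<beta> ?U)"
  proof (rule semidirect_embedding[OF G T \<tau>hom, of ?U id])
    show "id \<in> hom ?U G" by (auto simp: hom_def)
  qed (use U VU in \<open>auto simp: subgroup.m_closed\<close>)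
  let ?W = "semidirect T \<beta> ?U" and ?\<omega> = "\<lambda>(t, u). id u \<otimes>\<^bsub>G\<^esub> \<tau> t"
  have W: "carrier ?W = carrier T \<times> U" "\<one>\<^bsub>?W\<^esub> = (\<one>\<^bsub>T\<^esub>, \<one>\<^bsub>G\<^esub>)" by (auto simp: semidirect_def)
  have inj: "t = t' \<and> u = u' \<and> s = s'"
    if "u \<otimes>\<^bsub>G\<^esub> \<tau> t \<otimes>\<^bsub>G\<^esub> s = u' \<otimes>\<^bsub>G\<^esub> \<tau> t' \<otimes>\<^bsub>G\<^esub> s'" "s \<in> S" "s' \<in> S" "u \<in> U" "u' \<in> U"
      "t \<in> carrier T" "t' \<in> carrier T" for t t' u u' s s'
    using uniq[of u "\<tau> t" s u' "\<tau> t'" s'] that \<tau>V \<tau>inj by (auto dest: inj_onD)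
  obtain \<alpha> where \<alpha>: "\<alpha> \<in> hom ?S (AutoGroup ?W)"
      and \<alpha>hom: "(\<lambda>(s, w). ?\<omega> w \<otimes>\<^bsub>G\<^esub> id s) \<in> hom (semidirect ?S \<alpha> ?W) G"
  proof (rule semidirect_embedding[OF G, of ?S id ?W ?\<omega>])
    show "group ?S" using S by (rule G.subgroup_imp_group)
    show "id \<in> hom ?S G" by (auto simp: hom_def)
    \<comment> \<open>Uniqueness of the factorisation with a trivial third factor.\<close>
    show "inj_on ?\<omega> (carrier ?W)"
      using inj[where s = "\<one>\<^bsub>G\<^esub>" and s' = "\<one>\<^bsub>G\<^esub>"] by (auto simp: inj_on_def W)
    fix s w assume "s \<in> carrier ?S" "w \<in> carrier ?W"
    then obtain t u where w: "w = (t, u)" "t \<in> carrier T" "u \<in> U" "s \<in> S" by (auto simp: W)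
    obtain t' where t': "t' \<in> carrier T" "\<tau> t' = s \<otimes>\<^bsub>G\<^esub> \<tau> t \<otimes>\<^bsub>G\<^esub> inv\<^bsub>G\<^esub> s"
      using SV[of s "\<tau> t"] w \<tau>V \<tau>im by (metis imageE)
    have *: "inv\<^bsub>G\<^esub> s \<otimes>\<^bsub>G\<^esub> (s \<otimes>\<^bsub>G\<^esub> x) = x" if "x \<in> carrier G" for x
      using that w by (simp flip: G.m_assoc)
    \<comment> \<open>Conjugating \<open>u (\<tau> t)\<close> by \<open>s\<close> conjugates both
      factors: the first stays in \<open>U\<close>, the second in \<open>V\<close>, where it is
      again a value of \<open>\<tau>\<close>.\<close>
    have "id s \<otimes>\<^bsub>G\<^esub> ?\<omega> w \<otimes>\<^bsub>G\<^esub> inv\<^bsub>G\<^esub> (id s) = ?\<omega> (t', s \<otimes>\<^bsub>G\<^esub> u \<otimes>\<^bsub>G\<^esub> inv\<^bsub>G\<^esub> s)"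
      using w t' by (simp add: G.m_assoc *)
    moreover have "(t', s \<otimes>\<^bsub>G\<^esub> u \<otimes>\<^bsub>G\<^esub> inv\<^bsub>G\<^esub> s) \<in> carrier ?W"
      using w t' VU by (simp add: W)
    ultimately show "id s \<otimes>\<^bsub>G\<^esub> ?\<omega> w \<otimes>\<^bsub>G\<^esub> inv\<^bsub>G\<^esub> (id s) \<in> ?\<omega> ` carrier ?W"
      by (metis image_eqI)
  qed (use \<beta>hom \<beta>cl in auto)
  let ?\<Psi> = "\<lambda>(s, w). ?\<omega> w \<otimes>\<^bsub>G\<^esub> id s"
  have "bij_betw ?\<Psi> (carrier (semidirect ?S \<alpha> ?W)) (carrier G)"
  proof (rule bij_betw_imageI)
    show "inj_on ?\<Psi> (carrier (semidirect ?S \<alpha> ?W))"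
    proof (rule inj_onI)
      fix x y assume "x \<in> carrier (semidirect ?S \<alpha> ?W)" "y \<in> carrier (semidirect ?S \<alpha> ?W)"
        and eq: "?\<Psi> x = ?\<Psi> y"
      then obtain s t u s' t' u' where "x = (s, (t, u))" "y = (s', (t', u'))"
        "s \<in> S" "s' \<in> S" "u \<in> U" "u' \<in> U" "t \<in> carrier T" "t' \<in> carrier T"
        by (auto simp: semidirect_def)
      with eq inj[of u t s u' t' s'] show "x = y" by simp
    qed
    have "g \<in> ?\<Psi> ` carrier (semidirect ?S \<alpha> ?W)" if "g \<in> carrier G" for g
    proof -
      obtain u v s where "u \<in> U" "v \<in> V" "s \<in> S" "g = u \<otimes>\<^bsub>G\<^esub> v \<otimes>\<^bsub>G\<^esub> s"
        using gen \<open>g \<in> carrier G\<close> by metis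
      moreover from this obtain t where "t \<in> carrier T" "\<tau> t = v"
        using \<tau>im by blast
      ultimately have "g = ?\<Psi> (s, (t, u))" "(s, (t, u)) \<in> carrier (semidirect ?S \<alpha> ?W)"
        by (auto simp: semidirect_def)
      then show ?thesis by (metis image_eqI)
    qed
    then show "?\<Psi> ` carrier (semidirect ?S \<alpha> ?W) = carrier G"
      using \<tau>c by (auto simp: semidirect_def)
  qed
  with \<alpha>hom have "?\<Psi> \<in> iso (semidirect ?S \<alpha> ?W) G" by (simp add: iso_def)
  moreover have "\<forall>s\<in>carrier ?S. ?\<Psi> (s, (\<one>\<^bsub>T\<^esub>, \<one>\<^bsub>?U\<^esub>)) = s" "\<forall>u\<in>carrier ?U. ?\<Psi> (\<one>\<^bsub>?S\<^esub>, (\<one>\<^bsub>T\<^esub>, u)) = u"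
    by (auto simp: \<tau>1)
  ultimately show ?thesis
    using \<alpha> \<beta> unfolding iso_iterated_semidirect_def by blast
qed

subsection \<open>Kernels of characters of a torus\<close>

text \<open>Induction over the prime factors. Passing from \<open>n\<close> to \<open>p n\<close>:
  if \<open>p\<close> divides \<open>n\<close>, a \<open>p\<close>-th root of the given root has
  order \<open>p n\<close>; otherwise the orders are coprime and the given root is multiplied by a
  nontrivial \<open>p\<close>-th root of unity.\<close>

lemma primitive_root_of_unity_exists:
  assumes "n > 0"
  shows "\<exists>\<zeta> :: 'a::{alg_closed_field, field_char_0}. \<forall>i. \<zeta> ^ i = 1 \<longleftrightarrow> n dvd i"
  using assms
proof (induction n rule: prime_divisors_induct)
  case (unit n)
  then show ?case by (intro exI[of _ 1]) auto
next
  case (factor p n)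
  have p: "prime p" "p > 0" and n: "n > 0" using factor prime_gt_0_nat by auto
  obtain \<zeta> :: 'a where \<zeta>: "\<zeta> ^ i = 1 \<longleftrightarrow> n dvd i" for i using factor n by auto
  have \<zeta>0: "\<zeta> \<noteq> 0" using \<zeta>[of n] n by (auto simp: power_0_left)
  show ?case
  proof (cases "p dvd n")
    case True
    obtain \<xi> where \<xi>: "\<xi> ^ p = \<zeta>"
      using nth_root_exists[of p \<zeta>] p by auto
    show ?thesis
    proof (intro exI allI iffI)
      fix i assume i: "\<xi> ^ i = 1"
      then have "\<zeta> ^ i = 1" by (metis \<xi> power_commutes power_mult power_one mult.commute)
      then have "p dvd i" using \<zeta> True dvd_trans by blast
      then obtain j where j: "i = p * j" by auto
      with i \<xi> have "\<zeta> ^ j = 1" by (simp add: power_mult)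
      with j show "p * n dvd i" by (simp add: \<zeta>)
    next
      fix i assume "p * n dvd i"
  then obtain j where "i = p * n * j" by (rule dvdE)
      then have "i = p * (n * j)" by simp
      then have "\<xi> ^ i = \<zeta> ^ (n * j)" by (simp add: power_mult \<xi>)
      then show "\<xi> ^ i = 1" by (simp add: \<zeta>)
    qed
  next
    case False
    obtain w :: 'a where w: "w ^ p = 1" "w \<noteq> 1"
    proof -
      \<comment> \<open>The value of \<open>1 + X + ... + X^(p-1)\<close> at 1 is \<open>p\<close>,
        which is nonzero in characteristic zero, so any root of it is a \<open>p\<close>-th root of
        unity other than 1.\<close>
      let ?q = "\<Sum>i<p. monom (1::'a) i"
      have "coeff ?q (p - 1) = (\<Sum>i<p. if i = p - 1 then 1 else 0)"
        unfolding coeff_sum by (intro sum.cong) auto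
      also have "\<dots> = 1" using p by (subst sum.delta) auto
      finally have "p - 1 \<le> degree ?q" by (intro le_degree) simp
      with prime_gt_1_nat[OF p(1)] have "degree ?q > 0" by auto
      then obtain w where "poly ?q w = 0" using alg_closed_imp_poly_has_root by blast
      then have s: "(\<Sum>i<p. w ^ i) = 0" by (simp add: poly_sum poly_monom)
      then have "w \<noteq> 1" using p by auto
      moreover have "w ^ p = 1" using s power_diff_1_eq[of w p] by simp
      ultimately show ?thesis using that by blast
    qed
    have cop: "coprime p n" using False p by (simp add: prime_imp_coprime)
    have wdvd: "w ^ i = 1 \<longleftrightarrow> p dvd i" for i
    proof
      assume "w ^ i = 1"
      show "p dvd i"
      proof (rule ccontr)
        assume "\<not> p dvd i"
        then have "coprime i p" using p by (metis coprime_commute prime_imp_coprime)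
        then obtain a b where "i * a = p * b + 1"
          using coprime_bezout_strong[of i p] prime_gt_1_nat[OF p(1)] by auto
        then have "w ^ (i * a) = w ^ (p * b + 1)" by simp
        then show False using w \<open>w ^ i = 1\<close> by (simp add: power_mult power_add)
      qed
    qed (auto simp: power_mult w)
    show ?thesis
    proof (intro exI allI iffI)
      fix i assume i: "(\<zeta> * w) ^ i = 1"
      then have "((\<zeta> * w) ^ i) ^ p = 1" "((\<zeta> * w) ^ i) ^ n = 1" by simp_all
      moreover have "((\<zeta> * w) ^ i) ^ p = \<zeta> ^ (p * i) * (w ^ p) ^ i" "((\<zeta> * w) ^ i) ^ n = (\<zeta> ^ n) ^ i * w ^ (n * i)"
        by (simp_all add: power_mult_distrib mult.commute flip: power_mult)
      moreover have "\<zeta> ^ n = 1" by (simp add: \<zeta>)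
      ultimately have "\<zeta> ^ (p * i) = 1" "w ^ (n * i) = 1" using w by simp_all
      then have "n dvd p * i" "p dvd n * i" by (simp_all add: \<zeta> wdvd)
      then have "n dvd i" "p dvd i" using cop
        by (simp_all add: coprime_dvd_mult_right_iff coprime_commute)
      then show "p * n dvd i" using cop by (simp add: divides_mult)
    next
      fix i assume "p * n dvd i"
      then have "p dvd i" "n dvd i" by (auto dest: dvd_mult_left dvd_mult_right)
      then have "\<zeta> ^ i = 1" "w ^ i = 1" by (simp_all add: \<zeta> wdvd)
      then show "(\<zeta> * w) ^ i = 1" by (simp add: power_mult_distrib)
    qed
  qed
qed auto

text \<open>The first \<open>n\<close> powers of \<open>\<zeta>\<close> are distinct roots of
  \<open>X^n - 1\<close>, which has at most \<open>n\<close> roots; so they exhaust them.\<close>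

lemma roots_of_unity_powers:
  fixes \<zeta> x :: "'a::field"
  assumes n: "n > 0" and \<zeta>: "\<And>i. \<zeta> ^ i = 1 \<longleftrightarrow> n dvd i" and x: "x ^ n = 1"
  shows "\<exists>i<n. x = \<zeta> ^ i"
proof -
  have \<zeta>0: "\<zeta> \<noteq> 0" using \<zeta>[of n] n by (auto simp: power_0_left)
  have inj: "inj_on (\<lambda>i. \<zeta> ^ i) {..<n}"
  proof (rule linorder_inj_onI')
    fix i j assume ij: "i \<in> {..<n}" "j \<in> {..<n}" "i < j"
    then have "\<not> n dvd j - i" by (auto dest: dvd_imp_le)
    then have "\<zeta> ^ (j - i) \<noteq> 1" by (simp add: \<zeta>)
    moreover have "\<zeta> ^ j = \<zeta> ^ i * \<zeta> ^ (j - i)" using ij by (simp flip: power_add)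
    ultimately show "\<zeta> ^ i \<noteq> \<zeta> ^ j" using \<zeta>0 by auto
  qed
  let ?p = "monom 1 n - 1 :: 'a poly"
  have "coeff ?p n = 1" using n by (simp add: coeff_1)
  then have p0: "?p \<noteq> 0" by (metis coeff_0 zero_neq_one)
  have deg: "degree ?p \<le> n"
    by (rule degree_diff_le) (auto simp: degree_monom_le)
  have sub: "(\<lambda>i. \<zeta> ^ i) ` {..<n} \<subseteq> {y. poly ?p y = 0}"
  proof clarsimp
    fix i
    have "\<zeta> ^ n = 1" by (simp add: \<zeta>)
    then have "(\<zeta> ^ i) ^ n = 1" by (metis power_commutes power_mult power_one mult.commute)
    then show "poly (monom 1 n) (\<zeta> ^ i) = 1" by (simp add: poly_monom)
  qed
  have "{y. poly ?p y = 0} = (\<lambda>i. \<zeta> ^ i) ` {..<n}"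
  proof (rule card_seteq[symmetric, OF poly_roots_finite[OF p0] sub])
    show "card {y. poly ?p y = 0} \<le> card ((\<lambda>i. \<zeta> ^ i) ` {..<n})"
      using card_poly_roots_bound[OF p0] deg by (simp add: card_image[OF inj])
  qed
  moreover have "x \<in> {y. poly ?p y = 0}" using x by (simp add: poly_monom)
  ultimately show ?thesis by auto
qed

lemma carrier_torus: "carrier (torus n) = {1..n} \<rightarrow>\<^sub>E {x :: 'a::field. x \<noteq> 0}"
proof -
  have "Units (ring_of_type_algebra :: 'a ring) = {x. x \<noteq> 0}"
    by (auto simp: Units_def ring_of_type_algebra_def) (metis left_inverse right_inverse)
  then show ?thesis by (simp add: torus_def units_of_def)
qed

lemma mult_torus: "x \<otimes>\<^bsub>torus n\<^esub> y = (\<lambda>i\<in>{1..n}. x i * y i)"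
  by (simp add: torus_def units_of_def ring_of_type_algebra_def)

lemma group_torus: "group (torus n :: (nat \<Rightarrow> 'a::field) monoid)"
proof -
  have "group (units_of (ring_of_type_algebra :: 'a ring))"
    using field_from_type_algebra[where 'a = 'a] by (intro monoid.units_group) (auto simp: field_def domain_def cring_def ring_def)
  then show ?thesis by (simp add: torus_def)
qed

definition torus_ker :: "nat \<Rightarrow> (nat \<Rightarrow> nat) \<Rightarrow> (nat \<Rightarrow> 'a::field) monoid"
  where "torus_ker n a = (torus n)\<lparr>carrier := {t \<in> carrier (torus n). (\<Prod>i\<in>{1..n}. t i ^ a i) = 1}\<rparr>"

text \<open>One step of Euclid's algorithm: the substitution \<open>t\<^sub>j \<mapsto> t\<^sub>i t\<^sub>j\<close> subtracts one exponent from another.\<close>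

lemma torus_ker_shift:
  assumes "i \<in> {1..n}" "j \<in> {1..n}" "i \<noteq> j" "a j \<le> a i"
  shows "(torus_ker n (a(i := a i - a j)) :: (nat \<Rightarrow> 'a::field) monoid) \<cong> (torus_ker n a :: (nat \<Rightarrow> 'a) monoid)"
proof -
  let ?a = "a(i := a i - a j)"
  let ?K = "torus_ker n a :: (nat \<Rightarrow> 'a) monoid" and ?K' = "torus_ker n ?a :: (nat \<Rightarrow> 'a) monoid"
  let ?f = "\<lambda>t :: nat \<Rightarrow> 'a. t(j := t i * t j)" and ?g = "\<lambda>t :: nat \<Rightarrow> 'a. t(j := t j / t i)"
  have prod_split: "(\<Prod>l\<in>{1..n}. h l) = h i * (h j * (\<Prod>l\<in>{1..n} - {i} - {j}. h l))" for h :: "nat \<Rightarrow> 'a"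
    using assms by (simp add: prod.remove)
  \<comment> \<open>The factor \<open>t_i^(a_j)\<close> gained from \<open>(t_i t_j)^(a_j)\<close>
    makes up for lowering the exponent of \<open>t_i\<close> to \<open>a_i - a_j\<close>.\<close>
  have eq: "(\<Prod>l\<in>{1..n}. ?f t l ^ ?a l) = (\<Prod>l\<in>{1..n}. t l ^ a l)" for t :: "nat \<Rightarrow> 'a"
  proof -
    have "t i ^ a i = t i ^ (a i - a j) * t i ^ a j" using assms by (simp flip: power_add)
    moreover have "(\<Prod>l\<in>{1..n} - {i} - {j}. ?f t l ^ ?a l) = (\<Prod>l\<in>{1..n} - {i} - {j}. t l ^ a l)"
      by (intro prod.cong) auto
    ultimately show ?thesis
      unfolding prod_split using assms by (simp add: power_mult_distrib mult_ac)
  qed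
  have fg: "?f (?g t) = t" "?g (?f t) = t" if "t \<in> carrier (torus n)" for t :: "nat \<Rightarrow> 'a"
    using that assms by (auto simp: carrier_torus PiE_iff fun_eq_iff)
  have fT: "?f t \<in> carrier (torus n)" "?g t \<in> carrier (torus n)" if "t \<in> carrier (torus n)" for t :: "nat \<Rightarrow> 'a"
    using that assms unfolding carrier_torus by (auto simp: PiE_iff extensional_def)
  have gK: "?g t \<in> carrier ?K" if t: "t \<in> carrier ?K'" for t
  proof -
    have "t \<in> carrier (torus n)" using t by (simp add: torus_ker_def)
    with t eq[of "?g t"] show ?thesis
      by (simp only: torus_ker_def fT fg) (simp add: fT)
  qed
  have "bij_betw ?g (carrier ?K') (carrier ?K)"
    by (rule bij_betw_byWitness[where f' = ?f])
      (use gK fg fT eq in \<open>auto simp: torus_ker_def simp del: fun_upd_apply\<close>)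
  moreover have "?g \<in> hom ?K' ?K"
  proof (rule homI)
    fix x y assume xy: "x \<in> carrier ?K'" "y \<in> carrier ?K'"
    show "?g (x \<otimes>\<^bsub>?K'\<^esub> y) = ?g x \<otimes>\<^bsub>?K\<^esub> ?g y"
      using assms by (auto simp: torus_ker_def mult_torus fun_eq_iff)
  qed (rule gK)
  ultimately show ?thesis by (auto simp: is_iso_def iso_def)
qed

text \<open>Where Euclid's algorithm stops: the character is \<open>t \<mapsto> t_(i0)^g\<close>, so
  the coordinate at \<open>i\<^sub>0\<close> is a \<open>g\<close>-th root of unity and the other
  \<open>n - 1\<close> coordinates are free.\<close>

lemma torus_ker_single:
  assumes i0: "i\<^sub>0 \<in> {1..n}" and z: "\<And>i. i \<in> {1..n} \<Longrightarrow> i \<noteq> i\<^sub>0 \<Longrightarrow> a i = 0" and g: "a i\<^sub>0 = g" "g > 0"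
  shows "(torus (n - 1) :: (nat \<Rightarrow> 'a::{alg_closed_field, field_char_0}) monoid) \<times>\<times> integer_mod_group g \<cong>
    (torus_ker n a :: (nat \<Rightarrow> 'a) monoid)"
proof -
  obtain \<zeta> :: 'a where \<zeta>: "\<zeta> ^ i = 1 \<longleftrightarrow> g dvd i" for i
    using primitive_root_of_unity_exists[OF g(2)] by blast
  have \<zeta>0: "\<zeta> \<noteq> 0" using \<zeta>[of g] g by (auto simp: power_0_left)
  have \<zeta>mod: "\<zeta> ^ (i mod g) = \<zeta> ^ i" for i
  proof -
    have "\<zeta> ^ i = \<zeta> ^ (g * (i div g) + i mod g)" by simp
    also have "\<dots> = \<zeta> ^ (i mod g)" by (subst power_add) (simp add: \<zeta>)
    finally show ?thesis by simp
  qed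
  \<comment> \<open>The smaller torus has no index \<open>n\<close>, and the slot
    \<open>i\<^sub>0\<close> is taken by the root of unity; so coordinate \<open>n\<close> of the
    kernel element is stored at index \<open>i\<^sub>0\<close> of \<open>s\<close>. If
    \<open>i\<^sub>0 = n\<close>, the indices already match.\<close>
  let ?f = "\<lambda>(s :: nat \<Rightarrow> 'a, c :: int). \<lambda>i\<in>{1..n}. if i = i\<^sub>0 then \<zeta> ^ nat c else if i = n then s i\<^sub>0 else s i"
  let ?Q = "(torus (n - 1) :: (nat \<Rightarrow> 'a) monoid) \<times>\<times> integer_mod_group g"
  have ker: "carrier (torus_ker n a) = {t \<in> carrier (torus n). t i\<^sub>0 ^ g = (1::'a)}"
  proof -
    have "(\<Prod>i\<in>{1..n}. t i ^ a i) = t i\<^sub>0 ^ g" for t :: "nat \<Rightarrow> 'a"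
      using i0 z g by (simp add: prod.remove[of _ i\<^sub>0])
    then show ?thesis by (simp add: torus_ker_def)
  qed
  have Q: "carrier ?Q = ({1..n-1} \<rightarrow>\<^sub>E {x. x \<noteq> 0}) \<times> {0..<int g}"
    using g by (auto simp: DirProd_def carrier_torus carrier_integer_mod_group)
  have pow: "(\<zeta> ^ k) ^ g = 1" for k
  proof -
    have "\<zeta> ^ g = 1" by (simp add: \<zeta>)
    then show ?thesis by (metis power_mult power_one mult.commute)
  qed
  have fc: "?f x \<in> carrier (torus_ker n a)" if "x \<in> carrier ?Q" for x
  proof -
    obtain s c where x: "x = (s, c)" "s \<in> {1..n-1} \<rightarrow>\<^sub>E {x. x \<noteq> 0}"
      using \<open>x \<in> carrier ?Q\<close> unfolding Q by auto
    have "(if i = i\<^sub>0 then \<zeta> ^ nat c else if i = n then s i\<^sub>0 else s i) \<noteq> 0" if "i \<in> {1..n}" for i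
    proof -
      have "j \<in> {1..n-1} \<Longrightarrow> s j \<noteq> 0" for j using x(2) by (auto dest: PiE_mem)
      moreover have "i \<noteq> i\<^sub>0 \<Longrightarrow> i = n \<Longrightarrow> i\<^sub>0 \<in> {1..n-1}" "i \<noteq> n \<Longrightarrow> i \<in> {1..n-1}"
        using that i0 by auto
      ultimately show ?thesis using \<zeta>0 by auto
    qed
    then show ?thesis using i0 pow by (simp add: ker carrier_torus x(1) PiE_iff)
  qed
  have "?f \<in> hom ?Q (torus_ker n a)"
  proof (rule homI)
    fix x y assume "x \<in> carrier ?Q" "y \<in> carrier ?Q"
    then obtain s c s' c' where xy: "x = (s, c)" "y = (s', c')" "c \<in> {0..<int g}" "c' \<in> {0..<int g}"
      unfolding Q by auto
    have "nat ((c + c') mod int g) = (nat c + nat c') mod g"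
      using xy by (simp add: nat_mod_distrib nat_add_distrib)
    then have "\<zeta> ^ nat ((c + c') mod int g) = \<zeta> ^ nat c * \<zeta> ^ nat c'"
      by (simp add: \<zeta>mod flip: power_add)
    then show "?f (x \<otimes>\<^bsub>?Q\<^esub> y) = ?f x \<otimes>\<^bsub>torus_ker n a\<^esub> ?f y"
      using i0 by (auto simp: xy DirProd_def torus_ker_def mult_torus fun_eq_iff)
  qed (rule fc)
  moreover have "bij_betw ?f (carrier ?Q) (carrier (torus_ker n a))"
  proof (rule bij_betw_imageI)
    show "inj_on ?f (carrier ?Q)"
    proof (rule inj_onI)
      fix x y assume "x \<in> carrier ?Q" "y \<in> carrier ?Q" and eq: "?f x = ?f y"
      then obtain s c s' c' where xy: "x = (s, c)" "y = (s', c')" "c \<in> {0..<int g}" "c' \<in> {0..<int g}"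
        and s: "s \<in> extensional {1..n-1}" "s' \<in> extensional {1..n-1}"
        unfolding Q by (auto simp: PiE_iff)
      have fi: "(if i = i\<^sub>0 then \<zeta> ^ nat c else if i = n then s i\<^sub>0 else s i) =
          (if i = i\<^sub>0 then \<zeta> ^ nat c' else if i = n then s' i\<^sub>0 else s' i)" if "i \<in> {1..n}" for i
        using fun_cong[OF eq, of i] that by (simp add: xy)
      have "\<zeta> ^ nat c = \<zeta> ^ nat c'" using fi[OF i0] by simp
      have le: "b \<le> a" if "\<zeta> ^ a = \<zeta> ^ b" "a < g" "b < g" for a b :: nat
      proof (rule ccontr)
        assume "\<not> b \<le> a"
        then have "\<zeta> ^ b = \<zeta> ^ a * \<zeta> ^ (b - a)" by (simp flip: power_add)
        then have "\<zeta> ^ (b - a) = 1" using \<zeta>0 that by simp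
        then have "g dvd b - a" by (simp add: \<zeta>)
        then show False using that \<open>\<not> b \<le> a\<close> by (auto dest: dvd_imp_le)
      qed
      have "nat c = nat c'"
        using xy le[of "nat c" "nat c'"] le[of "nat c'" "nat c"] \<open>\<zeta> ^ nat c = \<zeta> ^ nat c'\<close> g
        by (intro antisym) auto
      then have "c = c'" using xy by auto
      moreover have "s = s'"
      proof (rule extensionalityI[OF s])
        fix i assume i: "i \<in> {1..n-1}"
        show "s i = s' i"
        proof (cases "i = i\<^sub>0")
          case True
          then have "n \<noteq> i\<^sub>0" "n \<in> {1..n}" using i i0 by auto
          then show ?thesis using fi[of n] True by simp
        next
          case False
          moreover have "i \<noteq> n" "i \<in> {1..n}" using i i0 by auto
          ultimately show ?thesis using fi[of i] by simp
        qed
      qed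
      ultimately show "x = y" by (simp add: xy)
    qed
    have surj: "t \<in> ?f ` carrier ?Q" if "t \<in> carrier (torus_ker n a)" for t
    proof -
      have t: "t \<in> {1..n} \<rightarrow>\<^sub>E {x. x \<noteq> 0}" "t i\<^sub>0 ^ g = 1"
        using that by (auto simp: ker carrier_torus)
      obtain c where c: "c < g" "t i\<^sub>0 = \<zeta> ^ c" using roots_of_unity_powers[OF g(2) \<zeta> t(2)] by blast
      define s where "s = (\<lambda>i\<in>{1..n-1}. if i = i\<^sub>0 then t n else t i)"
      have n: "n \<in> {1..n}" using i0 by auto
      have mem: "(s, int c) \<in> carrier ?Q" using t c n unfolding Q by (auto simp: s_def PiE_iff)
      have "?f (s, int c) = t"
      proof (rule extensionalityI[where A = "{1..n}"])
        fix i assume "i \<in> {1..n}"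
        then show "?f (s, int c) i = t i" using c i0 by (auto simp: s_def)
      qed (use t in \<open>auto simp: PiE_iff\<close>)
      then show ?thesis by (intro image_eqI[OF _ mem]) (rule sym)
    qed
    show "?f ` carrier ?Q = carrier (torus_ker n a)"
      by (intro equalityI image_subsetI subsetI fc surj)
  qed
  ultimately have "?f \<in> iso ?Q (torus_ker n a)" unfolding iso_def by blast
  then show ?thesis by (rule is_isoI)
qed

text \<open>Induction on the sum of the exponents. A Euclidean step lowers the sum, changes the
  kernel only by an isomorphism and preserves the gcd; it is available as long as two exponents are
  positive.\<close>

lemma torus_ker_iso:
  assumes "\<exists>i\<in>{1..n}. a i > 0"
  shows "(torus (n - 1) :: (nat \<Rightarrow> 'a::{alg_closed_field, field_char_0}) monoid) \<times>\<times>
    integer_mod_group (Gcd (a ` {1..n})) \<cong> (torus_ker n a :: (nat \<Rightarrow> 'a) monoid)"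
  using assms
proof (induction "\<Sum>i\<in>{1..n}. a i" arbitrary: a rule: less_induct)
  case (less a)
  show ?case
  proof (cases "\<exists>i\<in>{1..n}. \<exists>j\<in>{1..n}. i \<noteq> j \<and> a j \<le> a i \<and> a j > 0")
    case True
    then obtain i j where ij: "i \<in> {1..n}" "j \<in> {1..n}" "i \<noteq> j" "a j \<le> a i" "a j > 0" by blast
    define a' where "a' = a(i := a i - a j)"
    have "(\<Sum>l\<in>{1..n}. a' l) < (\<Sum>l\<in>{1..n}. a l)"
      using ij by (intro sum_strict_mono_ex1) (auto simp: a'_def intro!: bexI[of _ i])
    moreover have "\<exists>l\<in>{1..n}. a' l > 0" using ij by (intro bexI[of _ j]) (auto simp: a'_def)
    ultimately have IH: "(torus (n - 1) :: (nat \<Rightarrow> 'a) monoid) \<times>\<times> integer_mod_group (Gcd (a' ` {1..n})) \<cong> (torus_ker n a' :: (nat \<Rightarrow> 'a) monoid)"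
      by (rule less.hyps[rule_format])
    have "Gcd (a' ` {1..n}) = Gcd (a ` {1..n})"
    proof (rule dvd_antisym)
      show "Gcd (a' ` {1..n}) dvd Gcd (a ` {1..n})"
      proof (rule Gcd_greatest, clarify)
        fix l assume l: "l \<in> {1..n}"
        have *: "Gcd (a' ` {1..n}) dvd a' l" if "l \<in> {1..n}" for l using that by (intro Gcd_dvd) auto
        have "Gcd (a' ` {1..n}) dvd a' i + a' j" using *[of i] *[of j] ij by (intro dvd_add)
        then have "Gcd (a' ` {1..n}) dvd a i" using ij by (simp add: a'_def)
        then show "Gcd (a' ` {1..n}) dvd a l" using *[OF l] by (cases "l = i") (auto simp: a'_def)
      qed
      show "Gcd (a ` {1..n}) dvd Gcd (a' ` {1..n})"
      proof (rule Gcd_greatest, clarify)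
        fix l assume l: "l \<in> {1..n}"
        have *: "Gcd (a ` {1..n}) dvd a l" if "l \<in> {1..n}" for l using that by (intro Gcd_dvd) auto
        then show "Gcd (a ` {1..n}) dvd a' l" using *[OF l] *[of i] *[of j] ij
          by (cases "l = i") (auto simp: a'_def)
      qed
    qed
    with IH show ?thesis
      using iso_trans[OF _ torus_ker_shift[OF ij(1-4), where 'a = 'a, folded a'_def]] by simp
  next
    case False
    obtain i where i: "i \<in> {1..n}" "a i > 0" using less.prems by blast
    \<comment> \<open>Two positive exponents are comparable, so one could be subtracted from the
      other; hence only \<open>a i\<close> is positive.\<close>
    have z: "a j = 0" if "j \<in> {1..n}" "j \<noteq> i" for j
    proof (rule ccontr)
      assume "a j \<noteq> 0"
      with False i that show False by (metis linear neq0_conv)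
    qed
    have "Gcd (a ` {1..n}) = a i"
    proof (rule dvd_antisym)
      show "Gcd (a ` {1..n}) dvd a i" using i by (intro Gcd_dvd) auto
      show "a i dvd Gcd (a ` {1..n})"
      proof (rule Gcd_greatest, clarify)
        fix l assume "l \<in> {1..n}"
        then show "a i dvd a l" using z by (cases "l = i") auto
      qed
    qed
    then show ?thesis using torus_ker_single[where n = n and a = a, OF i(1) z refl i(2)] by simp
  qed
qed

abbreviation "lookup \<equiv> Poly_Mapping.lookup"
abbreviation "keys \<equiv> Poly_Mapping.keys"
abbreviation "single \<equiv> Poly_Mapping.single"

subsection \<open>Evaluation homomorphisms\<close>

lemma poly_mapping_sum_single:
  fixes p :: "'b \<Rightarrow>\<^sub>0 'c::comm_monoid_add"
  shows "p = (\<Sum>x\<in>keys p. single x (lookup p x))"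
  by (rule poly_mapping_eqI) (auto simp: lookup_sum lookup_single when_def in_keys_iff)

text \<open>The premise \<open>x \<in> keys p\<close> lets the monomial case use what is known about
  the support of the original \<open>p\<close>, as in the induction rules for subrings defined by
  conditions on the support.\<close>

lemma poly_mapping_induct_sum [case_names zero single add]:
  fixes p :: "'b \<Rightarrow>\<^sub>0 'c::comm_monoid_add"
  assumes "Q 0" and s: "\<And>x c. x \<in> keys p \<Longrightarrow> Q (single x c)" and a: "\<And>p q. Q p \<Longrightarrow> Q q \<Longrightarrow> Q (p + q)"
  shows "Q p"
proof -
  have "Q (\<Sum>x\<in>S. single x (lookup p x))" if "finite S" "S \<subseteq> keys p" for S
    using that by (induction S) (auto intro: assms)
  then show ?thesis by (subst poly_mapping_sum_single) auto
qed

text \<open>Linear extension of \<open>f\<close> from monomials, with \<open>c\<close> applied to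
  the coefficients. The exponent type is left open because exponents are natural for polynomials and
  integral for Laurent polynomials.\<close>

definition pm_eval :: "('c::zero \<Rightarrow> 'r::comm_ring_1) \<Rightarrow> ('b \<Rightarrow> 'r) \<Rightarrow> ('b \<Rightarrow>\<^sub>0 'c) \<Rightarrow> 'r"
  where "pm_eval c f p = (\<Sum>x\<in>keys p. c (lookup p x) * f x)"

locale pm_eval_hom =
  fixes c :: "'c::comm_ring_1 \<Rightarrow> 'r::comm_ring_1" and f :: "'b::comm_monoid_add \<Rightarrow> 'r"
  assumes c_1 [simp]: "c 1 = 1" and c_add: "c (x + y) = c x + c y" and c_mult: "c (x * y) = c x * c y"
    and f_0 [simp]: "f 0 = 1" and f_add: "f (\<mu> + \<nu>) = f \<mu> * f \<nu>"
begin

lemma c_0 [simp]: "c 0 = 0"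
  using c_add[of 0 0] by simp

lemma eval_0 [simp]: "pm_eval c f 0 = 0"
  by (simp add: pm_eval_def)

lemma eval_single [simp]: "pm_eval c f (single \<mu> a) = c a * f \<mu>"
  by (simp add: pm_eval_def)

lemma eval_superset:
  assumes "finite S" "keys p \<subseteq> S"
  shows "pm_eval c f p = (\<Sum>x\<in>S. c (lookup p x) * f x)"
  unfolding pm_eval_def using assms by (intro sum.mono_neutral_left) (auto simp: in_keys_iff)

lemma eval_add [simp]: "pm_eval c f (p + q) = pm_eval c f p + pm_eval c f q"
proof -
  let ?S = "keys p \<union> keys q"
  have "keys (p + q) \<subseteq> ?S" by (rule keys_add)
  then have "pm_eval c f (p + q) = (\<Sum>x\<in>?S. c (lookup (p + q) x) * f x)"
    by (intro eval_superset) auto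
  also have "\<dots> = (\<Sum>x\<in>?S. c (lookup p x) * f x) + (\<Sum>x\<in>?S. c (lookup q x) * f x)"
    by (simp add: lookup_add c_add algebra_simps sum.distrib)
  also have "\<dots> = pm_eval c f p + pm_eval c f q"
    by (subst (1 2) eval_superset[of ?S]) auto
  finally show ?thesis .
qed

lemma eval_1 [simp]: "pm_eval c f 1 = 1"
  by (simp flip: single_one)

lemma eval_mult [simp]: "pm_eval c f (p * q) = pm_eval c f p * pm_eval c f q"
proof (induction p rule: poly_mapping_induct_sum)
  case (single \<mu> a)
  show ?case
  proof (induction q rule: poly_mapping_induct_sum)
    case (single \<nu> b)
    show ?case by (simp add: mult_single c_mult f_add mult_ac)
  qed (simp_all add: algebra_simps)
qed (simp_all add: algebra_simps)

lemma eval_minus [simp]: "pm_eval c f (- p) = - pm_eval c f p"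
  using eval_add[of p "- p"] by (simp add: add_eq_0_iff)

lemma eval_diff [simp]: "pm_eval c f (p - q) = pm_eval c f p - pm_eval c f q"
  using eval_add[of p "- q"] by simp

lemma eval_power [simp]: "pm_eval c f (p ^ n) = pm_eval c f p ^ n"
  by (induction n) auto

lemma eval_prod [simp]: "pm_eval c f (\<Prod>i\<in>S. g i) = (\<Prod>i\<in>S. pm_eval c f (g i))"
  by (induction S rule: infinite_finite_induct) auto

lemma eval_sum [simp]: "pm_eval c f (\<Sum>i\<in>S. g i) = (\<Sum>i\<in>S. pm_eval c f (g i))"
  by (induction S rule: infinite_finite_induct) auto

end

subsection \<open>Laurent polynomials\<close>

type_synonym 'a laurent = "(nat \<Rightarrow>\<^sub>0 int) \<Rightarrow>\<^sub>0 'a"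

definition lconst :: "'a::zero \<Rightarrow> 'a laurent"
  where "lconst c = single 0 c"

definition lvar :: "nat \<Rightarrow> 'a::zero_neq_one laurent"
  where "lvar j = single (single j 1) 1"

lemma lconst_hom [simp]:
  "lconst 0 = 0" "lconst 1 = (1 :: 'a::comm_ring_1 laurent)"
  "lconst (a + b) = lconst a + (lconst b :: 'a::comm_ring_1 laurent)"
  "lconst (a * b) = lconst a * (lconst b :: 'a::comm_ring_1 laurent)"
  "lconst (- a) = - (lconst a :: 'a::comm_ring_1 laurent)"
  "lconst (a - b) = lconst a - (lconst b :: 'a::comm_ring_1 laurent)"
  by (simp_all add: lconst_def single_add mult_single single_uminus single_diff)

lemma lconst_power [simp]: "lconst (a ^ n) = (lconst a ^ n :: 'a::comm_ring_1 laurent)"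
  by (induction n) auto

lemma lconst_prod: "lconst (\<Prod>i\<in>S. f i) = (\<Prod>i\<in>S. lconst (f i) :: 'a::comm_ring_1 laurent)"
  by (induction S rule: infinite_finite_induct) auto

lemma lconst_of_nat [simp]: "lconst (of_nat n) = (of_nat n :: 'a::comm_ring_1 laurent)"
  by (induction n) auto

lemma lconst_eq_iff [simp]: "lconst a = lconst b \<longleftrightarrow> a = b"
  unfolding lconst_def by (metis lookup_single_eq)

lemma lconst_eq_0_iff [simp]: "lconst a = 0 \<longleftrightarrow> a = 0"
  using lconst_eq_iff[of a 0] by (simp del: lconst_eq_iff)

lemma lconst_mult_single: "lconst a * single \<nu> b = (single \<nu> (a * b) :: 'a::comm_ring_1 laurent)"
  by (simp add: lconst_def mult_single)

lemma prod_single_1: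
  "(\<Prod>i\<in>S. single (e i) (1::'a::comm_ring_1)) = single (\<Sum>i\<in>S. (e i :: 'b::comm_monoid_add)) 1"
  by (induction S rule: infinite_finite_induct) (auto simp: mult_single simp flip: single_one)

lemma power_single_1: "single (e :: 'b \<Rightarrow>\<^sub>0 int) (1::'a::comm_ring_1) ^ n = single (frag_cmul (int n) e) 1"
  by (induction n) (auto simp: mult_single frag_cmul_distrib algebra_simps simp flip: single_one)

lemma prod_lvar_power:
  "(\<Prod>i\<in>S. lvar i ^ n i) = (single (\<Sum>i\<in>S. single i (int (n i))) 1 :: 'a::comm_ring_1 laurent)"
proof -
  have "lvar i ^ n i = (single (single i (int (n i))) 1 :: 'a laurent)" for i
    unfolding lvar_def power_single_1
    by (rule arg_cong[where f = "\<lambda>e. single e 1"], rule poly_mapping_eqI) (auto simp: lookup_single when_def)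
  then show ?thesis by (simp add: prod_single_1)
qed

text \<open>The polynomial ring \<open>A\<close> inside the Laurent ring; it turns out to be the
  kernel of the derivation.\<close>

definition lpos :: "nat \<Rightarrow> 'a::zero laurent set"
  where "lpos m = {p. \<forall>\<nu>\<in>keys p. keys \<nu> \<subseteq> {2..m} \<and> (\<forall>i. 0 \<le> lookup \<nu> i)}"

lemma lpos_add: "p \<in> lpos m \<Longrightarrow> q \<in> lpos m \<Longrightarrow> p + q \<in> lpos m"
  for p q :: "'a::comm_ring_1 laurent"
  using keys_add[of p q] by (auto simp: lpos_def)

lemma lpos_minus: "p \<in> lpos m \<Longrightarrow> - p \<in> lpos m"
  for p :: "'a::comm_ring_1 laurent"
  by (auto simp: lpos_def in_keys_iff)

lemma lpos_mult: "p \<in> lpos m \<Longrightarrow> q \<in> lpos m \<Longrightarrow> p * q \<in> lpos m"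
  for p q :: "'a::comm_ring_1 laurent"
proof -
  assume p: "p \<in> lpos m" and q: "q \<in> lpos m"
  show ?thesis unfolding lpos_def
  proof (clarify, intro conjI allI)
    fix \<nu> assume "\<nu> \<in> keys (p * q)"
    then obtain a b where "\<nu> = a + b" "a \<in> keys p" "b \<in> keys q" using keys_mult[of p q] by blast
    moreover from this have "keys \<nu> \<subseteq> keys a \<union> keys b" using keys_add[of a b] by simp
    ultimately show "keys \<nu> \<subseteq> {2..m}" "0 \<le> lookup \<nu> i" for i
      using p q by (fastforce simp: lpos_def lookup_add)+
  qed
qed

lemma lpos_single: "keys \<nu> \<subseteq> {2..m} \<Longrightarrow> (\<And>i. 0 \<le> lookup \<nu> i) \<Longrightarrow> single \<nu> c \<in> lpos m"
  by (auto simp: lpos_def)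

lemma lpos_const [simp]: "lconst c \<in> lpos m"
  by (auto simp: lpos_def lconst_def)

lemma lpos_0 [simp]: "0 \<in> lpos m" and lpos_1 [simp]: "1 \<in> (lpos m :: 'a::comm_ring_1 laurent set)"
  using lpos_const[of 0 m] lpos_const[of "1 :: 'a" m] by (simp_all add: lconst_def)

lemma lpos_lvar: "j \<in> {2..m} \<Longrightarrow> lvar j \<in> lpos m"
  by (auto simp: lpos_def lvar_def lookup_single when_def)

lemma lpos_power: "p \<in> lpos m \<Longrightarrow> p ^ n \<in> lpos m" for p :: "'a::comm_ring_1 laurent"
  by (induction n) (auto intro: lpos_mult)

lemma lpos_prod: "(\<And>i. i \<in> S \<Longrightarrow> f i \<in> lpos m) \<Longrightarrow> (\<Prod>i\<in>S. f i) \<in> lpos m"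
  for f :: "'b \<Rightarrow> 'a::comm_ring_1 laurent"
  by (induction S rule: infinite_finite_induct) (auto intro: lpos_mult)

lemma lpos_sum: "(\<And>i. i \<in> S \<Longrightarrow> f i \<in> lpos m) \<Longrightarrow> (\<Sum>i\<in>S. f i) \<in> lpos m"
  for f :: "'b \<Rightarrow> 'a::comm_ring_1 laurent"
  by (induction S rule: infinite_finite_induct) (auto intro: lpos_add)

text \<open>\<open>A\<close> is generated by the constants and \<open>y_2, ..., y_m\<close>; ring
  homomorphisms on \<open>A\<close> are compared through this rule.\<close>

lemma lpos_induct [consumes 1, case_names const add mult lvar]:
  fixes p :: "'a::comm_ring_1 laurent"
  assumes p: "p \<in> lpos m" and c: "\<And>c. Q (lconst c)"
    and a: "\<And>p q. p \<in> lpos m \<Longrightarrow> q \<in> lpos m \<Longrightarrow> Q p \<Longrightarrow> Q q \<Longrightarrow> Q (p + q)"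
    and t: "\<And>p q. p \<in> lpos m \<Longrightarrow> q \<in> lpos m \<Longrightarrow> Q p \<Longrightarrow> Q q \<Longrightarrow> Q (p * q)"
    and v: "\<And>j. j \<in> {2..m} \<Longrightarrow> Q (lvar j)"
  shows "Q p"
proof -
  have pw: "Q (lvar j ^ n)" if "j \<in> {2..m}" for j n
    by (induction n) (use that c[of 1] v t in \<open>auto intro!: t lpos_lvar lpos_power\<close>)
  have pr: "Q (\<Prod>j\<in>S. lvar j ^ n j)" if "finite S" "S \<subseteq> {2..m}" for S n
    using that
  proof (induction S)
    case (insert j S)
    then show ?case by (auto intro!: t pw lpos_power lpos_lvar lpos_prod)
  qed (use c[of 1] in auto)
  have "p \<in> lpos m \<and> Q p"
  proof (induction p rule: poly_mapping_induct_sum)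
    case (single \<nu> c)
    with p have \<nu>: "keys \<nu> \<subseteq> {2..m}" "0 \<le> lookup \<nu> i" for i by (auto simp: lpos_def)
    \<comment> \<open>Nonnegative exponents survive the passage through \<open>nat\<close>, so the
      monomial is an honest product of powers of variables.\<close>
    have "\<nu> = (\<Sum>i\<in>keys \<nu>. single i (int (nat (lookup \<nu> i))))"
      using \<nu> by (subst poly_mapping_sum_single) simp
    then have eq: "single \<nu> c = lconst c * (\<Prod>j\<in>keys \<nu>. lvar j ^ nat (lookup \<nu> j))"
      unfolding prod_lvar_power lconst_mult_single by simp
    show ?case
      using \<nu> unfolding eq by (intro conjI t pr lpos_mult lpos_prod lpos_power lpos_lvar c lpos_const) auto
  qed (use c[of 0] a in \<open>auto intro: lpos_add\<close>)
  then show ?thesis by blast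
qed


subsection \<open>Monomial substitutions\<close>

definition lchar :: "(nat \<Rightarrow> 'a::field) \<Rightarrow> (nat \<Rightarrow>\<^sub>0 int) \<Rightarrow> 'a"
  where "lchar l \<nu> = (\<Prod>i\<in>keys \<nu>. l i powi lookup \<nu> i)"

text \<open>The substitution \<open>y_j \<mapsto> l j y_(\<sigma> j)\<close>:
  \<open>frag_extend\<close> carries exponent vectors along \<open>\<sigma>\<close>, and
  \<open>lchar l \<nu>\<close> is the value at \<open>l\<close> of the monomial with exponent
  \<open>\<nu>\<close>. On Laurent monomials this is multiplicative once no \<open>l i\<close>
  vanishes.\<close>

definition lsub :: "(nat \<Rightarrow> nat) \<Rightarrow> (nat \<Rightarrow> 'a::field) \<Rightarrow> 'a laurent \<Rightarrow> 'a laurent"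
  where "lsub \<sigma> l = pm_eval lconst (\<lambda>\<nu>. single (frag_extend (\<lambda>i. frag_of (\<sigma> i)) \<nu>) (lchar l \<nu>))"

lemma lchar_add:
  assumes "\<And>i. l i \<noteq> 0"
  shows "lchar l (\<mu> + \<nu>) = lchar l \<mu> * lchar l \<nu>"
proof -
  let ?S = "keys \<mu> \<union> keys \<nu>"
  have sup: "lchar l \<xi> = (\<Prod>i\<in>?S. l i powi lookup \<xi> i)" if "keys \<xi> \<subseteq> ?S" for \<xi>
    unfolding lchar_def using that by (intro prod.mono_neutral_left) (auto simp: in_keys_iff)
  have "lchar l (\<mu> + \<nu>) = (\<Prod>i\<in>?S. l i powi lookup (\<mu> + \<nu>) i)"
    by (rule sup[OF keys_add])
  also have "\<dots> = lchar l \<mu> * lchar l \<nu>"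
    using assms by (simp add: sup lookup_add power_int_add prod.distrib)
  finally show ?thesis .
qed

lemma pm_eval_hom_lsub:
  assumes "\<And>i. l i \<noteq> 0"
  shows "pm_eval_hom lconst (\<lambda>\<nu>. single (frag_extend (\<lambda>i. frag_of (\<sigma> i)) \<nu>) (lchar l \<nu>))"
  using assms by unfold_locales (simp_all add: lchar_add mult_single frag_extend_add, simp add: lchar_def)

context
  fixes l :: "nat \<Rightarrow> 'a::field" and \<sigma> :: "nat \<Rightarrow> nat"
  assumes l: "\<And>i. l i \<noteq> 0"
begin

interpretation pm_eval_hom lconst "\<lambda>\<nu>. single (frag_extend (\<lambda>i. frag_of (\<sigma> i)) \<nu>) (lchar l \<nu>)"
  by (rule pm_eval_hom_lsub) (rule l)

lemma lsub_hom [simp]: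
  "lsub \<sigma> l 0 = 0" "lsub \<sigma> l 1 = 1" "lsub \<sigma> l (p + q) = lsub \<sigma> l p + lsub \<sigma> l q"
  "lsub \<sigma> l (p * q) = lsub \<sigma> l p * lsub \<sigma> l q" "lsub \<sigma> l (- p) = - lsub \<sigma> l p"
  "lsub \<sigma> l (p - q) = lsub \<sigma> l p - lsub \<sigma> l q" "lsub \<sigma> l (p ^ n) = lsub \<sigma> l p ^ n"
  "lsub \<sigma> l (prod g S) = (\<Prod>i\<in>S. lsub \<sigma> l (g i))"
  by (simp_all add: lsub_def)

lemma lsub_lconst [simp]: "lsub \<sigma> l (lconst c) = lconst c"
  by (simp add: lsub_def lconst_def[of c]) (simp add: lconst_def lchar_def)

lemma lsub_lvar [simp]: "lsub \<sigma> l (lvar j) = lconst (l j) * lvar (\<sigma> j)"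
  by (simp add: lsub_def lvar_def[of j]) (simp add: lvar_def lconst_mult_single lchar_def)

lemma lsub_lpos:
  assumes "\<sigma> ` {2..m} \<subseteq> {2..m}" "p \<in> lpos m"
  shows "lsub \<sigma> l p \<in> lpos m"
  using assms(2)
proof (induction p rule: lpos_induct)
  case (lvar j)
  with assms(1) show ?case by (auto intro!: lpos_mult lpos_lvar)
qed (auto intro: lpos_add lpos_mult)

end

subsection \<open>Polynomials in a given set of variables\<close>

text \<open>Needed for two sets of variables: \<open>{0..m}\<close> for the full polynomial ring and
  \<open>{2..m}\<close> for the coefficients of normal forms.\<close>

definition mpoly_on :: "nat set \<Rightarrow> 'a::comm_ring_1 mpoly set"
  where "mpoly_on V = {p. \<forall>\<mu>\<in>keys p. keys \<mu> \<subseteq> V}"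

lemma mconst_hom [simp]:
  "mconst 0 = 0" "mconst 1 = 1" "mconst (a + b) = mconst a + mconst b"
  "mconst (a * b) = mconst a * mconst b" "mconst (- a) = - mconst a" "mconst (a - b) = mconst a - mconst b"
  by (simp_all add: mconst_def single_add mult_single single_uminus single_diff)

lemma mpoly_on_add: "p \<in> mpoly_on V \<Longrightarrow> q \<in> mpoly_on V \<Longrightarrow> p + q \<in> mpoly_on V"
  using keys_add[of p q] by (auto simp: mpoly_on_def)

lemma mpoly_on_minus: "p \<in> mpoly_on V \<Longrightarrow> - p \<in> mpoly_on V"
  by (auto simp: mpoly_on_def in_keys_iff)

lemma mpoly_on_diff: "p \<in> mpoly_on V \<Longrightarrow> q \<in> mpoly_on V \<Longrightarrow> p - q \<in> mpoly_on V"
  using mpoly_on_add[of p V "- q"] mpoly_on_minus[of q V] by simp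

lemma mpoly_on_mult:
  assumes p: "p \<in> mpoly_on V" and q: "q \<in> mpoly_on V"
  shows "p * q \<in> mpoly_on V"
  unfolding mpoly_on_def
proof clarify
  fix \<nu> x assume "\<nu> \<in> keys (p * q)" and x: "x \<in> keys \<nu>"
  then obtain a b where "\<nu> = a + b" "a \<in> keys p" "b \<in> keys q" using keys_mult[of p q] by blast
  moreover from this have "keys \<nu> \<subseteq> keys a \<union> keys b" using keys_add[of a b] by simp
  ultimately show "x \<in> V" using p q x by (auto simp: mpoly_on_def)
qed

lemma mpoly_on_mconst [simp]: "mconst c \<in> mpoly_on V"
  by (auto simp: mpoly_on_def mconst_def)

lemma mpoly_on_0 [simp]: "0 \<in> mpoly_on V" and mpoly_on_1 [simp]: "1 \<in> mpoly_on V"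
  using mpoly_on_mconst[of 0 V] mpoly_on_mconst[of 1 V] by simp_all

lemma mpoly_on_mvar: "i \<in> V \<Longrightarrow> mvar i \<in> mpoly_on V"
  by (auto simp: mpoly_on_def mvar_def)

lemma mpoly_on_power: "p \<in> mpoly_on V \<Longrightarrow> p ^ n \<in> mpoly_on V"
  by (induction n) (auto intro: mpoly_on_mult)

lemma mpoly_on_prod: "(\<And>i. i \<in> S \<Longrightarrow> f i \<in> mpoly_on V) \<Longrightarrow> (\<Prod>i\<in>S. f i) \<in> mpoly_on V"
  by (induction S rule: infinite_finite_induct) (auto intro: mpoly_on_mult)

lemma mpoly_on_mono: "p \<in> mpoly_on V \<Longrightarrow> V \<subseteq> V' \<Longrightarrow> p \<in> mpoly_on V'"
  by (auto simp: mpoly_on_def)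

lemma mvar_power: "mvar i ^ n = (single (single i n) 1 :: 'a::comm_ring_1 mpoly)"
  by (induction n) (auto simp: mvar_def mult_single simp flip: single_add)

lemma mpoly_on_induct [consumes 1, case_names const add mult mvar]:
  fixes p :: "'a::comm_ring_1 mpoly"
  assumes p: "p \<in> mpoly_on V" and c: "\<And>c. Q (mconst c)"
    and a: "\<And>p q. p \<in> mpoly_on V \<Longrightarrow> q \<in> mpoly_on V \<Longrightarrow> Q p \<Longrightarrow> Q q \<Longrightarrow> Q (p + q)"
    and t: "\<And>p q. p \<in> mpoly_on V \<Longrightarrow> q \<in> mpoly_on V \<Longrightarrow> Q p \<Longrightarrow> Q q \<Longrightarrow> Q (p * q)"
    and v: "\<And>j. j \<in> V \<Longrightarrow> Q (mvar j)"
  shows "Q p"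
proof -
  have pw: "Q (mvar j ^ n)" if "j \<in> V" for j n
    by (induction n) (use that c[of 1] v t in \<open>auto intro!: t mpoly_on_mvar mpoly_on_power\<close>)
  have pr: "Q (\<Prod>j\<in>S. mvar j ^ n j)" if "finite S" "S \<subseteq> V" for S n
    using that
  proof (induction S)
    case (insert j S)
    then show ?case by (auto intro!: t pw mpoly_on_power mpoly_on_mvar mpoly_on_prod)
  qed (use c[of 1] in auto)
  have "p \<in> mpoly_on V \<and> Q p"
  proof (induction p rule: poly_mapping_induct_sum)
    case (single \<nu> c)
    with p have \<nu>: "keys \<nu> \<subseteq> V" by (auto simp: mpoly_on_def)
    have "(\<Prod>j\<in>keys \<nu>. mvar j ^ lookup \<nu> j) = (single \<nu> 1 :: 'a mpoly)"
      unfolding mvar_power prod_single_1 by (subst (3) poly_mapping_sum_single) simp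
    then have eq: "single \<nu> c = mconst c * (\<Prod>j\<in>keys \<nu>. mvar j ^ lookup \<nu> j)"
      by (simp add: mconst_def mult_single)
    show ?case
      unfolding eq using \<nu>
      by (intro conjI t pr mpoly_on_mult mpoly_on_prod mpoly_on_power mpoly_on_mvar c mpoly_on_mconst) auto
  qed (use c[of 0] a in \<open>auto intro: mpoly_on_add\<close>)
  then show ?thesis by blast
qed

lemma mpoly_ring_simps [simp]:
  "carrier (mpoly_ring m) = mpoly_on {0..m}" "monoid.mult (mpoly_ring m) = (*)"
  "one (mpoly_ring m) = 1" "zero (mpoly_ring m) = 0" "add (mpoly_ring m) = (+)"
  by (simp_all add: mpoly_ring_def mpoly_on_def)

lemma cring_mpoly_ring: "cring (mpoly_ring m :: 'a::comm_ring_1 mpoly ring)" (is "cring ?R")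
proof (rule cringI)
  show "abelian_group ?R"
  proof (rule abelian_groupI)
    fix x :: "'a mpoly" assume "x \<in> carrier ?R"
    then show "\<exists>y\<in>carrier ?R. y \<oplus>\<^bsub>?R\<^esub> x = \<zero>\<^bsub>?R\<^esub>"
      by (intro bexI[of _ "- x"]) (auto intro: mpoly_on_minus)
  qed (auto intro: mpoly_on_add)
  show "Group.comm_monoid ?R"
    by (rule comm_monoidI) (auto intro: mpoly_on_mult simp: mult_ac)
qed (auto simp: algebra_simps)

lemma pm_eval_hom_mpoly:
  assumes "c 1 = 1" "\<And>x y. c (x + y) = c x + c y" "\<And>x y. c (x * y) = c x * c y"
  shows "pm_eval_hom c (\<lambda>\<mu> :: nat \<Rightarrow>\<^sub>0 nat. \<Prod>i\<in>keys \<mu>. g i ^ lookup \<mu> i)"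
proof (unfold_locales; (fact assms)?)
  fix \<mu> \<nu> :: "nat \<Rightarrow>\<^sub>0 nat"
  let ?S = "keys \<mu> \<union> keys \<nu>"
  have sup: "(\<Prod>i\<in>keys \<xi>. g i ^ lookup \<xi> i) = (\<Prod>i\<in>?S. g i ^ lookup \<xi> i)" if "keys \<xi> \<subseteq> ?S" for \<xi>
    using that by (intro prod.mono_neutral_left) (auto simp: in_keys_iff)
  show "(\<Prod>i\<in>keys (\<mu> + \<nu>). g i ^ lookup (\<mu> + \<nu>) i) =
      (\<Prod>i\<in>keys \<mu>. g i ^ lookup \<mu> i) * (\<Prod>i\<in>keys \<nu>. g i ^ lookup \<nu> i)"
    by (subst (1 2 3) sup) (auto simp: keys_add lookup_add power_add prod.distrib dest: subsetD[OF keys_add])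
qed simp

lemma map_poly_hom_add:
  assumes "f 0 = 0" "\<And>x y. f (x + y) = f x + f y"
  shows "map_poly f (p + q) = map_poly f p + map_poly f q"
  by (rule poly_eqI) (simp add: coeff_map_poly assms)

lemma map_poly_hom_mult:
  fixes f :: "'a::comm_ring_1 \<Rightarrow> 'b::comm_ring_1"
  assumes "f 0 = 0" "\<And>x y. f (x + y) = f x + f y" "\<And>x y. f (x * y) = f x * f y"
  shows "map_poly f (p * q) = map_poly f p * map_poly f q"
proof -
  have "f (sum g S) = (\<Sum>i\<in>S. f (g i))" for g :: "nat \<Rightarrow> 'a" and S
    by (induction S rule: infinite_finite_induct) (auto simp: assms)
  then show ?thesis by (intro poly_eqI) (simp add: coeff_map_poly assms coeff_mult)
qed

lemma map_poly_hom_pcompose: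
  fixes f :: "'a::comm_ring_1 \<Rightarrow> 'b::comm_ring_1"
  assumes "f 0 = 0" "\<And>x y. f (x + y) = f x + f y" "\<And>x y. f (x * y) = f x * f y"
  shows "map_poly f (pcompose p q) = pcompose (map_poly f p) (map_poly f q)"
  by (induction p)
    (simp_all add: pcompose_pCons map_poly_hom_add map_poly_hom_mult map_poly_pCons assms)

lemma subst_Z_0 [simp]: "subst_Z 0 = 0"
  by (simp add: subst_Z_def)

lemma subst_Z_pCons [simp]: "subst_Z (pCons a p) = mconst a + Zvar * subst_Z p"
  by (simp add: subst_Z_def map_poly_pCons)

lemma subst_Z_mpoly_on: "0 \<in> V \<Longrightarrow> subst_Z p \<in> mpoly_on V"
  by (induction p) (auto intro!: mpoly_on_add mpoly_on_mult mpoly_on_mvar)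

locale danielewski =
  fixes P :: "'a::field_char_0 poly" and k :: "nat \<Rightarrow> nat" and m :: nat
  assumes deg: "degree P \<ge> 2" and monic: "lead_coeff P = 1"
    and m: "m \<ge> 2" and k: "\<And>j. j \<in> {2..m} \<Longrightarrow> k j \<ge> 2"
begin

abbreviation d where "d \<equiv> degree P"
abbreviation B where "B \<equiv> dan_ring m k P"
abbreviation cls where "cls \<equiv> dan_class m k P"
abbreviation D where "D \<equiv> D_con m k P"
abbreviation MP :: "'a mpoly set" where "MP \<equiv> mpoly_on {0..m}"

definition rel :: "'a mpoly" where "rel = perm_monomial m k id - subst_Z P"

lemma rel_MP: "rel \<in> MP"
  using m by (auto simp: rel_def perm_monomial_def intro!: mpoly_on_diff mpoly_on_mult mpoly_on_prod mpoly_on_power mpoly_on_mvar subst_Z_mpoly_on)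

lemma ideal_eq: "dan_ideal m k P = {s * rel | s. s \<in> MP}"
  by (simp add: dan_ideal_def cgenideal_def flip: rel_def)

sublocale I: ideal "dan_ideal m k P" "mpoly_ring m"
  unfolding dan_ideal_def by (rule cring.cgenideal_ideal[OF cring_mpoly_ring]) (simp add: rel_MP flip: rel_def)

lemma cls_eq: "cls p = {s * rel + p | s. s \<in> MP}"
  by (auto simp: dan_class_def a_r_coset_def r_coset_def ideal_eq)

lemma cls_eq_iff:
  assumes "p \<in> MP" "q \<in> MP"
  shows "cls p = cls q \<longleftrightarrow> (\<exists>s\<in>MP. p - q = s * rel)"
proof
  assume "cls p = cls q"
  moreover have "p \<in> cls p" unfolding cls_eq by (auto intro!: exI[of _ 0])
  ultimately obtain s where "s \<in> MP" "p = s * rel + q" by (auto simp: cls_eq)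
  then show "\<exists>s\<in>MP. p - q = s * rel" by auto
next
  assume "\<exists>s\<in>MP. p - q = s * rel"
  then obtain s where s: "s \<in> MP" "p = s * rel + q" by (auto simp: algebra_simps)
  show "cls p = cls q"
  proof (rule Set.set_eqI)
    fix x
    have "x \<in> cls p \<longleftrightarrow> (\<exists>t\<in>MP. x = (t + s) * rel + q)"
      unfolding cls_eq s(2) by (auto simp: algebra_simps)
    also have "\<dots> \<longleftrightarrow> (\<exists>t\<in>MP. x = t * rel + q)"
    proof
      assume "\<exists>t\<in>MP. x = t * rel + q"
      then obtain t where "t \<in> MP" "x = ((t - s) + s) * rel + q" by auto
      then show "\<exists>t\<in>MP. x = (t + s) * rel + q" using mpoly_on_diff[OF _ s(1)] by blast
    qed (use mpoly_on_add[OF _ s(1)] in blast)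
    finally show "x \<in> cls p \<longleftrightarrow> x \<in> cls q" by (auto simp: cls_eq)
  qed
qed

lemma carrier_B: "carrier B = cls ` MP"
  by (auto simp: dan_ring_def FactRing_def A_RCOSETS_def RCOSETS_def dan_class_def a_r_coset_def)

lemma cls_in_B [simp]: "p \<in> MP \<Longrightarrow> cls p \<in> carrier B"
  by (simp add: carrier_B)

lemma cls_add: "p \<in> MP \<Longrightarrow> q \<in> MP \<Longrightarrow> cls p \<oplus>\<^bsub>B\<^esub> cls q = cls (p + q)"
  using I.a_rcos_sum[of p q] by (simp add: dan_ring_def FactRing_def dan_class_def)

lemma cls_mult: "p \<in> MP \<Longrightarrow> q \<in> MP \<Longrightarrow> cls p \<otimes>\<^bsub>B\<^esub> cls q = cls (p * q)"
  using I.rcoset_mult_add[of p q] by (simp add: dan_ring_def FactRing_def dan_class_def)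

lemma one_B: "\<one>\<^bsub>B\<^esub> = cls 1" and zero_B: "\<zero>\<^bsub>B\<^esub> = cls 0"
proof -
  have "cls 0 = dan_ideal m k P" by (simp add: cls_eq ideal_eq)
  then show "\<zero>\<^bsub>B\<^esub> = cls 0" by (simp add: dan_ring_def FactRing_def)
qed (simp add: dan_ring_def FactRing_def dan_class_def)

lemma cring_B: "cring B"
  unfolding dan_ring_def by (rule I.quotient_is_cring[OF cring_mpoly_ring])

subsection \<open>The embedding into Laurent polynomials in one more variable\<close>

text \<open>Minus the mean of the roots of the monic polynomial \<open>P\<close>; replacing
  \<open>Z\<close> by \<open>Z - r\<close> moves that mean to 0.\<close>

definition r :: 'a where "r = coeff P (d - 1) / of_nat d"
definition Pn :: "'a poly" where "Pn = normalised P"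
definition PL :: "'a laurent poly" where "PL = map_poly lconst Pn"
definition kexp :: "nat \<Rightarrow>\<^sub>0 int" where "kexp = (\<Sum>j\<in>{2..m}. single j (int (k j)))"
definition yk :: "'a laurent" where "yk = single kexp 1"
definition yk_inv :: "'a laurent" where "yk_inv = single (- kexp) 1"
definition Y1 :: "'a laurent poly" where "Y1 = smult yk_inv PL"

text \<open>\<open>Z\<close> goes to \<open>z - r\<close> rather than to \<open>z\<close>, so that \<open>P(Z)\<close> goes to the normalised polynomial.\<close>

definition gen :: "nat \<Rightarrow> 'a laurent poly"
  where "gen i = (if i = 0 then [:- lconst r, 1:] else if i = 1 then Y1 else [:lvar i:])"

lemma gen_0: "gen 0 = [:- lconst r, 1:]" and gen_1 [simp]: "gen (Suc 0) = Y1"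
  and gen_lvar: "j \<ge> 2 \<Longrightarrow> gen j = [:lvar j:]"
  by (simp_all add: gen_def)

definition iota :: "'a mpoly \<Rightarrow> 'a laurent poly"
  where "iota = pm_eval (\<lambda>c. [:lconst c:]) (\<lambda>\<mu>. \<Prod>i\<in>keys \<mu>. gen i ^ lookup \<mu> i)"

lemma normalised_shift: "normalised P = pcompose P [:- r, 1:]"
  by (simp add: normalised_def r_def)

lemma d_pos: "d > 0" using deg by simp

lemma degree_Pn [simp]: "degree Pn = d"
  by (simp add: Pn_def normalised_shift degree_pcompose)

lemma lead_Pn [simp]: "coeff Pn d = 1"
proof -
  have "lead_coeff (pcompose P [:- r, 1:]) = 1" using monic by (subst lead_coeff_comp) auto
  then show ?thesis using degree_Pn by (simp add: Pn_def normalised_shift)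
qed

lemma coeff_PL [simp]: "coeff PL i = lconst (coeff Pn i)"
  by (simp add: PL_def coeff_map_poly)

lemma degree_PL [simp]: "degree PL = d"
proof -
  have "degree (map_poly lconst Pn) = degree Pn" by (rule degree_map_poly) auto
  then show ?thesis by (simp add: PL_def)
qed

lemma yk_inv: "yk * yk_inv = 1" "yk_inv * yk = 1"
  by (simp_all add: yk_def yk_inv_def mult_single)

lemma yk_nz [simp]: "yk \<noteq> 0" "yk_inv \<noteq> 0"
  using yk_inv by auto

lemma yk_prod: "yk = (\<Prod>j\<in>{2..m}. lvar j ^ k j)"
  by (simp add: prod_lvar_power yk_def kexp_def)

lemma yk_lpos [simp]: "yk \<in> lpos m"
  unfolding yk_prod by (intro lpos_prod lpos_power lpos_lvar)

lemma yk_Y1: "smult yk Y1 = PL"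
  by (simp add: Y1_def yk_inv)

lemma degree_Y1 [simp]: "degree Y1 = d"
  by (simp add: Y1_def)

sublocale iota: pm_eval_hom "\<lambda>c. [:lconst c:]" "\<lambda>\<mu> :: nat \<Rightarrow>\<^sub>0 nat. \<Prod>i\<in>keys \<mu>. gen i ^ lookup \<mu> i"
  by (rule pm_eval_hom_mpoly) (auto simp: one_pCons)

lemma iota_hom [simp]:
  "iota 0 = 0" "iota 1 = 1" "iota (p + q) = iota p + iota q" "iota (p * q) = iota p * iota q"
  "iota (- p) = - iota p" "iota (p - q) = iota p - iota q" "iota (p ^ n) = iota p ^ n"
  "iota (prod f S) = (\<Prod>i\<in>S. iota (f i))" "iota (sum f S) = (\<Sum>i\<in>S. iota (f i))"
  by (simp_all add: iota_def)

lemma iota_mconst [simp]: "iota (mconst c) = [:lconst c:]"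
  by (simp add: iota_def mconst_def)

lemma iota_mvar [simp]: "iota (mvar i) = gen i"
  by (simp add: iota_def mvar_def one_pCons)

lemma iota_subst_Z: "iota (subst_Z Q) = map_poly lconst (pcompose Q [:- r, 1:])"
proof (induction Q)
  case (pCons a Q)
  let ?s = "[:- r, 1:]"
  have s: "map_poly lconst ?s = gen 0"
    by (simp add: gen_0 map_poly_pCons)
  have "map_poly lconst (pcompose (pCons a Q) ?s) = map_poly lconst [:a:] + map_poly lconst (?s * pcompose Q ?s)"
    unfolding pcompose_pCons by (rule map_poly_hom_add) auto
  also have "map_poly lconst (?s * pcompose Q ?s) = gen 0 * iota (subst_Z Q)"
    unfolding pCons.IH by (subst map_poly_hom_mult) (simp_all add: s del: mult_pCons_left)
  finally show ?case by (simp add: map_poly_pCons)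
qed simp

lemma const_poly_power: "[:c:] ^ n = [:c ^ n:]" for c :: "'a laurent"
  by (induction n) (auto simp: one_pCons)

lemma const_poly_prod: "(\<Prod>i\<in>S. [:f i:]) = [:\<Prod>i\<in>S. f i:]" for f :: "'b \<Rightarrow> 'a laurent"
  by (induction S rule: infinite_finite_induct) (auto simp: one_pCons)

lemma prod_gen_power:
  assumes "S \<subseteq> {2..m}"
  shows "(\<Prod>j\<in>S. gen j ^ n j) = [:\<Prod>j\<in>S. lvar j ^ n j:]"
proof -
  have "(\<Prod>j\<in>S. gen j ^ n j) = (\<Prod>j\<in>S. [:lvar j ^ n j:])"
    using assms by (intro prod.cong) (auto simp: gen_def const_poly_power)
  then show ?thesis by (simp add: const_poly_prod)
qed

lemma iota_rel: "iota rel = 0"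
proof -
  have "iota (perm_monomial m k id) = Y1 * [:yk:]"
    by (simp add: perm_monomial_def prod_gen_power yk_prod)
  also have "\<dots> = PL" by (simp flip: yk_Y1)
  finally show ?thesis by (simp add: rel_def iota_subst_Z PL_def Pn_def normalised_shift)
qed


subsection \<open>Normal forms\<close>

text \<open>With \<open>Z + r\<close> in place of \<open>Z\<close> the second factor is mapped to a
  plain power of \<open>z\<close>, so that \<open>W e\<close> represents the basis element
  \<open>w e\<close>.\<close>

definition W :: "nat \<Rightarrow> 'a mpoly"
  where "W e = mvar 1 ^ (e div d) * (Zvar + mconst r) ^ (e mod d)"

definition w :: "nat \<Rightarrow> 'a laurent poly"
  where "w e = Y1 ^ (e div d) * monom 1 (e mod d)"

lemma iota_shift: "iota (Zvar + mconst r) = monom 1 1"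
  by (simp add: gen_0 monom_altdef)

lemma iota_W [simp]: "iota (W e) = w e"
  unfolding W_def w_def iota_hom(4,7) iota_shift iota_mvar by (simp add: monom_power)

lemma Y1_nz: "Y1 \<noteq> 0"
  using degree_Y1 d_pos by (metis degree_0 less_irrefl)

lemma w_nz [simp]: "w e \<noteq> 0"
  using Y1_nz by (simp add: w_def monom_eq_0_iff)

lemma degree_w [simp]: "degree (w e) = e"
proof -
  have "degree (w e) = (e div d) * d + e mod d"
    using Y1_nz by (simp add: w_def degree_mult_eq degree_power_eq monom_eq_0_iff degree_monom_eq)
  then show ?thesis by simp
qed

text \<open>Triangularity in the degree: for the largest \<open>i\<close> with
  \<open>b i \<noteq> 0\<close>, only \<open>w i\<close> contributes to the coefficient of
  \<open>z^i\<close>, and the product of two nonzero Laurent polynomials is nonzero.\<close>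

lemma independent_w:
  assumes "S = (\<Sum>e<N. smult (b e) (w e))" "e < N" "b e \<noteq> 0"
  shows "e \<le> degree S" "S \<noteq> 0"
proof -
  let ?E = "{i. i < N \<and> b i \<noteq> 0}"
  define i where "i = Max ?E"
  have "i \<in> ?E" unfolding i_def using assms by (intro Max_in) auto
  then have i: "i < N" "b i \<noteq> 0" by auto
  have mx: "j \<le> i" if "j < N" "b j \<noteq> 0" for j
    unfolding i_def using that by (intro Max_ge) auto
  have "coeff S i = (\<Sum>j<N. b j * coeff (w j) i)"
    by (simp add: assms(1) coeff_sum)
  also have "\<dots> = (\<Sum>j<N. if j = i then b i * coeff (w i) i else 0)"
  proof (rule sum.cong)
    fix j assume j: "j \<in> {..<N}"
    consider "j = i" | "j < i" | "j > i" by linarith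
    then show "b j * coeff (w j) i = (if j = i then b i * coeff (w i) i else 0)"
    proof cases
      case 2
      then have "coeff (w j) i = 0" by (intro coeff_eq_0) simp
      with 2 show ?thesis by simp
    next
      case 3
      with mx[of j] j have "b j = 0" by fastforce
      with 3 show ?thesis by simp
    qed simp
  qed simp
  also have "\<dots> = b i * coeff (w i) i" using i by simp
  also have "coeff (w i) i \<noteq> 0" using leading_coeff_0_iff[of "w i"] by (simp del: leading_coeff_0_iff) 
  then have "b i * coeff (w i) i \<noteq> 0" using i by simp
  finally have c: "coeff S i \<noteq> 0" .
  then show "S \<noteq> 0" by auto
  have "i \<le> degree S" using c by (rule le_degree)
  with mx[OF assms(2,3)] show "e \<le> degree S" by simp
qed

text \<open>Reading natural exponents as integers is injective on monomials, so no two terms of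
  \<open>a\<close> merge. The last conjunct will turn vanishing of Laurent coefficients into
  vanishing of polynomial coefficients.\<close>

lemma iota_lpos:
  assumes "a \<in> mpoly_on {2..m}"
  shows "\<exists>b\<in>lpos m. iota a = [:b:] \<and> (b = 0 \<longrightarrow> a = 0)"
proof -
  let ?E = "\<lambda>\<mu>. \<Sum>i\<in>keys \<mu>. single i (int (lookup \<mu> i))"
  have Ek: "lookup (?E \<mu>) i = int (lookup \<mu> i)" for \<mu> i
    by (auto simp: lookup_sum lookup_single when_def in_keys_iff)
  have Einj: "?E \<mu> = ?E \<nu> \<longleftrightarrow> \<mu> = \<nu>" for \<mu> \<nu>
  proof
    assume eq: "?E \<mu> = ?E \<nu>"
    show "\<mu> = \<nu>"
    proof (rule poly_mapping_eqI)
      fix i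
      have "lookup (?E \<mu>) i = lookup (?E \<nu>) i" by (simp only: eq)
      then show "lookup \<mu> i = lookup \<nu> i" by (simp only: Ek of_nat_eq_iff)
    qed
  qed simp
  define b where "b = (\<Sum>\<mu>\<in>keys a. single (?E \<mu>) (lookup a \<mu>))"
  have "iota a = (\<Sum>\<mu>\<in>keys a. [:lconst (lookup a \<mu>):] * (\<Prod>i\<in>keys \<mu>. gen i ^ lookup \<mu> i))"
    by (simp add: iota_def pm_eval_def)
  also have "\<dots> = (\<Sum>\<mu>\<in>keys a. [:single (?E \<mu>) (lookup a \<mu>):])"
  proof (rule sum.cong)
    fix \<mu> assume "\<mu> \<in> keys a"
    then have "keys \<mu> \<subseteq> {2..m}" using assms by (auto simp: mpoly_on_def)
    then show "[:lconst (lookup a \<mu>):] * (\<Prod>i\<in>keys \<mu>. gen i ^ lookup \<mu> i) = [:single (?E \<mu>) (lookup a \<mu>):]"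
      by (simp add: prod_gen_power prod_lvar_power lconst_def mult_single)
  qed simp
  also have "\<dots> = [:b:]"
  proof -
    have "(\<Sum>\<mu>\<in>S. [:f \<mu>:]) = [:sum f S:]" for f :: "_ \<Rightarrow> 'a laurent" and S :: "(nat \<Rightarrow>\<^sub>0 nat) set"
      by (induction S rule: infinite_finite_induct) auto
    then show ?thesis by (simp add: b_def)
  qed
  finally have "iota a = [:b:]" .
  moreover have "b \<in> lpos m"
    unfolding b_def
  proof (intro lpos_sum lpos_single)
    fix \<mu> i assume "\<mu> \<in> keys a"
    then have \<mu>: "keys \<mu> \<subseteq> {2..m}" using assms by (auto simp: mpoly_on_def)
    show "0 \<le> lookup (?E \<mu>) i" by (simp add: Ek)
    have "keys (?E \<mu>) \<subseteq> keys \<mu>" by (auto simp: in_keys_iff Ek)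
    with \<mu> show "keys (?E \<mu>) \<subseteq> {2..m}" by blast
  qed
  moreover have "a = 0" if "b = 0"
  proof (rule poly_mapping_eqI)
    fix \<nu>
    have "lookup b (?E \<nu>) = (\<Sum>\<mu>\<in>keys a. if \<mu> = \<nu> then lookup a \<mu> else 0)"
      unfolding b_def lookup_sum[of _ "keys a"] lookup_single Einj when_def ..
    also have "\<dots> = lookup a \<nu>" by (simp add: in_keys_iff)
    finally show "lookup a \<nu> = lookup 0 \<nu>" using that by simp
  qed
  ultimately show ?thesis by blast
qed

text \<open>A representation modulo the relation as a combination of the \<open>W e\<close> over
  \<open>K[Y_2,...,Y_m]\<close>. Letting \<open>a\<close> vanish from \<open>N\<close> on allows two
  such sums to be padded to a common length.\<close>

definition nf :: "'a mpoly \<Rightarrow> bool"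
  where "nf p \<longleftrightarrow> (\<exists>a N s. (\<forall>e. a e \<in> mpoly_on {2..m}) \<and> (\<forall>e\<ge>N. a e = 0) \<and> s \<in> MP \<and>
    p = (\<Sum>e<N. a e * W e) + s * rel)"

lemma nf_add: assumes "nf p" "nf q" shows "nf (p + q)"
proof -
  obtain a N s where 1: "\<And>e. a e \<in> mpoly_on {2..m}" "\<And>e. e \<ge> N \<Longrightarrow> a e = 0" "s \<in> MP"
    "p = (\<Sum>e<N. a e * W e) + s * rel" using assms(1) unfolding nf_def by auto
  obtain a' N' s' where 2: "\<And>e. a' e \<in> mpoly_on {2..m}" "\<And>e. e \<ge> N' \<Longrightarrow> a' e = 0" "s' \<in> MP"
    "q = (\<Sum>e<N'. a' e * W e) + s' * rel" using assms(2) unfolding nf_def by auto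
  let ?N = "max N N'"
  have "(\<Sum>e<N. a e * W e) = (\<Sum>e<?N. a e * W e)"
    by (rule sum.mono_neutral_left) (auto simp: 1)
  moreover have "(\<Sum>e<N'. a' e * W e) = (\<Sum>e<?N. a' e * W e)"
    by (rule sum.mono_neutral_left) (auto simp: 2)
  ultimately have "p + q = (\<Sum>e<?N. (a e + a' e) * W e) + (s + s') * rel"
    by (simp add: 1(4) 2(4) sum.distrib algebra_simps)
  then show ?thesis
    unfolding nf_def using 1 2
    by (intro exI[of _ "\<lambda>e. a e + a' e"] exI[of _ ?N] exI[of _ "s + s'"]) (auto intro: mpoly_on_add)
qed

lemma nf_rel: "s \<in> MP \<Longrightarrow> nf (s * rel)"
  unfolding nf_def by (intro exI[of _ "\<lambda>_. 0"] exI[of _ 0] exI[of _ s]) auto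

lemma nf_W: "a \<in> mpoly_on {2..m} \<Longrightarrow> nf (a * W e)"
  unfolding nf_def
  by (intro exI[of _ "\<lambda>i. if i = e then a else 0"] exI[of _ "Suc e"] exI[of _ 0]) (auto simp: if_distrib[of "\<lambda>x. x * _"] cong: if_cong)

lemma nf_0: "nf 0"
  using nf_W[of 0 0] by simp

lemma nf_sum: "(\<And>i. i \<in> S \<Longrightarrow> nf (f i)) \<Longrightarrow> nf (sum f S)"
  by (induction S rule: infinite_finite_induct) (auto intro: nf_add nf_0)

lemma nf_mult:
  assumes "nf p" "q \<in> MP" "\<And>a e. a \<in> mpoly_on {2..m} \<Longrightarrow> nf (q * (a * W e))"
  shows "nf (q * p)"
proof -
  obtain a N s where 1: "\<And>e. a e \<in> mpoly_on {2..m}" "s \<in> MP"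
    "p = (\<Sum>e<N. a e * W e) + s * rel" using assms(1) unfolding nf_def by auto
  have "q * p = (\<Sum>e<N. q * (a e * W e)) + (q * s) * rel"
    by (simp add: 1(3) sum_distrib_left algebra_simps)
  then show ?thesis using 1 assms by (auto intro!: nf_add nf_sum nf_rel mpoly_on_mult)
qed

lemma mpoly_on_MP: "p \<in> mpoly_on {2..m} \<Longrightarrow> p \<in> MP"
  by (erule mpoly_on_mono) auto

lemma nf_mult_coeff: "nf p \<Longrightarrow> q \<in> mpoly_on {2..m} \<Longrightarrow> nf (q * p)"
  by (rule nf_mult) (auto simp flip: mult.assoc intro: nf_W mpoly_on_mult mpoly_on_MP)

lemma nf_mult_Y1: assumes "nf p" shows "nf (mvar 1 * p)"
proof (rule nf_mult[OF assms])
  fix a :: "'a mpoly" and e assume a: "a \<in> mpoly_on {2..m}"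
  have "mvar 1 * (a * W e) = a * W (e + d)"
    using d_pos by (simp add: W_def algebra_simps)
  then show "nf (mvar 1 * (a * W e))" using nf_W[OF a] by (simp only:)
qed (use m in \<open>auto intro: mpoly_on_mvar\<close>)

lemma poly_map_mconst_eq: "poly (map_poly mconst (pcompose Q [:c, 1:])) x = poly (map_poly mconst Q) (x + mconst c)"
proof (induction Q)
  case (pCons a Q)
  have "map_poly mconst (pcompose (pCons a Q) [:c, 1:]) = map_poly mconst [:a:] + map_poly mconst [:c, 1:] * map_poly mconst (pcompose Q [:c, 1:])"
    unfolding pcompose_pCons
    by (subst map_poly_hom_add, simp, simp, subst map_poly_hom_mult) (simp_all del: mult_pCons_left)
  with pCons show ?case by (simp add: map_poly_pCons algebra_simps del: mult_pCons_left)
qed simp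

text \<open>Multiplication by \<open>Z + r\<close> raises \<open>e\<close> by one, except when
  \<open>e mod d = d - 1\<close>. Then a power \<open>(Z + r)^d\<close> arises, and the relation
  trades it for \<open>Y_1 y^k\<close> and lower powers.\<close>

lemma nf_mult_Z: assumes "nf p" shows "nf ((Zvar + mconst r) * p)"
proof (rule nf_mult[OF assms])
  let ?Z = "Zvar + mconst r"
  fix a :: "'a mpoly" and e assume a: "a \<in> mpoly_on {2..m}"
  let ?n = "e div d" and ?i = "e mod d"
  show "nf (?Z * (a * W e))"
  proof (cases "Suc ?i = d")
    case False
    then have "Suc ?i < d" using d_pos by (metis Suc_lessI mod_less_divisor)
    then have "Suc e div d = ?n" "Suc e mod d = Suc ?i"
      using d_pos by (simp_all add: div_Suc mod_Suc)
    then have "?Z * (a * W e) = a * W (Suc e)" by (simp add: W_def algebra_simps)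
    then show ?thesis using nf_W[OF a] by (simp only:)
  next
    case True
    let ?y = "\<Prod>j\<in>{2..m}. mvar j ^ k j :: 'a mpoly"
    \<comment> \<open>Translating back undoes the normalisation, so \<open>P(Z)\<close> is the
      normalised polynomial evaluated at \<open>Z + r\<close>.\<close>
    have P_eq: "pcompose Pn [:r, 1:] = P"
      by (simp add: Pn_def normalised_shift flip: pcompose_assoc) (simp add: pcompose_pCons)
    have "subst_Z (pcompose Pn [:r, 1:]) = poly (map_poly mconst Pn) ?Z"
      by (simp only: subst_Z_def poly_map_mconst_eq)
    then have "subst_Z P = poly (map_poly mconst Pn) ?Z" unfolding P_eq .
    also have "\<dots> = (\<Sum>i\<le>d. mconst (coeff Pn i) * ?Z ^ i)"
    proof -
      have "degree (map_poly mconst Pn) \<le> d"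
        by (intro degree_le) (simp add: coeff_map_poly coeff_eq_0)
      then have "poly (map_poly mconst Pn) ?Z = (\<Sum>i\<le>d. coeff (map_poly mconst Pn) i * ?Z ^ i)"
        unfolding poly_altdef by (intro sum.mono_neutral_left) (auto simp: coeff_eq_0)
      then show ?thesis by (simp add: coeff_map_poly)
    qed
    also have "\<dots> = ?Z ^ d + (\<Sum>i<d. mconst (coeff Pn i) * ?Z ^ i)"
      by (simp add: lessThan_Suc_atMost[symmetric])
    \<comment> \<open>The relation read as a rewriting rule for the top power; this works because
      the normalised polynomial is still monic.\<close>
    finally have Zd: "?Z ^ d = mvar 1 * ?y - rel - (\<Sum>i<d. mconst (coeff Pn i) * ?Z ^ i)"
      by (simp add: rel_def perm_monomial_def algebra_simps)
    have "?Z * (a * W e) = a * mvar 1 ^ ?n * ?Z ^ d"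
      using True unfolding W_def by (metis (no_types, lifting) mult.assoc mult.commute power_Suc)
    also have "\<dots> = (a * ?y) * (mvar 1 ^ Suc ?n) + (- (a * mvar 1 ^ ?n)) * rel +
        (\<Sum>i<d. (- (a * mconst (coeff Pn i))) * (mvar 1 ^ ?n * ?Z ^ i))"
      unfolding Zd by (simp add: algebra_simps sum_distrib_left sum_negf)
    also have "\<dots> = (a * ?y) * W (Suc ?n * d) + (- (a * mvar 1 ^ ?n)) * rel +
        (\<Sum>i<d. (- (a * mconst (coeff Pn i))) * W (?n * d + i))"
      using d_pos by (simp add: W_def)
    finally have eq: "?Z * (a * W e) = \<dots>" .
    have y: "?y \<in> mpoly_on {2..m}" by (intro mpoly_on_prod mpoly_on_power mpoly_on_mvar)
    show ?thesis
      unfolding eq using a y m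
      by (intro nf_add nf_sum nf_W nf_rel mpoly_on_mult mpoly_on_minus mpoly_on_power mpoly_on_mvar
          mpoly_on_mconst mpoly_on_MP[OF a]) auto
  qed
qed (intro mpoly_on_add mpoly_on_mvar mpoly_on_mconst, simp)

text \<open>The multipliers that preserve \<open>nf\<close> are closed under sums and products and
  include the constants and all variables; applying such a multiplier to 1 gives the claim.\<close>

lemma nf_all:
  assumes "p \<in> MP"
  shows "nf p"
proof -
  have "\<forall>q. nf q \<longrightarrow> nf (p * q)"
    using assms
  proof (induction p rule: mpoly_on_induct)
    case (mvar j)
    consider "j = 0" | "j = 1" | "j \<in> {2..m}" using mvar by fastforce
    then show ?case
    proof cases
      case 1
      show ?thesis
      proof (intro allI impI)
        fix q assume q: "nf q"
        have "nf ((Zvar + mconst r) * q + mconst (- r) * q)"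
          using q by (intro nf_add nf_mult_Z nf_mult_coeff mpoly_on_mconst)
        then show "nf (mvar j * q)" using 1 by (simp add: algebra_simps)
      qed
    next
      case 2 then show ?thesis using nf_mult_Y1 by simp
    next
      case 3 then show ?thesis using nf_mult_coeff[OF _ mpoly_on_mvar[OF 3]] by simp
    qed
  next
    case (const c)
    then show ?case by (auto intro: nf_mult_coeff)
  qed (auto simp: distrib_right mult.assoc intro: nf_add)
  moreover have "nf 1" using nf_W[of 1 0] by (simp add: W_def)
  ultimately show ?thesis by (metis mult.right_neutral)
qed

lemma iota_nf:
  assumes "p \<in> MP"
  obtains a N s b where "\<And>e. a e \<in> mpoly_on {2..m}" "s \<in> MP" "p = (\<Sum>e<N. a e * W e) + s * rel"
    "\<And>e. b e \<in> lpos m" "\<And>e. b e = 0 \<Longrightarrow> a e = 0" "iota p = (\<Sum>e<N. smult (b e) (w e))"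
    "\<And>e. e \<ge> N \<Longrightarrow> b e = 0"
proof -
  obtain a N s where a: "\<And>e. a e \<in> mpoly_on {2..m}" "\<And>e. e \<ge> N \<Longrightarrow> a e = 0" "s \<in> MP"
    "p = (\<Sum>e<N. a e * W e) + s * rel"
    using nf_all[OF assms] unfolding nf_def by auto
  have "\<forall>e. \<exists>b. b \<in> lpos m \<and> iota (a e) = [:b:] \<and> (b = 0 \<longrightarrow> a e = 0)"
    using iota_lpos[OF a(1)] by blast
  then obtain b where b: "\<And>e. b e \<in> lpos m" "\<And>e. iota (a e) = [:b e:]" "\<And>e. b e = 0 \<longrightarrow> a e = 0"
    by metis
  show thesis
  proof (rule that[OF a(1,3,4) b(1)])
    show "iota p = (\<Sum>e<N. smult (b e) (w e))" by (simp add: a(4) b(2) iota_rel)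
    show "b e = 0" if "e \<ge> N" for e using b(2)[of e] a(2)[OF that] by simp
  qed (use b in auto)
qed

text \<open>In a normal form of \<open>p\<close> all Laurent coefficients vanish by independence,
  hence all polynomial ones, and only the multiple of the relation remains. This makes the map on
  the quotient injective.\<close>

lemma iota_kernel:
  assumes "p \<in> MP" "iota p = 0"
  shows "\<exists>s\<in>MP. p = s * rel"
proof -
  obtain a N s b where nf: "\<And>e. a e \<in> mpoly_on {2..m}" "s \<in> MP" "p = (\<Sum>e<N. a e * W e) + s * rel"
    "\<And>e. b e \<in> lpos m" "\<And>e. b e = 0 \<Longrightarrow> a e = 0" "iota p = (\<Sum>e<N. smult (b e) (w e))"
    "\<And>e. e \<ge> N \<Longrightarrow> b e = 0"
    by (rule iota_nf[OF assms(1)]) (rule that, assumption+)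
  have "b e = 0" if "e < N" for e using independent_w(2)[OF nf(6) that] assms(2) by blast
  then have "(\<Sum>e<N. a e * W e) = 0" using nf(5) by (intro sum.neutral) auto
  with nf(2,3) show ?thesis by auto
qed

definition img :: "'a laurent poly set" where "img = iota ` MP"

lemma img_low_degree:
  assumes "q \<in> img" "degree q < d"
  shows "coeff q i \<in> lpos m"
proof -
  obtain p where p: "p \<in> MP" "q = iota p" using assms(1) by (auto simp: img_def)
  obtain a N s b where nf: "\<And>e. a e \<in> mpoly_on {2..m}" "s \<in> MP" "p = (\<Sum>e<N. a e * W e) + s * rel"
    "\<And>e. b e \<in> lpos m" "\<And>e. b e = 0 \<Longrightarrow> a e = 0" "iota p = (\<Sum>e<N. smult (b e) (w e))"
    "\<And>e. e \<ge> N \<Longrightarrow> b e = 0"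
    by (rule iota_nf[OF p(1)]) (rule that, assumption+)
  note b = nf(4) nf(6)[folded p(2)] nf(7)
  \<comment> \<open>A nonzero \<open>b e\<close> with e \<ge> d would push the degree up to at least
    \<open>d\<close>. For e < d the element \<open>w e\<close> is just \<open>z^e\<close>, so the
    surviving \<open>b e\<close> are the coefficients of \<open>q\<close>.\<close>
  have "b e = 0" if "e \<ge> d" for e
    using independent_w(1)[OF b(2), of e] assms(2) that b(3)[of e] by (cases "e < N") force+
  then have "b e * coeff (w e) i = (if e < d then b e * coeff (monom 1 e) i else 0)" for e
    by (auto simp: w_def)
  then have "coeff q i = (\<Sum>e<N. if e < d then b e * coeff (monom 1 e) i else 0)"
    by (simp add: b(2) coeff_sum)
  then show ?thesis using b(1) by (auto intro!: lpos_sum lpos_mult)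
qed

lemma img_add: "p \<in> img \<Longrightarrow> q \<in> img \<Longrightarrow> p + q \<in> img"
  by (auto simp: img_def simp flip: iota_hom(3) intro: mpoly_on_add)

lemma img_mult: "p \<in> img \<Longrightarrow> q \<in> img \<Longrightarrow> p * q \<in> img"
  by (auto simp: img_def simp flip: iota_hom(4) intro: mpoly_on_mult)

lemma img_minus: "p \<in> img \<Longrightarrow> - p \<in> img"
  by (auto simp: img_def simp flip: iota_hom(5) intro: mpoly_on_minus)

lemma img_diff: "p \<in> img \<Longrightarrow> q \<in> img \<Longrightarrow> p - q \<in> img"
  using img_add[of p "- q"] img_minus[of q] by simp

lemma img_const: "[:lconst c:] \<in> img"
  unfolding img_def by (rule image_eqI[of _ _ "mconst c"]) auto

lemma img_lvar: "j \<in> {2..m} \<Longrightarrow> [:lvar j:] \<in> img"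
  unfolding img_def by (rule image_eqI[of _ _ "mvar j"]) (auto simp: gen_lvar intro: mpoly_on_mvar)

lemma img_Y1: "Y1 \<in> img"
  unfolding img_def using m by (intro image_eqI[of _ _ "mvar 1"]) (auto intro: mpoly_on_mvar)

lemma img_z: "[:0, 1:] \<in> img"
  unfolding img_def
proof (rule image_eqI)
  show "[:0, 1:] = iota (Zvar + mconst r)" by (simp only: iota_shift) (simp add: monom_altdef)
qed (intro mpoly_on_add mpoly_on_mvar mpoly_on_mconst, simp)

lemma img_lpos: "b \<in> lpos m \<Longrightarrow> [:b:] \<in> img"
proof (induction b rule: lpos_induct)
  case (add p q)
  then show ?case using img_add[of "[:p:]" "[:q:]"] by simp
next
  case (mult p q)
  then show ?case using img_mult[of "[:p:]" "[:q:]"] by (simp add: mult.commute)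
qed (use img_const img_lvar in auto)

lemma img_smult: "b \<in> lpos m \<Longrightarrow> q \<in> img \<Longrightarrow> smult b q \<in> img"
  using img_mult[OF img_lpos, of b q] by simp

lemma img_induct [consumes 1, case_names const add mult lvar z Y1]:
  assumes "q \<in> img" and c: "\<And>c. Q [:lconst c:]"
    and a: "\<And>p q. p \<in> img \<Longrightarrow> q \<in> img \<Longrightarrow> Q p \<Longrightarrow> Q q \<Longrightarrow> Q (p + q)"
    and t: "\<And>p q. p \<in> img \<Longrightarrow> q \<in> img \<Longrightarrow> Q p \<Longrightarrow> Q q \<Longrightarrow> Q (p * q)"
    and v: "\<And>j. j \<in> {2..m} \<Longrightarrow> Q [:lvar j:]" and z: "Q [:0, 1:]" and y: "Q Y1"
  shows "Q q"
proof -
  obtain p where p: "p \<in> MP" "q = iota p" using assms(1) by (auto simp: img_def)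
  have "Q (iota p)" using p(1)
  proof (induction p rule: mpoly_on_induct)
    case (mvar j)
    consider "j = 0" | "j = 1" | "j \<in> {2..m}" using mvar by fastforce
    then show ?case
    proof cases
      case 1
      have "Q ([:0, 1:] + [:lconst (- r):])" by (intro a z c img_z img_const)
      with 1 show ?thesis by (simp add: gen_0)
    next
      case 3
      then show ?thesis using v by (simp add: gen_lvar)
    qed (use y in simp)
  next
    case (add p q)
    then show ?case unfolding iota_hom by (intro a) (auto simp: img_def)
  next
    case (mult p q)
    then show ?case unfolding iota_hom by (intro t) (auto simp: img_def)
  qed (simp only: iota_mconst c)
  with p show ?thesis by simp
qed


section \<open>Transport between the coordinate ring and its image\<close>

definition psi :: "'a mpoly set \<Rightarrow> 'a laurent poly"
  where "psi b = iota (SOME p. p \<in> MP \<and> cls p = b)"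

definition unpsi :: "'a laurent poly \<Rightarrow> 'a mpoly set"
  where "unpsi = inv_into (carrier B) psi"

definition lift :: "('a laurent poly \<Rightarrow> 'a laurent poly) \<Rightarrow> 'a mpoly set \<Rightarrow> 'a mpoly set"
  where "lift F = (\<lambda>b\<in>carrier B. unpsi (F (psi b)))"

text \<open>Two representatives of a class differ by a multiple of the relation, which
  \<open>iota\<close> kills; so the choice made in \<open>psi\<close> does not matter.\<close>

lemma psi_cls [simp]:
  assumes "p \<in> MP"
  shows "psi (cls p) = iota p"
proof -
  let ?q = "SOME q. q \<in> MP \<and> cls q = cls p"
  have "?q \<in> MP \<and> cls ?q = cls p" by (rule someI[of _ p]) (simp add: assms)
  then obtain s where "s \<in> MP" "?q - p = s * rel" using cls_eq_iff[of ?q p] assms by blast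
  then have "iota (?q - p) = 0" using iota_rel by (simp del: iota_hom(6))
  then show ?thesis by (simp add: psi_def)
qed

lemma psi_inj: "inj_on psi (carrier B)"
proof (rule inj_onI)
  fix x y assume "x \<in> carrier B" "y \<in> carrier B" and eq: "psi x = psi y"
  then obtain p q where pq: "p \<in> MP" "q \<in> MP" "x = cls p" "y = cls q" by (auto simp: carrier_B)
  with eq have "iota (p - q) = 0" by simp
  with pq iota_kernel[of "p - q"] show "x = y" by (simp add: cls_eq_iff mpoly_on_diff)
qed

lemma psi_bij: "bij_betw psi (carrier B) img"
  using psi_inj by (force simp: bij_betw_def img_def carrier_B)

lemma psi_img [simp]: "b \<in> carrier B \<Longrightarrow> psi b \<in> img"
  using psi_bij by (rule bij_betw_apply)

lemma psi_eq_iff: "x \<in> carrier B \<Longrightarrow> y \<in> carrier B \<Longrightarrow> x = y \<longleftrightarrow> psi x = psi y"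
  using psi_inj by (auto dest: inj_onD)

lemma unpsi_B [simp]: "q \<in> img \<Longrightarrow> unpsi q \<in> carrier B"
  using psi_bij unfolding unpsi_def by (metis bij_betw_apply bij_betw_inv_into)

lemma psi_unpsi [simp]: "q \<in> img \<Longrightarrow> psi (unpsi q) = q"
  using psi_bij unfolding unpsi_def by (rule bij_betw_inv_into_right)

lemma unpsi_psi [simp]: "b \<in> carrier B \<Longrightarrow> unpsi (psi b) = b"
  using psi_bij unfolding unpsi_def by (rule bij_betw_inv_into_left)

lemma B_closed [simp]: "x \<in> carrier B \<Longrightarrow> y \<in> carrier B \<Longrightarrow> x \<oplus>\<^bsub>B\<^esub> y \<in> carrier B"
  "x \<in> carrier B \<Longrightarrow> y \<in> carrier B \<Longrightarrow> x \<otimes>\<^bsub>B\<^esub> y \<in> carrier B"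
  "\<zero>\<^bsub>B\<^esub> \<in> carrier B" "\<one>\<^bsub>B\<^esub> \<in> carrier B"
  using cring_B by (auto simp: cring_def ring.ring_simprules)

lemma psi_add [simp]: "x \<in> carrier B \<Longrightarrow> y \<in> carrier B \<Longrightarrow> psi (x \<oplus>\<^bsub>B\<^esub> y) = psi x + psi y"
  by (auto simp: carrier_B cls_add mpoly_on_add)

lemma psi_mult [simp]: "x \<in> carrier B \<Longrightarrow> y \<in> carrier B \<Longrightarrow> psi (x \<otimes>\<^bsub>B\<^esub> y) = psi x * psi y"
  by (auto simp: carrier_B cls_mult mpoly_on_mult)

lemma psi_0 [simp]: "psi \<zero>\<^bsub>B\<^esub> = 0" and psi_1 [simp]: "psi \<one>\<^bsub>B\<^esub> = 1"
  by (simp_all add: zero_B one_B)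

lemma MP_mvar: "j \<in> {1..m} \<Longrightarrow> mvar j \<in> MP" "Zvar \<in> MP"
  by (auto intro: mpoly_on_mvar)

lemma MP_subst_Z: "subst_Z Q \<in> MP"
  by (rule subst_Z_mpoly_on) simp

lemma img_map_poly: "map_poly lconst Q \<in> img"
proof (induction Q)
  case 0
  then show ?case using img_const[of 0] by simp
next
  case (pCons a Q)
  have "[:lconst a:] + [:0, 1:] * map_poly lconst Q \<in> img"
    by (intro img_add img_mult img_const img_z pCons.IH)
  then show ?case by (simp add: map_poly_pCons)
qed

subsection \<open>The derivation\<close>

definition Delta :: "'a laurent poly \<Rightarrow> 'a laurent poly"
  where "Delta q = smult yk (pderiv q)"

lemma pderiv_map_poly: "pderiv (map_poly lconst Q) = map_poly lconst (pderiv Q)" for Q :: "'a poly"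
  by (rule poly_eqI) (simp only: coeff_pderiv coeff_map_poly lconst_hom lconst_of_nat)

lemma Delta_simps [simp]:
  "Delta [:c:] = 0" "Delta (p + q) = Delta p + Delta q" "Delta (p * q) = Delta p * q + p * Delta q"
  "Delta [:0, 1:] = [:yk:]" "Delta Y1 = map_poly lconst (pderiv Pn)" "Delta 0 = 0"
proof -
  have "smult yk (pderiv Y1) = pderiv (smult yk Y1)" by (simp add: pderiv_smult)
  then show "Delta Y1 = map_poly lconst (pderiv Pn)"
    by (simp add: Delta_def yk_Y1) (simp add: PL_def pderiv_map_poly)
qed (simp_all add: Delta_def pderiv_add pderiv_mult pderiv_pCons smult_add_right mult.commute)

lemma Delta_img [simp]: "q \<in> img \<Longrightarrow> Delta q \<in> img"
proof (induction q rule: img_induct)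
  case z
  then show ?case by (simp add: img_lpos)
qed (use img_const[of 0] in \<open>auto intro: img_add img_mult img_map_poly\<close>)

lemma lift_apply: "b \<in> carrier B \<Longrightarrow> lift F b = unpsi (F (psi b))"
  by (simp add: lift_def)

lemma K_derivation_lift_Delta: "K_derivation m k P (lift Delta)"
proof -
  have lB: "lift Delta b \<in> carrier B" if "b \<in> carrier B" for b using that by (simp add: lift_apply)
  have lp: "psi (lift Delta b) = Delta (psi b)" if "b \<in> carrier B" for b using that by (simp add: lift_apply)
  show ?thesis
    unfolding K_derivation_def Let_def
  proof (intro conjI ballI allI)
    show "lift Delta \<in> carrier B \<rightarrow>\<^sub>E carrier B" using lB by (auto simp: lift_def)
    fix a b assume ab: "a \<in> carrier B" "b \<in> carrier B"
    show "lift Delta (a \<oplus>\<^bsub>B\<^esub> b) = lift Delta a \<oplus>\<^bsub>B\<^esub> lift Delta b"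
      using ab by (subst psi_eq_iff) (simp_all add: lB lp)
    show "lift Delta (a \<otimes>\<^bsub>B\<^esub> b) = lift Delta a \<otimes>\<^bsub>B\<^esub> b \<oplus>\<^bsub>B\<^esub> a \<otimes>\<^bsub>B\<^esub> lift Delta b"
      using ab by (subst psi_eq_iff) (simp_all add: lB lp)
  next
    fix c
    show "lift Delta (cls (mconst c)) = \<zero>\<^bsub>B\<^esub>" by (subst psi_eq_iff) (simp_all add: lB lp)
  qed
qed

lemma lift_Delta_gens:
  "lift Delta (cls (mvar 1)) = cls (subst_Z (pderiv P))"
  "lift Delta (cls Zvar) = cls (\<Prod>j\<in>{2..m}. mvar j ^ k j)"
  "j \<in> {2..m} \<Longrightarrow> lift Delta (cls (mvar j)) = \<zero>\<^bsub>B\<^esub>"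
proof -
  have y: "(\<Prod>j\<in>{2..m}. mvar j ^ k j) \<in> MP" by (intro mpoly_on_prod mpoly_on_power mpoly_on_mvar) auto
  have "1 \<in> {1..m}" using m by auto
  note gens = MP_mvar(1)[OF this] MP_mvar MP_subst_Z y
  have "pderiv Pn = pcompose (pderiv P) [:- r, 1:]"
    by (simp add: Pn_def normalised_shift pderiv_pcompose pderiv_pCons)
  then show "lift Delta (cls (mvar 1)) = cls (subst_Z (pderiv P))"
    using gens by (subst psi_eq_iff) (simp_all add: lift_apply iota_subst_Z img_Y1 img_map_poly)
  have z: "gen 0 = [:- lconst r:] + [:0, 1:]" by (simp add: gen_0)
  have "iota (mvar 0) \<in> img" unfolding img_def using gens(3) by (rule imageI)
  then have "gen 0 \<in> img" by simp
  moreover have "Delta (gen 0) = [:yk:]" unfolding z Delta_simps by simp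
  ultimately show "lift Delta (cls Zvar) = cls (\<Prod>j\<in>{2..m}. mvar j ^ k j)"
    using gens Delta_img[of "gen 0"] by (subst psi_eq_iff) (simp_all add: lift_apply prod_gen_power yk_prod)
  show "lift Delta (cls (mvar j)) = \<zero>\<^bsub>B\<^esub>" if "j \<in> {2..m}"
    using that gens(2)[of j] img_const[of 0] by (subst psi_eq_iff) (simp_all add: lift_apply gen_lvar)
qed

text \<open>The definite description is resolved by the transported \<open>y^k d/dz\<close>: a
  derivation killing the constants is determined on all classes by its values on the generators, and
  extensionality settles it off the carrier.\<close>

lemma D_con_eq: "D = lift Delta"
  unfolding D_con_def
proof (rule the_equality)
  show "K_derivation m k P (lift Delta) \<and> lift Delta (cls (mvar 1)) = cls (subst_Z (pderiv P)) \<and>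
    lift Delta (cls Zvar) = cls (\<Prod>j\<in>{2..m}. mvar j ^ k j) \<and>
    (\<forall>j\<in>{2..m}. lift Delta (cls (mvar j)) = \<zero>\<^bsub>B\<^esub>)"
    using K_derivation_lift_Delta lift_Delta_gens by blast
next
  fix D' assume D': "K_derivation m k P D' \<and> D' (cls (mvar 1)) = cls (subst_Z (pderiv P)) \<and>
    D' (cls Zvar) = cls (\<Prod>j\<in>{2..m}. mvar j ^ k j) \<and> (\<forall>j\<in>{2..m}. D' (cls (mvar j)) = \<zero>\<^bsub>B\<^esub>)"
  from K_derivation_lift_Delta have K: "lift Delta \<in> carrier B \<rightarrow>\<^sub>E carrier B" 
      "\<And>a b. a \<in> carrier B \<Longrightarrow> b \<in> carrier B \<Longrightarrow> lift Delta (a \<oplus>\<^bsub>B\<^esub> b) = lift Delta a \<oplus>\<^bsub>B\<^esub> lift Delta b"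
      "\<And>a b. a \<in> carrier B \<Longrightarrow> b \<in> carrier B \<Longrightarrow> lift Delta (a \<otimes>\<^bsub>B\<^esub> b) = lift Delta a \<otimes>\<^bsub>B\<^esub> b \<oplus>\<^bsub>B\<^esub> a \<otimes>\<^bsub>B\<^esub> lift Delta b"
      "\<And>c. lift Delta (cls (mconst c)) = \<zero>\<^bsub>B\<^esub>"
    unfolding K_derivation_def Let_def by blast+
  from D' have K': "D' \<in> carrier B \<rightarrow>\<^sub>E carrier B" 
      "\<And>a b. a \<in> carrier B \<Longrightarrow> b \<in> carrier B \<Longrightarrow> D' (a \<oplus>\<^bsub>B\<^esub> b) = D' a \<oplus>\<^bsub>B\<^esub> D' b"
      "\<And>a b. a \<in> carrier B \<Longrightarrow> b \<in> carrier B \<Longrightarrow> D' (a \<otimes>\<^bsub>B\<^esub> b) = D' a \<otimes>\<^bsub>B\<^esub> b \<oplus>\<^bsub>B\<^esub> a \<otimes>\<^bsub>B\<^esub> D' b"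
      "\<And>c. D' (cls (mconst c)) = \<zero>\<^bsub>B\<^esub>"
    unfolding K_derivation_def Let_def by blast+
  have "D' (cls p) = lift Delta (cls p)" if "p \<in> MP" for p
    using that
  proof (induction p rule: mpoly_on_induct)
    case (const c)
    show ?case by (simp only: K(4) K'(4))
  next
    case (add p q)
    then show ?case by (simp only: cls_add[symmetric] K(2) K'(2) cls_in_B)
  next
    case (mult p q)
    then show ?case by (simp only: cls_mult[symmetric] K(3) K'(3) cls_in_B)
  next
    case (mvar j)
    consider "j = 0" | "j = 1" | "j \<in> {2..m}" using mvar by fastforce
    then show ?case using D' lift_Delta_gens by cases auto
  qed
  then show "D' = lift Delta"
    by (intro PiE_ext[OF K'(1) K(1)]) (auto simp: carrier_B)
qed

lemma D_B [simp]: "b \<in> carrier B \<Longrightarrow> D b \<in> carrier B"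
  and psi_D [simp]: "b \<in> carrier B \<Longrightarrow> psi (D b) = Delta (psi b)"
  by (simp_all add: D_con_eq lift_apply)

text \<open>In characteristic zero a vanishing derivative means degree zero, and the degree
  criterion then puts the constant into \<open>A\<close>.\<close>

lemma Delta_eq_0D: assumes "q \<in> img" "Delta q = 0" shows "\<exists>c\<in>lpos m. q = [:c:]"
proof -
  have "pderiv q = 0" using assms(2) by (simp add: Delta_def)
  then have "degree q = 0" by (simp add: pderiv_eq_0_iff)
  then obtain c where c: "q = [:c:]" by (rule degree_eq_zeroE)
  with assms(1) img_low_degree[of q 0] deg have "c \<in> lpos m" by simp
  with c show ?thesis by blast
qed

lemma Ker_D_iff: "f \<in> Ker_D m k P \<longleftrightarrow> f \<in> carrier B \<and> (\<exists>c\<in>lpos m. psi f = [:c:])"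
proof -
  have "D f = \<zero>\<^bsub>B\<^esub> \<longleftrightarrow> Delta (psi f) = 0" if "f \<in> carrier B"
    using that by (subst psi_eq_iff) auto
  then show ?thesis using Delta_eq_0D by (auto simp: Ker_D_def)
qed

subsection \<open>Triangular automorphisms\<close>

definition mu :: "(nat \<Rightarrow> 'a) \<Rightarrow> 'a" where "mu l = (\<Prod>j\<in>{2..m}. l j ^ k j)"

text \<open>\<open>E \<sigma> l f\<close> is the substitution \<open>y\<^sub>j \<mapsto> l j y\<^bsub>\<sigma> j\<^esub>\<close>, \<open>z \<mapsto> mu l z + y\<^sup>k f\<close>; the factor \<open>mu l\<close> is what makes it
  commute with the derivation.\<close>

definition E :: "(nat \<Rightarrow> nat) \<Rightarrow> (nat \<Rightarrow> 'a) \<Rightarrow> 'a laurent \<Rightarrow> 'a laurent poly \<Rightarrow> 'a laurent poly"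
  where "E \<sigma> l f q = pcompose (map_poly (lsub \<sigma> l) q) [:yk * f, lconst (mu l):]"

text \<open>For \<open>c = mu l\<close> this is what lets \<open>y_1 = P / y^k\<close> return to the
  ring: a substitution with \<open>f = 0\<close> sends it to \<open>c^(d-1) y_1\<close>.\<close>

definition scaling :: "'a \<Rightarrow> bool"
  where "scaling c \<longleftrightarrow> pcompose Pn [:0, c:] = smult (c ^ d) Pn"

text \<open>Fixing \<open>l j = 1\<close> for the indices that do not occur makes \<open>(\<sigma>, l, f)\<close> unique.\<close>

definition params :: "(nat \<Rightarrow> nat) \<Rightarrow> (nat \<Rightarrow> 'a) \<Rightarrow> 'a laurent \<Rightarrow> bool"
  where "params \<sigma> l f \<longleftrightarrow> \<sigma> permutes {2..m} \<and> (\<forall>j\<in>{2..m}. k (\<sigma> j) = k j) \<and>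
    (\<forall>j. l j \<noteq> 0) \<and> (\<forall>j. j \<notin> {2..m} \<longrightarrow> l j = 1) \<and> scaling (mu l) \<and> f \<in> lpos m"

lemma mu_nz: "(\<And>j. l j \<noteq> 0) \<Longrightarrow> mu l \<noteq> 0"
  by (simp add: mu_def)

lemma E_hom [simp]:
  assumes "\<And>j. l j \<noteq> 0"
  shows "E \<sigma> l f 0 = 0" "E \<sigma> l f 1 = 1" "E \<sigma> l f (p + q) = E \<sigma> l f p + E \<sigma> l f q"
    "E \<sigma> l f (p * q) = E \<sigma> l f p * E \<sigma> l f q"
    "E \<sigma> l f [:c:] = [:lsub \<sigma> l c:]" "E \<sigma> l f [:0, 1:] = [:yk * f, lconst (mu l):]"
    "E \<sigma> l f (smult c q) = smult (lsub \<sigma> l c) (E \<sigma> l f q)"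
    "E \<sigma> l f (map_poly lconst Q) = pcompose (map_poly lconst Q) [:yk * f, lconst (mu l):]"
proof -
  note h = lsub_hom[OF assms]
  have "map_poly (lsub \<sigma> l) (map_poly lconst Q) = map_poly lconst Q"
    using assms by (subst map_poly_map_poly) (auto intro!: map_poly_cong)
  then show "E \<sigma> l f (map_poly lconst Q) = pcompose (map_poly lconst Q) [:yk * f, lconst (mu l):]"
    by (simp add: E_def)
qed (simp_all add: E_def map_poly_hom_add map_poly_hom_mult map_poly_smult pcompose_add pcompose_mult
    pcompose_1 pcompose_smult map_poly_pCons pcompose_pCons lsub_hom[OF assms])

lemma lsub_yk:
  assumes "\<And>j. l j \<noteq> 0" "\<sigma> permutes {2..m}" "\<And>j. j \<in> {2..m} \<Longrightarrow> k (\<sigma> j) = k j"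
  shows "lsub \<sigma> l yk = lconst (mu l) * yk"
proof -
  have "lsub \<sigma> l yk = (\<Prod>j\<in>{2..m}. lconst (l j) ^ k j * lvar (\<sigma> j) ^ k j)"
    using assms(1) by (simp add: yk_prod power_mult_distrib)
  also have "\<dots> = lconst (mu l) * (\<Prod>j\<in>{2..m}. lvar (\<sigma> j) ^ k (\<sigma> j))"
    using assms(3) by (simp add: prod.distrib mu_def lconst_prod)
  also have "(\<Prod>j\<in>{2..m}. lvar (\<sigma> j) ^ k (\<sigma> j)) = (\<Prod>j\<in>{2..m}. lvar j ^ k j)"
    by (rule prod.permute[OF assms(2), of "\<lambda>j. lvar j ^ k j", unfolded o_def, symmetric])
  finally show ?thesis by (simp add: yk_prod)
qed



lemma smult_yk_cancel: "smult yk p = smult yk q \<longleftrightarrow> p = q"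
proof
  assume "smult yk p = smult yk q"
  then have "smult yk_inv (smult yk p) = smult yk_inv (smult yk q)" by (simp only:)
  then show "p = q" by (simp add: yk_inv)
qed simp

text \<open>The two arguments differ by \<open>y^k f\<close>, as in a first-order Taylor expansion.
  The content is that \<open>h\<close> lies in the image: in \<open>L[z]\<close> alone, division by
  the unit \<open>y^k\<close> is always possible.\<close>

lemma pcompose_shift_divisible:
  fixes Q :: "'a poly"
  assumes "f \<in> lpos m"
  shows "\<exists>h\<in>img. pcompose (map_poly lconst Q) [:yk * f, lconst c:] =
    pcompose (map_poly lconst Q) [:0, lconst c:] + smult yk h"
proof (induction Q)
  case 0
  then show ?case using img_const[of 0] by (intro bexI[of _ 0]) auto
next
  case (pCons a Q)
  let ?s = "[:yk * f, lconst c:]" and ?u = "[:0, lconst c:]"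
  let ?A = "pcompose (map_poly lconst Q) ?u"
  obtain h where h: "h \<in> img" "pcompose (map_poly lconst Q) ?s = ?A + smult yk h"
    using pCons.IH by (elim bexE) (rule that)
  have s: "?s = ?u + smult yk [:f:]" by simp
  have "[:lconst c:] * [:0, 1:] \<in> img" by (intro img_mult img_const img_z)
  then have s0_img: "?u \<in> img" by simp
  then have s_img: "?s \<in> img"
    unfolding s using assms by (intro img_add img_smult img_lpos yk_lpos)
  have "?A = map_poly lconst (pcompose Q [:0, c:])"
    by (subst map_poly_hom_pcompose) (simp_all add: map_poly_pCons)
  then have A0: "?A \<in> img" by (simp add: img_map_poly)
  have ring: "x + (s + t) * (A + H) = (x + s * A) + ((s + t) * H + t * A)" for x s t A H :: "'a laurent poly"
    by (simp add: algebra_simps)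
  have "pcompose (map_poly lconst (pCons a Q)) ?s = [:lconst a:] + ?s * (?A + smult yk h)"
    by (simp only: map_poly_pCons lconst_hom(1) pcompose_pCons h(2))
  also have "\<dots> = ([:lconst a:] + ?u * ?A) + (?s * smult yk h + smult yk [:f:] * ?A)"
    by (simp only: s ring)
  also have "\<dots> = ([:lconst a:] + ?u * ?A) + smult yk (?s * h + [:f:] * ?A)"
    by (simp only: smult_add_right mult_smult_left mult_smult_right)
  also have "[:lconst a:] + ?u * ?A = pcompose (map_poly lconst (pCons a Q)) ?u"
    by (simp only: map_poly_pCons lconst_hom(1) pcompose_pCons)
  finally have eq: "pcompose (map_poly lconst (pCons a Q)) ?s =
    pcompose (map_poly lconst (pCons a Q)) ?u + smult yk (?s * h + [:f:] * ?A)" .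
  have "?s * h + [:f:] * ?A \<in> img"
    using h(1) A0 assms by (intro img_add img_mult s_img img_lpos)
  with eq show ?case by (rule bexI[where x = "?s * h + [:f:] * ?A"])
qed

lemma pcompose_PL_scaling:
  assumes "scaling c"
  shows "pcompose PL [:0, lconst c:] = smult (lconst (c ^ d)) PL"
proof -
  have "pcompose PL [:0, lconst c:] = map_poly lconst (pcompose Pn [:0, c:])"
    unfolding PL_def by (subst map_poly_hom_pcompose) (simp_all add: map_poly_pCons)
  also have "\<dots> = smult (lconst (c ^ d)) PL"
    using assms by (simp add: scaling_def PL_def map_poly_smult)
  finally show ?thesis .
qed

lemma paramsD:
  assumes "params \<sigma> l f"
  shows "\<sigma> permutes {2..m}" "j \<in> {2..m} \<Longrightarrow> k (\<sigma> j) = k j" "l j \<noteq> 0" "i \<notin> {2..m} \<Longrightarrow> l i = 1"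
    "scaling (mu l)" "f \<in> lpos m" "mu l \<noteq> 0"
  using assms by (auto simp: params_def mu_nz)

text \<open>Only \<open>y_1\<close> needs an argument. Applying the substitution to
  \<open>y^k y_1 = P\<close> gives \<open>mu y^k E(y_1) = P(mu z + y^k f)\<close>, and the right
  side is \<open>mu^d P(z)\<close> plus \<open>y^k h\<close> with \<open>h\<close> in the image.
  Cancelling \<open>y^k\<close> leaves \<open>E(y_1) = (mu^d y_1 + h) / mu\<close>.\<close>

lemma E_img:
  assumes p: "params \<sigma> l f" and q: "q \<in> img"
  shows "E \<sigma> l f q \<in> img"
  using q
proof (induction q rule: img_induct)
  note l = paramsD(3)[OF p]
  case (lvar j)
  have "\<sigma> j \<in> {2..m}" using permutes_in_image[OF paramsD(1)[OF p], of j] lvar by simp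
  then show ?case using lvar l by (auto intro!: img_lpos lpos_mult lpos_lvar)
next
  case z
  have "[:yk * f:] + [:lconst (mu l):] * [:0, 1:] \<in> img"
    using paramsD(6)[OF p] by (intro img_add img_mult img_const img_z img_lpos lpos_mult yk_lpos)
  then show ?case using paramsD(3)[OF p] by simp
next
  case Y1
  note l = paramsD(3)[OF p]
  obtain h where h: "h \<in> img" "pcompose PL [:yk * f, lconst (mu l):] =
      pcompose PL [:0, lconst (mu l):] + smult yk h"
    using pcompose_shift_divisible[OF paramsD(6)[OF p], of Pn "mu l"] by (auto simp: PL_def)
  let ?X = "smult (lconst (mu l ^ d)) Y1 + h"
  have "smult (lconst (mu l) * yk) (E \<sigma> l f Y1) = E \<sigma> l f (smult yk Y1)"
    using l lsub_yk[OF l paramsD(1,2)[OF p]] by simp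
  also have "\<dots> = pcompose PL [:yk * f, lconst (mu l):]"
    using l by (simp add: yk_Y1 del: E_hom(7)) (simp add: PL_def)
  also have "\<dots> = smult yk ?X"
    unfolding h(2) pcompose_PL_scaling[OF paramsD(5)[OF p]]
    by (simp add: smult_add_right mult.commute flip: yk_Y1)
  finally have "smult yk (smult (lconst (mu l)) (E \<sigma> l f Y1)) = smult yk ?X" by (simp add: mult.commute)
  then have "smult (lconst (mu l)) (E \<sigma> l f Y1) = ?X"
    by (simp only: smult_yk_cancel)
  then have "smult (lconst (1 / mu l)) ?X = smult (lconst (1 / mu l) * lconst (mu l)) (E \<sigma> l f Y1)"
    by (simp only: flip: smult_smult)
  also have "\<dots> = E \<sigma> l f Y1"
    using paramsD(7)[OF p] by (simp flip: lconst_hom(4))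
  finally have "E \<sigma> l f Y1 = smult (lconst (1 / mu l)) ?X" ..
  then show ?case using h(1) by (auto intro!: img_smult img_add img_Y1 lpos_power)
qed (use paramsD(3)[OF p] in \<open>auto intro: img_add img_mult img_const\<close>)

text \<open>The factor \<open>mu l\<close> that \<open>y^k\<close> acquires on the left is the inner
  derivative of \<open>mu z + y^k f\<close> produced by the chain rule on the right.\<close>

lemma E_Delta:
  assumes "params \<sigma> l f"
  shows "E \<sigma> l f (Delta q) = Delta (E \<sigma> l f q)"
proof -
  note l = paramsD(3)[OF assms]
  have "pderiv (map_poly (lsub \<sigma> l) q) = map_poly (lsub \<sigma> l) (pderiv q)"
  proof (rule poly_eqI)
    have "lsub \<sigma> l (of_nat n) = of_nat n" for n
      using lsub_lconst[OF l, where c = "of_nat n"] by simp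
    then show "coeff (pderiv (map_poly (lsub \<sigma> l) q)) n = coeff (map_poly (lsub \<sigma> l) (pderiv q)) n" for n
      using l by (simp add: coeff_pderiv coeff_map_poly del: of_nat_Suc)
  qed
  then show ?thesis
    using l lsub_yk[OF l paramsD(1,2)[OF assms]]
    unfolding Delta_def E_hom(7)[OF l]
    by (simp add: E_def pderiv_pcompose pderiv_pCons mult_ac)
qed

end

section \<open>Top coefficients after a linear substitution, and factors of monomials\<close>

lemma coeff_pcompose_linear_lead:
  fixes p :: "'b::comm_ring_1 poly"
  assumes "degree p \<le> n"
  shows "coeff (pcompose p [:g, c:]) n = c ^ n * coeff p n"
  using assms
proof (induction p arbitrary: n)
  case (pCons a p)
  show ?case
  proof (cases n)
    case 0
    with pCons have "p = 0" by (auto split: if_splits)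
    with 0 show ?thesis by simp
  next
    case (Suc i)
    with pCons have *: "degree p \<le> i" by (auto split: if_splits)
    then have "degree (pcompose p [:g, c:]) \<le> i"
      using degree_pcompose_le[of p "[:g, c:]"] by (auto split: if_splits)
    then have "coeff (pcompose p [:g, c:]) (Suc i) = 0" by (intro coeff_eq_0) simp
    with Suc pCons.IH[OF *] show ?thesis by (simp add: pcompose_pCons)
  qed
qed simp

text \<open>The second summand is the part of \<open>(c z + g)^(n+1)\<close> that is linear in
  \<open>g\<close>. When \<open>p\<close> has no term of degree \<open>n\<close>, this coefficient
  isolates \<open>g\<close>.\<close>

lemma coeff_pcompose_linear_sublead:
  fixes p :: "'b::comm_ring_1 poly"
  assumes "degree p \<le> Suc n"
  shows "coeff (pcompose p [:g, c:]) n = c ^ n * coeff p n + of_nat (Suc n) * coeff p (Suc n) * c ^ n * g"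
  using assms
proof (induction p arbitrary: n)
  case (pCons a p)
  then have deg: "degree p \<le> n" by (auto split: if_splits)
  have lead: "coeff (pcompose p [:g, c:]) n = c ^ n * coeff p n"
    by (rule coeff_pcompose_linear_lead[OF deg])
  show ?case
  proof (cases n)
    case 0
    then show ?thesis using lead by (simp add: pcompose_pCons)
  next
    case (Suc i)
    have "coeff (pcompose p [:g, c:]) i = c ^ i * coeff p i + of_nat (Suc i) * coeff p (Suc i) * c ^ i * g"
      using deg Suc by (intro pCons.IH) simp
    with lead Suc show ?thesis by (simp add: pcompose_pCons algebra_simps)
  qed
qed simp

text \<open>If \<open>a + b\<close> arises from the two supports in one way only, no other term can
  cancel against that product.\<close>

lemma lookup_mult_extreme:
  fixes p q :: "'b::comm_monoid_add \<Rightarrow>\<^sub>0 'c::comm_ring_1"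
  assumes "\<And>x y. x \<in> keys p \<Longrightarrow> y \<in> keys q \<Longrightarrow> x + y = a + b \<Longrightarrow> x = a \<and> y = b"
    and "a \<in> keys p" "b \<in> keys q"
  shows "lookup (p * q) (a + b) = lookup p a * lookup q b"
proof -
  have "p * q = (\<Sum>x\<in>keys p. \<Sum>y\<in>keys q. single (x + y) (lookup p x * lookup q y))"
  proof -
    have "p * q = (\<Sum>x\<in>keys p. single x (lookup p x)) * (\<Sum>y\<in>keys q. single y (lookup q y))"
      by (simp flip: poly_mapping_sum_single)
    then show ?thesis by (simp only: sum_product mult_single)
  qed
  then have "lookup (p * q) (a + b) = (\<Sum>x\<in>keys p. \<Sum>y\<in>keys q. if x + y = a + b then lookup p x * lookup q y else 0)"
    by (simp add: lookup_sum lookup_single when_def eq_commute)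
  also have "\<dots> = (\<Sum>x\<in>keys p. \<Sum>y\<in>keys q. if x = a \<and> y = b then lookup p x * lookup q y else 0)"
    using assms by (intro sum.cong refl if_cong) auto
  also have "\<dots> = (\<Sum>x\<in>keys p. if x = a then (\<Sum>y\<in>keys q. if y = b then lookup p x * lookup q y else 0) else 0)"
    by (intro sum.cong refl) auto
  also have "\<dots> = lookup p a * lookup q b" using assms by simp
  finally show ?thesis .
qed

lemma add_eq_add_extreme:
  fixes x y a b :: "'b::{linorder, ordered_cancel_comm_monoid_add}"
  assumes "x \<le> a" "y \<le> b" "x + y = a + b"
  shows "x = a \<and> y = b"
proof (intro conjI)
  show "x = a"
  proof (rule ccontr)
    assume "x \<noteq> a"
    with assms have "x + y < a + b" by (intro add_less_le_mono) auto
    with assms show False by simp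
  qed
  show "y = b"
  proof (rule ccontr)
    assume "y \<noteq> b"
    with assms have "x + y < a + b" by (intro add_le_less_mono) auto
    with assms show False by simp
  qed
qed

text \<open>For a linear order compatible with addition, both the products of the largest and of the
  smallest terms of the factors survive in the product.\<close>

lemma monomial_if_mult_monomial:
  fixes p q :: "'b::{linorder, ordered_cancel_comm_monoid_add} \<Rightarrow>\<^sub>0 'c::idom"
  assumes eq: "p * q = single \<nu> c" and c: "c \<noteq> 0"
  shows "\<exists>\<alpha> u. u \<noteq> 0 \<and> p = single \<alpha> u"
proof -
  have "p \<noteq> 0" "q \<noteq> 0" using assms by (metis mult_zero_left single_zero inj_single lookup_single_eq lookup_zero, metis mult_zero_right lookup_single_eq lookup_zero)
  then have ne: "keys p \<noteq> {}" "keys q \<noteq> {}" by auto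
  have ext: "a + b = \<nu>" if "a \<in> keys p" "b \<in> keys q"
    and "\<And>x y. x \<in> keys p \<Longrightarrow> y \<in> keys q \<Longrightarrow> x + y = a + b \<Longrightarrow> x = a \<and> y = b" for a b
  proof -
    have "lookup (p * q) (a + b) = lookup p a * lookup q b" by (rule lookup_mult_extreme) (use that in auto)
    then have "lookup (single \<nu> c) (a + b) \<noteq> 0" using that eq by (auto simp: in_keys_iff)
    then show ?thesis by (simp add: lookup_single when_def split: if_splits)
  qed
  let ?a = "Max (keys p)" and ?b = "Max (keys q)" and ?u = "Min (keys p)" and ?v = "Min (keys q)"
  have "?a + ?b = \<nu>"
  proof (rule ext)
    fix x y assume xy: "x \<in> keys p" "y \<in> keys q" "x + y = ?a + ?b"
    then have "x \<le> ?a" "y \<le> ?b" by auto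
    then show "x = ?a \<and> y = ?b" using xy(3) by (rule add_eq_add_extreme)
  qed (use ne in auto)
  moreover have "?u + ?v = \<nu>"
  proof (rule ext)
    fix x y assume xy: "x \<in> keys p" "y \<in> keys q" "x + y = ?u + ?v"
    then have "?u \<le> x" "?v \<le> y" by auto
    then have "?u = x \<and> ?v = y" using xy(3)[symmetric] by (rule add_eq_add_extreme)
    then show "x = ?u \<and> y = ?v" by simp
  qed (use ne in auto)
  moreover have "?u \<le> ?a" "?v \<le> ?b" using ne by auto
  \<comment> \<open>The sum of the minima equals the sum of the maxima, so neither factor has room
    between its smallest and largest exponent.\<close>
  ultimately have ua: "?u = ?a" using add_eq_add_extreme[of ?u ?a ?v ?b] by simp
  have p0: "lookup p x = 0" if "x \<noteq> ?a" for x
  proof -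
    have "x = ?a" if "x \<in> keys p" for x
    proof -
      have "x \<le> ?a" "?u \<le> x" using that by auto
      with ua show ?thesis by simp
    qed
    then show ?thesis using that by (auto simp: in_keys_iff)
  qed
  then have "p = single ?a (lookup p ?a)"
    by (intro poly_mapping_eqI) (simp add: lookup_single when_def)
  moreover have "lookup p ?a \<noteq> 0" using ne Max_in[of "keys p"] by (simp add: in_keys_iff)
  ultimately show ?thesis by blast
qed

section \<open>Uniqueness, composition and inversion of the triangular substitutions\<close>

context danielewski begin

lemma scaling_iff: "scaling c \<longleftrightarrow> (\<forall>i. coeff Pn i \<noteq> 0 \<longrightarrow> c ^ i = c ^ d)"
proof -
  have "scaling c \<longleftrightarrow> (\<forall>i. c ^ i * coeff Pn i = c ^ d * coeff Pn i)"
    by (simp only: scaling_def poly_eq_iff coeff_pcompose_linear coeff_smult)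
  also have "\<dots> \<longleftrightarrow> (\<forall>i. coeff Pn i \<noteq> 0 \<longrightarrow> c ^ i = c ^ d)"
    by (intro all_cong1) (simp only: mult_cancel_right, blast)
  finally show ?thesis .
qed

lemma scaling_1 [simp]: "scaling 1"
  by (simp add: scaling_iff)

lemma scaling_mult: "scaling a \<Longrightarrow> scaling b \<Longrightarrow> scaling (a * b)"
  unfolding scaling_iff power_mult_distrib by metis

lemma scaling_inverse: "scaling a \<Longrightarrow> scaling (1 / a)"
  unfolding scaling_iff power_divide power_one by metis

lemma coeff_Pn_sublead: "coeff Pn (d - 1) = 0"
proof -
  have d: "Suc (d - 1) = d" using d_pos by simp
  have "coeff Pn (d - 1) = 1 ^ (d - 1) * coeff P (d - 1) + of_nat (Suc (d - 1)) * coeff P (Suc (d - 1)) * 1 ^ (d - 1) * (- r)"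
    unfolding Pn_def normalised_shift by (rule coeff_pcompose_linear_sublead) simp
  then show ?thesis using monic d_pos by (simp only: d) (simp add: r_def)
qed

text \<open>Agreement on the \<open>y_j\<close> and on \<open>z\<close> gives agreement on
  \<open>A\<close> and on \<open>P(z)\<close>. The value at \<open>y_1\<close> is then forced by
  \<open>y^k y_1 = P\<close>, because the image of \<open>y^k\<close> is nonzero in a
  domain.\<close>

lemma E_unique:
  assumes add: "\<And>p q. p \<in> img \<Longrightarrow> q \<in> img \<Longrightarrow> F (p + q) = F p + F q"
    and mult: "\<And>p q. p \<in> img \<Longrightarrow> q \<in> img \<Longrightarrow> F (p * q) = F p * F q"
    and const: "\<And>c. F [:lconst c:] = [:lconst c:]"
    and lv: "\<And>j. j \<in> {2..m} \<Longrightarrow> F [:lvar j:] = [:lconst (l j) * lvar (\<sigma> j):]"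
    and z: "F [:0, 1:] = [:yk * f, lconst (mu l):]"
    and p: "params \<sigma> l f" and q: "q \<in> img"
  shows "F q = E \<sigma> l f q"
proof -
  note l = paramsD(3)[OF p]
  have A: "F [:c:] = E \<sigma> l f [:c:]" if "c \<in> lpos m" for c
    using that
  proof (induction c rule: lpos_induct)
    case (add p q)
    then show ?case using assms(1)[of "[:p:]" "[:q:]"] l by (simp add: img_lpos)
  next
    case (mult p q)
    then have "F ([:p:] * [:q:]) = E \<sigma> l f ([:p:] * [:q:])"
      by (simp only: assms(2) img_lpos E_hom(4)[OF l])
    then show ?case by (simp add: mult.commute)
  qed (use const lv l in auto)
  have C: "F (map_poly lconst Q) = E \<sigma> l f (map_poly lconst Q)" for Q
  proof (induction Q)
    case 0
    then show ?case using A[of 0] by simp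
  next
    case (pCons a Q)
    have eq: "map_poly lconst (pCons a Q) = [:lconst a:] + [:0, 1:] * map_poly lconst Q"
      by (simp add: map_poly_pCons)
    have "F ([:lconst a:] + [:0, 1:] * map_poly lconst Q) = E \<sigma> l f [:lconst a:] + E \<sigma> l f [:0, 1:] * E \<sigma> l f (map_poly lconst Q)"
      by (simp only: add mult img_const img_z img_map_poly img_mult pCons.IH z A lpos_const E_hom(6)[OF l])
    then show ?case unfolding eq by (simp only: E_hom(3,4)[OF l])
  qed
  show ?thesis using q
  proof (induction q rule: img_induct)
    case Y1
    have PL: "PL = [:yk:] * Y1" by (simp add: yk_Y1)
    have "F [:yk:] * F Y1 = F PL" unfolding PL by (simp only: mult img_lpos yk_lpos img_Y1)
    also have "\<dots> = E \<sigma> l f PL" unfolding PL_def by (rule C)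
    also have "\<dots> = E \<sigma> l f [:yk:] * E \<sigma> l f Y1" unfolding PL by (simp only: E_hom(4)[OF l])
    finally have "E \<sigma> l f [:yk:] * F Y1 = E \<sigma> l f [:yk:] * E \<sigma> l f Y1" by (simp only: A yk_lpos)
    moreover have "E \<sigma> l f [:yk:] \<noteq> 0"
      using lsub_yk[OF l paramsD(1,2)[OF p]] paramsD(7)[OF p] l by simp
    ultimately show ?case by (simp only: mult_cancel_left) simp
  qed (use A l z in \<open>auto simp: add mult lpos_lvar\<close>)
qed

lemma mu_comp:
  assumes "\<sigma> permutes {2..m}" "\<And>j. j \<in> {2..m} \<Longrightarrow> k (\<sigma> j) = k j"
  shows "mu (\<lambda>j. l j * l' (\<sigma> j)) = mu l * mu l'"
proof -
  have "(\<Prod>j\<in>{2..m}. l' (\<sigma> j) ^ k j) = (\<Prod>j\<in>{2..m}. l' (\<sigma> j) ^ k (\<sigma> j))"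
    using assms(2) by (intro prod.cong) auto
  also have "\<dots> = mu l'"
    unfolding mu_def using prod.permute[OF assms(1), of "\<lambda>j. l' j ^ k j"] by (simp add: o_def)
  finally show ?thesis by (simp add: mu_def power_mult_distrib prod.distrib)
qed

lemma params_comp:
  assumes p1: "params \<sigma>1 l1 f1" and p2: "params \<sigma>2 l2 f2"
  shows "params (\<sigma>1 \<circ> \<sigma>2) (\<lambda>j. l2 j * l1 (\<sigma>2 j)) (lconst (mu l2) * f1 + lconst (mu l1) * lsub \<sigma>1 l1 f2)"
proof -
  have s2: "j \<in> {2..m} \<Longrightarrow> \<sigma>2 j \<in> {2..m}" "j \<notin> {2..m} \<Longrightarrow> \<sigma>2 j = j" for j
    using permutes_in_image[OF paramsD(1)[OF p2], of j] permutes_not_in[OF paramsD(1)[OF p2], of j] by auto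
  have mu: "mu (\<lambda>j. l2 j * l1 (\<sigma>2 j)) = mu l2 * mu l1"
    by (rule mu_comp) (use paramsD[OF p2] in auto)
  show ?thesis
    unfolding params_def mu
  proof (intro conjI)
    show "(\<sigma>1 \<circ> \<sigma>2) permutes {2..m}" by (intro permutes_compose paramsD(1)[OF p1] paramsD(1)[OF p2])
    show "\<forall>j\<in>{2..m}. k ((\<sigma>1 \<circ> \<sigma>2) j) = k j"
      using s2 paramsD(2)[OF p1] paramsD(2)[OF p2] by simp
    show "\<forall>j. l2 j * l1 (\<sigma>2 j) \<noteq> 0" using paramsD(3)[OF p1] paramsD(3)[OF p2] by simp
    show "\<forall>j. j \<notin> {2..m} \<longrightarrow> l2 j * l1 (\<sigma>2 j) = 1" using s2 paramsD(4)[OF p1] paramsD(4)[OF p2] by simp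
    show "scaling (mu l2 * mu l1)" by (intro scaling_mult paramsD(5)[OF p1] paramsD(5)[OF p2])
    have "\<sigma>1 ` {2..m} \<subseteq> {2..m}" using permutes_image[OF paramsD(1)[OF p1]] by simp
    then show "lconst (mu l2) * f1 + lconst (mu l1) * lsub \<sigma>1 l1 f2 \<in> lpos m"
      using paramsD(6)[OF p1] paramsD(6)[OF p2] paramsD(3)[OF p1]
      by (intro lpos_add lpos_mult lpos_const lsub_lpos) auto
  qed
qed

text \<open>The parameters are read off the generators. For \<open>z\<close>: the inner map gives
  \<open>mu l2 z + y^k f2\<close>, and the outer one turns this into
  \<open>mu l2 (mu l1 z + y^k f1) + mu l1 y^k (lsub \<sigma>1 l1 f2)\<close>.\<close>

lemma E_comp:
  assumes p1: "params \<sigma>1 l1 f1" and p2: "params \<sigma>2 l2 f2" and q: "q \<in> img"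
  shows "E \<sigma>1 l1 f1 (E \<sigma>2 l2 f2 q) =
    E (\<sigma>1 \<circ> \<sigma>2) (\<lambda>j. l2 j * l1 (\<sigma>2 j)) (lconst (mu l2) * f1 + lconst (mu l1) * lsub \<sigma>1 l1 f2) q"
proof -
  note l1 = paramsD(3)[OF p1] and l2 = paramsD(3)[OF p2]
  note h1 = E_hom[OF l1] and h2 = E_hom[OF l2]
  show ?thesis
  proof (rule E_unique[where F = "\<lambda>q. E \<sigma>1 l1 f1 (E \<sigma>2 l2 f2 q)", OF _ _ _ _ _ params_comp[OF p1 p2] q])
  have mu: "mu (\<lambda>j. l2 j * l1 (\<sigma>2 j)) = mu l2 * mu l1"
    by (rule mu_comp) (use paramsD[OF p2] in auto)
  have "[:yk * f2, lconst (mu l2):] = [:yk * f2:] + [:lconst (mu l2):] * [:0, 1:]" by simp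
  then have "E \<sigma>1 l1 f1 (E \<sigma>2 l2 f2 [:0, 1:]) =
      [:lsub \<sigma>1 l1 (yk * f2):] + [:lconst (mu l2):] * [:yk * f1, lconst (mu l1):]"
    by (simp only: h1 h2 lsub_lconst[OF l1])
  also have "lsub \<sigma>1 l1 (yk * f2) = lconst (mu l1) * yk * lsub \<sigma>1 l1 f2"
    using lsub_yk[OF l1 paramsD(1,2)[OF p1]] by (simp add: lsub_hom[OF l1])
  finally show "E \<sigma>1 l1 f1 (E \<sigma>2 l2 f2 [:0, 1:]) =
      [:yk * (lconst (mu l2) * f1 + lconst (mu l1) * lsub \<sigma>1 l1 f2), lconst (mu (\<lambda>j. l2 j * l1 (\<sigma>2 j))):]"
    by (simp add: mu algebra_simps)
next
  fix j assume "j \<in> {2..m}"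
  have "E \<sigma>1 l1 f1 (E \<sigma>2 l2 f2 [:lvar j:]) = [:lconst (l2 j) * (lconst (l1 (\<sigma>2 j)) * lvar (\<sigma>1 (\<sigma>2 j))):]"
    by (simp only: h1(5) h2(5) lsub_lvar[OF l1] lsub_lvar[OF l2] lsub_hom(4)[OF l1] lsub_lconst[OF l1])
  then show "E \<sigma>1 l1 f1 (E \<sigma>2 l2 f2 [:lvar j:]) = [:lconst (l2 j * l1 (\<sigma>2 j)) * lvar ((\<sigma>1 \<circ> \<sigma>2) j):]"
    by (simp only: lconst_hom(4) mult.assoc o_apply)
qed (simp_all only: h1 h2 lsub_lconst[OF l1] lsub_lconst[OF l2])
qed

lemma params_id: "params id (\<lambda>_. 1) 0"
  by (simp add: params_def permutes_id mu_def)

lemma E_id: "q \<in> img \<Longrightarrow> E id (\<lambda>_. 1) 0 q = q"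
proof (rule E_unique[where F = "\<lambda>q. q", OF _ _ _ _ _ params_id, symmetric])
  show "[:0, 1:] = [:yk * 0, lconst (mu (\<lambda>_. 1)):]" by (simp add: mu_def)
qed simp_all

lemma E_left_inverse:
  assumes p: "params \<sigma> l f"
  obtains \<sigma>' l' f' where "params \<sigma>' l' f'" "\<And>q. q \<in> img \<Longrightarrow> E \<sigma>' l' f' (E \<sigma> l f q) = q"
proof -
  define \<tau> where "\<tau> = inv_into UNIV \<sigma>"
  define l' where "l' i = 1 / l (\<tau> i)" for i
  \<comment> \<open>Solves \<open>mu l ?f + mu l' (lsub \<tau> l' f) = 0\<close>, the vanishing of
    the shear component in the composition law.\<close>
  let ?f = "- (lconst (mu l' / mu l) * lsub \<tau> l' f)"
  have perm: "\<sigma> permutes {2..m}" by (rule paramsD(1)[OF p])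
  then have iperm: "\<tau> permutes {2..m}" unfolding \<tau>_def by (rule permutes_inv)
  have inv: "\<tau> (\<sigma> i) = i" "\<sigma> (\<tau> i) = i" for i
    using permutes_inverses[OF perm] by (auto simp: \<tau>_def)
  have s: "j \<in> {2..m} \<Longrightarrow> \<tau> j \<in> {2..m}" "j \<notin> {2..m} \<Longrightarrow> \<tau> j = j" for j
    using permutes_in_image[OF iperm, of j] permutes_not_in[OF iperm, of j] by auto
  have l: "l j \<noteq> 0" and l': "l' j \<noteq> 0" for j using paramsD(3)[OF p] by (auto simp: l'_def)
  have "mu (\<lambda>j. l j * l' (\<sigma> j)) = mu l * mu l'"
    by (rule mu_comp) (use paramsD[OF p] in auto)
  then have "mu l * mu l' = 1" using l by (simp add: inv mu_def l'_def)
  then have mu': "mu l' = 1 / mu l" using paramsD(7)[OF p] by (simp add: field_simps)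
  have "\<tau> ` {2..m} \<subseteq> {2..m}" using permutes_image[OF iperm] by simp
  then have f: "?f \<in> lpos m"
    by (intro lpos_minus lpos_mult lpos_const lsub_lpos paramsD(6)[OF p] l')
  have kk: "k (\<tau> j) = k j" if "j \<in> {2..m}" for j
    using paramsD(2)[OF p, of "\<tau> j"] s(1)[OF that] by (simp add: inv)
  have p': "params \<tau> l' ?f"
    unfolding params_def
  proof (intro conjI allI ballI impI)
    show "scaling (mu l')" unfolding mu' by (rule scaling_inverse[OF paramsD(5)[OF p]])
    show "l' j = 1" if "j \<notin> {2..m}" for j using that s(2) paramsD(4)[OF p] by (simp add: l'_def)
  qed (use iperm kk l' f in auto)
  have z: "lconst (mu l) * ?f + lconst (mu l') * lsub \<tau> l' f = 0"
  proof -
    have "mu l * (mu l' / mu l) = mu l'" using paramsD(7)[OF p] by simp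
    then have "lconst (mu l) * lconst (mu l' / mu l) = lconst (mu l')" by (simp only: lconst_hom(4)[symmetric])
    then show ?thesis by (simp only: mult_minus_right mult.assoc[symmetric]) simp
  qed
  have "E \<tau> l' ?f (E \<sigma> l f q) = q" if "q \<in> img" for q
  proof -
    have "E \<tau> l' ?f (E \<sigma> l f q) = E (\<tau> \<circ> \<sigma>) (\<lambda>j. l j * l' (\<sigma> j)) (lconst (mu l) * ?f + lconst (mu l') * lsub \<tau> l' f) q"
      by (rule E_comp[OF p' p that])
    also have "\<tau> \<circ> \<sigma> = id" by (auto simp: inv)
    also have "(\<lambda>j. l j * l' (\<sigma> j)) = (\<lambda>_. 1)" using l by (simp add: inv l'_def)
    finally show ?thesis by (simp only: z E_id[OF that])
  qed
  with p' show thesis by (rule that)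
qed

text \<open>The left inverse is again a triangular substitution and so has a left inverse itself,
  which makes it two-sided.\<close>

lemma E_inverse:
  assumes p: "params \<sigma> l f"
  obtains \<sigma>' l' f' where "params \<sigma>' l' f'" "\<And>q. q \<in> img \<Longrightarrow> E \<sigma>' l' f' (E \<sigma> l f q) = q"
    "\<And>q. q \<in> img \<Longrightarrow> E \<sigma> l f (E \<sigma>' l' f' q) = q"
proof -
  obtain \<sigma>' l' f' where 1: "params \<sigma>' l' f'" "\<And>q. q \<in> img \<Longrightarrow> E \<sigma>' l' f' (E \<sigma> l f q) = q"
    using E_left_inverse[OF p] by blast
  obtain \<sigma>2 l2 f2 where 2: "params \<sigma>2 l2 f2" "\<And>q. q \<in> img \<Longrightarrow> E \<sigma>2 l2 f2 (E \<sigma>' l' f' q) = q"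
    using E_left_inverse[OF 1(1)] by blast
  have "E \<sigma> l f (E \<sigma>' l' f' q) = q" if q: "q \<in> img" for q
  proof -
    have a: "E \<sigma>' l' f' q \<in> img" by (rule E_img[OF 1(1) q])
    then have "E \<sigma> l f (E \<sigma>' l' f' q) = E \<sigma>2 l2 f2 (E \<sigma>' l' f' (E \<sigma> l f (E \<sigma>' l' f' q)))"
      using E_img[OF p] by (simp add: 2(2))
    also have "\<dots> = q" using a q by (simp add: 1(2) 2(2))
    finally show ?thesis .
  qed
  with 1 show thesis by (rule that)
qed


section \<open>Endomorphisms of the image that commute with the derivation\<close>

definition equivariant :: "('a laurent poly \<Rightarrow> 'a laurent poly) \<Rightarrow> bool"
  where "equivariant F \<longleftrightarrow> (\<forall>q\<in>img. F q \<in> img \<and> F (Delta q) = Delta (F q)) \<and>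
    (\<forall>p\<in>img. \<forall>q\<in>img. F (p + q) = F p + F q \<and> F (p * q) = F p * F q) \<and>
    (\<forall>c. F [:lconst c:] = [:lconst c:])"

lemma equivariantD:
  assumes "equivariant F"
  shows "q \<in> img \<Longrightarrow> F q \<in> img" "q \<in> img \<Longrightarrow> F (Delta q) = Delta (F q)"
    "p \<in> img \<Longrightarrow> q \<in> img \<Longrightarrow> F (p + q) = F p + F q"
    "p \<in> img \<Longrightarrow> q \<in> img \<Longrightarrow> F (p * q) = F p * F q" "F [:lconst c:] = [:lconst c:]"
  using assms by (auto simp: equivariant_def)

text \<open>The map induced on the kernel \<open>A\<close>. Taking the constant term is harmless,
  since an equivariant map sends constants from \<open>A\<close> to constants from
  \<open>A\<close>.\<close>

definition restr :: "('a laurent poly \<Rightarrow> 'a laurent poly) \<Rightarrow> 'a laurent \<Rightarrow> 'a laurent"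
  where "restr F c = coeff (F [:c:]) 0"

lemma equivariant_restr:
  assumes F: "equivariant F" and c: "c \<in> lpos m"
  shows "F [:c:] = [:restr F c:]" "restr F c \<in> lpos m"
proof -
  have "Delta (F [:c:]) = F (Delta [:c:])" using equivariantD(2)[OF F img_lpos[OF c]] by simp
  also have "\<dots> = 0" using equivariantD(5)[OF F, of 0] by simp
  finally obtain c' where "c' \<in> lpos m" "F [:c:] = [:c':]"
    using Delta_eq_0D[OF equivariantD(1)[OF F img_lpos[OF c]]] by blast
  then show "F [:c:] = [:restr F c:]" "restr F c \<in> lpos m" by (simp_all add: restr_def)
qed

lemma restr_hom:
  assumes F: "equivariant F"
  shows "a \<in> lpos m \<Longrightarrow> b \<in> lpos m \<Longrightarrow> restr F (a * b) = restr F a * restr F b"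
    "restr F (lconst c) = lconst c"
proof -
  show "restr F (a * b) = restr F a * restr F b" if ab: "a \<in> lpos m" "b \<in> lpos m"
  proof -
    have "F ([:a:] * [:b:]) = F [:a:] * F [:b:]"
      by (intro equivariantD(4)[OF F] img_lpos ab)
    then have "[:restr F (a * b):] = [:restr F a:] * [:restr F b:]"
      using ab equivariant_restr(1)[OF F lpos_mult[OF ab]] by (simp add: equivariant_restr(1)[OF F] mult.commute)
    then show ?thesis by (simp add: mult.commute)
  qed
  show "restr F (lconst c) = lconst c" using equivariantD(5)[OF F] by (simp add: restr_def)
qed

lemma restr_inverse:
  assumes F: "equivariant F" and F': "equivariant F'" and inv: "\<And>q. q \<in> img \<Longrightarrow> F' (F q) = q"
    and c: "c \<in> lpos m"
  shows "restr F' (restr F c) = c"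
proof -
  have "[:c:] = F' (F [:c:])" using inv[OF img_lpos[OF c]] by simp
  also have "\<dots> = [:restr F' (restr F c):]"
    using c by (simp add: equivariant_restr[OF F] equivariant_restr[OF F'])
  finally show ?thesis by simp
qed

text \<open>From \<open>Delta z = y^k\<close> the derivative of \<open>F z\<close> is
  \<open>F(y^k) / y^k\<close>, which is free of \<open>z\<close>; so \<open>F z\<close> has degree
  at most one. This is below \<open>d\<close>, hence both coefficients lie in \<open>A\<close>, and
  comparing constant terms gives \<open>F(y^k) = y^k a\<close>.\<close>

lemma equivariant_z:
  assumes F: "equivariant F"
  obtains g a where "g \<in> lpos m" "a \<in> lpos m" "F [:0, 1:] = [:g, a:]" "restr F yk = yk * a"
proof -
  have Fz: "F [:0, 1:] \<in> img" by (rule equivariantD(1)[OF F img_z])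
  have D1: "Delta (F [:0, 1:]) = [:restr F yk:]"
    using equivariantD(2)[OF F img_z] equivariant_restr(1)[OF F yk_lpos] by simp
  then have "smult yk_inv (Delta (F [:0, 1:])) = [:yk_inv * restr F yk:]" by simp
  then have pd: "pderiv (F [:0, 1:]) = [:yk_inv * restr F yk:]" by (simp add: Delta_def yk_inv)
  have "degree (F [:0, 1:]) \<le> 1"
  proof -
    have "degree (F [:0, 1:]) - 1 = 0"
      using degree_pderiv[of "F [:0, 1:]"] pd by simp
    then show ?thesis by simp
  qed
  then have "F [:0, 1:] = [:coeff (F [:0, 1:]) 0, coeff (F [:0, 1:]) 1:]" (is "_ = [:?g, ?a:]")
    by (intro poly_eqI) (auto simp: coeff_pCons coeff_eq_0 split: nat.splits)
  moreover have "?g \<in> lpos m" "?a \<in> lpos m"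
    using \<open>degree (F [:0, 1:]) \<le> 1\<close> deg by (auto intro!: img_low_degree[OF Fz])
  moreover have "restr F yk = yk * ?a"
  proof -
    have "coeff (Delta (F [:0, 1:])) 0 = yk * ?a" by (simp add: Delta_def coeff_pderiv)
    then show ?thesis by (simp add: D1)
  qed
  ultimately show thesis using that by blast
qed

text \<open>Both factors of 1 are monomials, and nonnegative exponent vectors with sum zero are
  zero.\<close>

lemma lpos_unit:
  assumes "a \<in> lpos m" "b \<in> lpos m" "a * b = (1 :: 'a laurent)"
  shows "\<exists>c. c \<noteq> 0 \<and> a = lconst c"
proof -
  have ab: "a * b = single 0 1" "b * a = single 0 1" using assms(3) by (simp_all add: mult.commute)
  obtain \<alpha> u where a: "u \<noteq> 0" "a = single \<alpha> u" using monomial_if_mult_monomial[OF ab(1)] by auto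
  obtain \<beta> v where b: "v \<noteq> 0" "b = single \<beta> v" using monomial_if_mult_monomial[OF ab(2)] by auto
  have "single (\<alpha> + \<beta>) (u * v) = single 0 (1 :: 'a)" using ab(1) a b by (simp add: mult_single)
  then have "lookup (single 0 (1 :: 'a)) (\<alpha> + \<beta>) \<noteq> 0" using a b by (metis lookup_single_eq mult_eq_0_iff)
  then have "\<alpha> + \<beta> = 0" by (simp add: lookup_one when_def split: if_splits)
  moreover have "0 \<le> lookup \<alpha> i" "0 \<le> lookup \<beta> i" for i
    using assms(1,2) a b by (auto simp: lpos_def)
  ultimately have "lookup \<alpha> i = 0" for i
    by (metis add_nonneg_eq_0_iff lookup_add lookup_zero)
  then have "\<alpha> = 0" by (intro poly_mapping_eqI) simp
  with a show ?thesis by (auto simp: lconst_def)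
qed

text \<open>Applied to an automorphism and its inverse, monotonicity of the total degree shows that
  variables go to multiples of variables.\<close>

definition tot :: "(nat \<Rightarrow>\<^sub>0 int) \<Rightarrow> int" where "tot \<nu> = (\<Sum>i\<in>{2..m}. lookup \<nu> i)"

lemma tot_simps [simp]: "tot (\<mu> + \<nu>) = tot \<mu> + tot \<nu>" "tot 0 = 0"
  "j \<in> {2..m} \<Longrightarrow> tot (single j 1) = 1"
  by (simp_all add: tot_def lookup_add sum.distrib lookup_single when_def)

definition pexp :: "(nat \<Rightarrow>\<^sub>0 int) \<Rightarrow> bool"
  where "pexp \<nu> \<longleftrightarrow> keys \<nu> \<subseteq> {2..m} \<and> (\<forall>i. 0 \<le> lookup \<nu> i)"

lemma pexp_tot: assumes "pexp \<nu>" shows "tot \<nu> \<ge> 0" "tot \<nu> = 0 \<Longrightarrow> \<nu> = 0"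
proof -
  show "tot \<nu> \<ge> 0" using assms by (simp add: tot_def pexp_def sum_nonneg)
  assume "tot \<nu> = 0"
  then have "\<forall>i\<in>{2..m}. lookup \<nu> i = 0"
    using assms unfolding tot_def pexp_def by (subst (asm) sum_nonneg_eq_0_iff) auto
  then show "\<nu> = 0" using assms by (intro poly_mapping_eqI) (metis in_keys_iff lookup_zero pexp_def subsetD)
qed

lemma pexp_split:
  assumes "pexp \<nu>" "tot \<nu> > 0"
  obtains j \<mu> where "j \<in> {2..m}" "pexp \<mu>" "\<nu> = single j 1 + \<mu>"
proof -
  have "\<exists>j\<in>{2..m}. lookup \<nu> j > 0"
  proof (rule ccontr)
    assume "\<not> ?thesis"
    then have "tot \<nu> \<le> 0" unfolding tot_def by (intro sum_nonpos) force
    with assms show False by simp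
  qed
  then obtain j where j: "j \<in> {2..m}" "lookup \<nu> j > 0" by blast
  let ?\<mu> = "\<nu> - single j 1"
  have "keys ?\<mu> \<subseteq> {2..m}"
  proof
    fix i assume "i \<in> keys ?\<mu>"
    then have "i \<in> keys \<nu> \<or> i = j" by (auto simp: in_keys_iff lookup_minus lookup_single when_def split: if_splits)
    then show "i \<in> {2..m}" using assms j by (auto simp: pexp_def)
  qed
  moreover have "0 \<le> lookup ?\<mu> i" for i
    using assms j by (auto simp: pexp_def lookup_minus lookup_single when_def)
  ultimately have "pexp ?\<mu>" by (simp add: pexp_def)
  then show thesis using that[OF j(1), of ?\<mu>] by simp
qed

lemma pexp_lpos: "pexp \<nu> \<Longrightarrow> single \<nu> c \<in> lpos m"
  by (rule lpos_single) (auto simp: pexp_def)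

lemma lpos_pexp: "single \<nu> c \<in> lpos m \<Longrightarrow> c \<noteq> 0 \<Longrightarrow> pexp \<nu>"
  by (auto simp: lpos_def pexp_def)

lemma restr_lvar_monomial:
  assumes F: "equivariant F" and yk: "restr F yk = yk * lconst c" "c \<noteq> 0" and j: "j \<in> {2..m}"
  shows "\<exists>\<alpha> u. u \<noteq> 0 \<and> restr F (lvar j) = single \<alpha> u \<and> pexp \<alpha>"
proof -
  \<comment> \<open>The cofactor of \<open>y_j\<close> in \<open>y^k\<close>; it stays in
    \<open>A\<close> because \<open>k j\<close> is positive.\<close>
  let ?q = "lvar j ^ (k j - 1) * (\<Prod>i\<in>{2..m} - {j}. lvar i ^ k i) :: 'a laurent"
  have q: "?q \<in> lpos m" using j by (intro lpos_mult lpos_prod lpos_power lpos_lvar) auto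
  have "lvar j ^ k j = (lvar j * lvar j ^ (k j - 1) :: 'a laurent)"
    using k[OF j] by (cases "k j") auto
  then have "yk = lvar j * ?q" using j by (simp add: yk_prod prod.remove mult.assoc)
  then have "restr F yk = restr F (lvar j) * restr F ?q"
    using restr_hom(1)[OF F lpos_lvar[OF j] q] by simp
  moreover have "restr F yk = single kexp c"
    using yk(1) by (simp add: yk_def lconst_def mult_single)
  ultimately have "restr F (lvar j) * restr F ?q = single kexp c" by simp
  then obtain \<alpha> u where "u \<noteq> 0" "restr F (lvar j) = single \<alpha> u"
    using monomial_if_mult_monomial yk(2) by blast
  moreover from this have "pexp \<alpha>"
    using equivariant_restr(2)[OF F lpos_lvar[OF j]] lpos_pexp by simp
  ultimately show ?thesis by blast
qed

text \<open>Variables are peeled off one at a time, and each contributes a monomial of total degree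
  at least one; so the total degree cannot drop.\<close>

lemma restr_monomial_tot:
  assumes F: "equivariant F"
    and mon: "\<And>j. j \<in> {2..m} \<Longrightarrow> \<exists>\<alpha> u. u \<noteq> 0 \<and> restr F (lvar j) = single \<alpha> u \<and> tot \<alpha> \<ge> 1"
    and \<nu>: "pexp \<nu>"
  shows "\<exists>\<beta> v. v \<noteq> 0 \<and> restr F (single \<nu> 1) = single \<beta> v \<and> tot \<beta> \<ge> tot \<nu>"
  using \<nu>
proof (induction "nat (tot \<nu>)" arbitrary: \<nu> rule: less_induct)
  case (less \<nu>)
  show ?case
  proof (cases "tot \<nu> > 0")
    case False
    then have "\<nu> = 0" using pexp_tot[OF less.prems] by simp
    moreover have "restr F (single 0 1) = single 0 1"
      using restr_hom(2)[OF F, of 1] by (simp add: lconst_def)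
    ultimately show ?thesis by (intro exI[of _ 0] exI[of _ 1]) simp
  next
    case True
    obtain j \<mu> where j: "j \<in> {2..m}" "pexp \<mu>" "\<nu> = single j 1 + \<mu>"
      using pexp_split[OF less.prems True] by blast
    then have t: "tot \<nu> = 1 + tot \<mu>" by simp
    then obtain \<beta> v where b: "v \<noteq> 0" "restr F (single \<mu> 1) = single \<beta> v" "tot \<beta> \<ge> tot \<mu>"
      using less.hyps[of \<mu>] j True pexp_tot[OF j(2)] by auto
    obtain \<alpha> u where a: "u \<noteq> 0" "restr F (lvar j) = single \<alpha> u" "tot \<alpha> \<ge> 1" using mon[OF j(1)] by blast
    have "single \<nu> 1 = lvar j * single \<mu> (1 :: 'a)" by (simp add: j(3) lvar_def mult_single)
    then have "restr F (single \<nu> 1) = restr F (lvar j) * restr F (single \<mu> 1)"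
      by (simp only: restr_hom(1)[OF F lpos_lvar[OF j(1)] pexp_lpos[OF j(2)]])
    then have "restr F (single \<nu> 1) = single (\<alpha> + \<beta>) (u * v)" by (simp add: a b mult_single)
    then show ?thesis using a b t by (intro exI[of _ "\<alpha> + \<beta>"] exI[of _ "u * v"]) simp
  qed
qed

text \<open>A nonzero constant divided by \<open>y^k\<close> has the exponent \<open>- k 2\<close>
  at \<open>y_2\<close>, so the quotient lies outside \<open>A\<close>.\<close>

lemma lconst_eq_yk_multD:
  assumes "lconst c = yk * a" "a \<in> lpos m"
  shows "c = 0"
proof (rule ccontr)
  assume c: "c \<noteq> 0"
  have "yk_inv * (yk * a) = a" by (simp add: yk_inv flip: mult.assoc)
  then have "a = yk_inv * lconst c" using assms(1) by simp
  then have "a = single (- kexp) c" by (simp add: yk_inv_def lconst_def mult_single)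
  then have "pexp (- kexp)" using assms(2) c lpos_pexp by blast
  then have "0 \<le> lookup (- kexp) 2" unfolding pexp_def by blast
  moreover have "lookup kexp 2 = int (k 2)" using m by (simp add: kexp_def lookup_sum lookup_single when_def)
  ultimately show False using k[of 2] m by simp
qed

theorem equivariant_is_E:
  assumes F: "equivariant F" and F': "equivariant F'"
    and FF': "\<And>q. q \<in> img \<Longrightarrow> F (F' q) = q" and F'F: "\<And>q. q \<in> img \<Longrightarrow> F' (F q) = q"
  shows "\<exists>\<sigma> l f. params \<sigma> l f \<and> (\<forall>q\<in>img. F q = E \<sigma> l f q)"
proof -
  obtain g a where g: "g \<in> lpos m" "a \<in> lpos m" "F [:0, 1:] = [:g, a:]" "restr F yk = yk * a"
    by (rule equivariant_z[OF F])
  obtain g' a' where g': "a' \<in> lpos m" "restr F' yk = yk * a'"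
    by (rule equivariant_z[OF F'])
  \<comment> \<open>Applying \<open>F\<close> to \<open>F'(y^k) = y^k a'\<close> gives
    \<open>y^k = y^k a F(a')\<close>, so \<open>a\<close> is a unit of \<open>A\<close>.\<close>
  have "yk * (a * restr F a') = restr F yk * restr F a'" by (simp add: g(4))
  also have "\<dots> = restr F (restr F' yk)"
    using restr_hom(1)[OF F yk_lpos g'(1)] by (simp add: g'(2))
  also have "\<dots> = yk * 1" using restr_inverse[OF F' F FF' yk_lpos] by simp
  finally have aa: "a * restr F a' = 1" by (simp only: mult_cancel_left) simp
  obtain c where c: "c \<noteq> 0" "a = lconst c"
    using lpos_unit[OF g(2) equivariant_restr(2)[OF F g'(1)] aa] by blast
  have "restr F' a * restr F' (restr F a') = restr F' 1"
    using restr_hom(1)[OF F' g(2) equivariant_restr(2)[OF F g'(1)]] aa by simp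
  then have "lconst c * a' = 1"
    using restr_hom(2)[OF F', of 1] by (simp add: restr_inverse[OF F F' F'F g'(1)] c restr_hom(2)[OF F'])
  then have "a' * lconst c = 1" by (simp add: mult.commute)
  then obtain c' where c': "c' \<noteq> 0" "a' = lconst c'" using lpos_unit[OF g'(1) lpos_const] by blast
  have mon: "\<exists>\<alpha> u. u \<noteq> 0 \<and> restr F (lvar j) = single \<alpha> u \<and> pexp \<alpha>" if "j \<in> {2..m}" for j
    using restr_lvar_monomial[OF F _ c(1) that] g(4) c by simp
  \<comment> \<open>If a variable went to a constant, the inverse map, which fixes constants, would
    show that the variable is that constant. Stated for an arbitrary pair so that it serves both
    \<open>F\<close> and \<open>F'\<close>.\<close>
  have pos: "tot \<alpha> \<ge> 1" if "equivariant H" "equivariant H'" "\<And>q. q \<in> img \<Longrightarrow> H' (H q) = q"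
    "j \<in> {2..m}" "restr H (lvar j) = single \<alpha> u" "pexp \<alpha>" for H H' j \<alpha> u
  proof (rule ccontr)
    assume "\<not> tot \<alpha> \<ge> 1"
    then have "\<alpha> = 0" using pexp_tot[OF that(6)] by simp
    then have "lvar j = lconst u"
      using restr_inverse[OF that(1-3) lpos_lvar[OF that(4)]] that(5) restr_hom(2)[OF that(2), of u]
      by (simp add: lconst_def)
    then have "lookup (lvar j :: 'a laurent) (single j 1) = lookup (lconst u) (single j 1)" by simp
    then show False by (simp add: lvar_def lconst_def lookup_single when_def)
  qed
  have mon': "\<exists>\<alpha> u. u \<noteq> 0 \<and> restr F' (lvar j) = single \<alpha> u \<and> tot \<alpha> \<ge> 1" if "j \<in> {2..m}" for j
    using restr_lvar_monomial[OF F' _ c'(1) that] g'(2) c' pos[OF F' F FF' that] by auto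
  have lv: "\<exists>i u. i \<in> {2..m} \<and> u \<noteq> 0 \<and> restr F (lvar j) = lconst u * lvar i" if j: "j \<in> {2..m}" for j
  proof -
    obtain \<alpha> u where \<alpha>: "u \<noteq> 0" "restr F (lvar j) = single \<alpha> u" "pexp \<alpha>" using mon[OF j] by blast
    then have t1: "tot \<alpha> \<ge> 1" using pos[OF F F' F'F j] by blast
    \<comment> \<open>\<open>F'\<close> does not lower the total degree, yet it brings the monomial
      with exponent \<open>\<alpha>\<close> back to a multiple of \<open>y_j\<close>; so
      \<open>\<alpha>\<close> has total degree one.\<close>
    obtain \<beta> v where \<beta>: "v \<noteq> 0" "restr F' (single \<alpha> 1) = single \<beta> v" "tot \<beta> \<ge> tot \<alpha>"
      using restr_monomial_tot[OF F' mon' \<alpha>(3)] by blast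
    have "single \<alpha> u = lconst u * single \<alpha> 1" by (simp add: lconst_mult_single)
    then have "restr F' (single \<alpha> u) = lconst u * single \<beta> v"
      by (simp only: restr_hom(1)[OF F' lpos_const pexp_lpos[OF \<alpha>(3)]] restr_hom(2)[OF F'] \<beta>(2))
    then have "lvar j = single \<beta> (u * v)"
      using restr_inverse[OF F F' F'F lpos_lvar[OF j]] \<alpha>(2) by (simp add: lconst_mult_single)
    then have "lookup (lvar j :: 'a laurent) \<beta> = u * v" by simp
    then have "lookup (lvar j :: 'a laurent) \<beta> \<noteq> 0" using \<alpha> \<beta> by simp
    then have "\<beta> = single j 1" by (simp add: lvar_def lookup_single when_def split: if_splits)
    then have "tot \<beta> = 1" using j by simp
    with t1 \<beta>(3) have t: "tot \<alpha> = 1" by simp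
    then obtain i \<mu> where i: "i \<in> {2..m}" "pexp \<mu>" "\<alpha> = single i 1 + \<mu>" using pexp_split[OF \<alpha>(3)] by auto
    then have "tot \<mu> = 0" using t by simp
    then have "\<alpha> = single i 1" using pexp_tot(2)[OF i(2)] i(3) by simp
    then have "lconst u * lvar i = single \<alpha> u" by (simp add: lvar_def lconst_mult_single)
    then have "restr F (lvar j) = lconst u * lvar i" by (simp only: \<alpha>(2))
    with i \<alpha> show ?thesis by blast
  qed
  then obtain s u where su: "\<And>j. j \<in> {2..m} \<Longrightarrow> s j \<in> {2..m}" "\<And>j. j \<in> {2..m} \<Longrightarrow> u j \<noteq> 0"
    "\<And>j. j \<in> {2..m} \<Longrightarrow> restr F (lvar j) = lconst (u j) * lvar (s j)" by metis
  define \<sigma> where "\<sigma> j = (if j \<in> {2..m} then s j else j)" for j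
  define l where "l j = (if j \<in> {2..m} then u j else 1)" for j
  have lvar_inj: "i = j" if "lconst x * lvar i = lconst y * lvar j" "x \<noteq> 0" for i j and x y :: 'a
  proof -
    have "single (single i (1::int)) x = single (single j 1) y"
      using that by (simp add: lvar_def lconst_mult_single)
    then have "lookup (single (single j (1::int)) y) (single i 1) \<noteq> 0" using that by (metis lookup_single_eq)
    then have "single j (1::int) = single i 1" by (simp add: lookup_single when_def split: if_splits)
    then have "lookup (single j (1::int)) i = 1" by simp
    then show ?thesis by (simp add: lookup_single when_def split: if_splits)
  qed
  have inj: "inj_on s {2..m}"
  proof (rule inj_onI)
    fix i j assume ij: "i \<in> {2..m}" "j \<in> {2..m}" "s i = s j"
    \<comment> \<open>The scalars are crossed so that both elements have the image
      \<open>u_i u_j y_(s i)\<close>; injectivity of \<open>F\<close> on \<open>A\<close> does the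
      rest.\<close>
    have "restr F (lconst (u j) * lvar i) = restr F (lconst (u i) * lvar j)"
      using ij by (simp add: restr_hom[OF F] lpos_lvar su(3) mult_ac)
    then have "restr F' (restr F (lconst (u j) * lvar i)) = restr F' (restr F (lconst (u i) * lvar j))" by simp
    then have "lconst (u j) * lvar i = lconst (u i) * lvar j"
      using ij by (simp only: restr_inverse[OF F F' F'F] lpos_mult lpos_const lpos_lvar)
    then show "i = j" using lvar_inj su(2)[OF ij(2)] by blast
  qed
  have perm: "\<sigma> permutes {2..m}"
  proof (rule bij_imp_permutes)
    have "s ` {2..m} = {2..m}" by (rule endo_inj_surj) (use su inj in auto)
    then have "bij_betw s {2..m} {2..m}" using inj by (simp add: bij_betw_def)
    moreover have "bij_betw \<sigma> {2..m} {2..m} \<longleftrightarrow> bij_betw s {2..m} {2..m}"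
      by (rule bij_betw_cong) (simp add: \<sigma>_def)
    ultimately show "bij_betw \<sigma> {2..m} {2..m}" by simp
  qed (auto simp: \<sigma>_def)
  have "restr F (\<Prod>j\<in>S. lvar j ^ n j) = (\<Prod>j\<in>S. (lconst (u j) * lvar (s j)) ^ n j)"
    if "finite S" "S \<subseteq> {2..m}" for S n
  proof -
    have pw: "restr F (lvar j ^ n) = (lconst (u j) * lvar (s j)) ^ n" if "j \<in> {2..m}" for j n
    proof (induction n)
      case 0
      then show ?case using restr_hom(2)[OF F, of 1] by simp
    next
      case (Suc n)
      then show ?case
        by (simp only: power_Suc restr_hom(1)[OF F lpos_lvar[OF that] lpos_power[OF lpos_lvar[OF that]]] su(3)[OF that])
    qed
    show ?thesis using that
    proof (induction S)
      case empty
      then show ?case using restr_hom(2)[OF F, of 1] by simp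
    next
      case (insert j S)
      have j: "j \<in> {2..m}" "S \<subseteq> {2..m}" using insert by auto
      have "(\<Prod>j\<in>S. lvar j ^ n j) \<in> (lpos m :: 'a laurent set)"
        using j(2) by (intro lpos_prod lpos_power lpos_lvar) blast
      moreover have "lvar j ^ n j \<in> (lpos m :: 'a laurent set)" using j(1) by (intro lpos_power lpos_lvar)
      ultimately show ?case using insert j by (simp add: restr_hom(1)[OF F] pw)
    qed
  qed
  \<comment> \<open>The image of \<open>y^k\<close> computed in two ways, as \<open>c y^k\<close>
    and factor by factor. Comparing exponents gives \<open>k (s i) = k i\<close>, comparing
    coefficients gives \<open>mu l = c\<close>.\<close>
  from this[of "{2..m}" k] have "yk * lconst c = lconst (\<Prod>j\<in>{2..m}. u j ^ k j) * (\<Prod>j\<in>{2..m}. lvar (s j) ^ k j)"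
    using g(4) c by (simp add: yk_prod power_mult_distrib prod.distrib lconst_prod)
  moreover have "(\<Prod>j\<in>{2..m}. u j ^ k j) = mu l" unfolding mu_def l_def by (intro prod.cong) auto
  moreover have "(\<Prod>j\<in>{2..m}. lvar (s j) ^ k j) = (single (\<Sum>j\<in>{2..m}. single (s j) (int (k j))) 1 :: 'a laurent)"
  proof -
    have inv: "inv_into {2..m} s (s j) = j" if "j \<in> {2..m}" for j using inj that by simp
    have im: "s ` {2..m} = {2..m}" by (rule endo_inj_surj) (use su inj in auto)
    have "(\<Prod>j\<in>{2..m}. lvar (s j) ^ k j) = (\<Prod>j\<in>s ` {2..m}. lvar j ^ k (inv_into {2..m} s j) :: 'a laurent)"
      using inv by (simp add: prod.reindex[OF inj])
    also have "\<dots> = single (\<Sum>j\<in>s ` {2..m}. single j (int (k (inv_into {2..m} s j)))) 1"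
      by (rule prod_lvar_power)
    also have "(\<Sum>j\<in>s ` {2..m}. single j (int (k (inv_into {2..m} s j)))) = (\<Sum>j\<in>{2..m}. single (s j) (int (k j)))"
      using inv by (simp add: sum.reindex[OF inj])
    finally show ?thesis .
  qed
  ultimately have "single kexp c = single (\<Sum>j\<in>{2..m}. single (s j) (int (k j))) (mu l)" (is "_ = single ?\<kappa> _")
    by (simp add: yk_def lconst_def mult_single)
  moreover from this have "lookup (single ?\<kappa> (mu l)) kexp \<noteq> 0" using c(1) by (metis lookup_single_eq)
  ultimately have \<kappa>: "kexp = ?\<kappa>" and mu: "mu l = c"
    by (auto simp: lookup_single when_def split: if_splits) (metis lookup_single_eq)
  have kk: "k (s i) = k i" if i: "i \<in> {2..m}" for i
  proof -
    have "lookup ?\<kappa> (s i) = (\<Sum>j\<in>{2..m}. if j = i then int (k j) else 0)"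
      unfolding lookup_sum using i inj_onD[OF inj] by (intro sum.cong) (auto simp: lookup_single when_def)
    then have "lookup ?\<kappa> (s i) = int (k i)" using i by simp
    moreover have "lookup kexp (s i) = int (k (s i))"
      using su(1)[OF i] by (simp add: kexp_def lookup_sum lookup_single when_def)
    ultimately show ?thesis by (simp add: \<kappa>)
  qed
  have Fmap: "F (map_poly lconst Q) = pcompose (map_poly lconst Q) [:g, lconst c:]" for Q
  proof (induction Q)
    case 0
    then show ?case using equivariantD(5)[OF F, of 0] by simp
  next
    case (pCons b Q)
    have eq: "map_poly lconst (pCons b Q) = [:lconst b:] + [:0, 1:] * map_poly lconst Q"
      by (simp add: map_poly_pCons)
    have "F ([:lconst b:] + [:0, 1:] * map_poly lconst Q) = [:lconst b:] + [:g, lconst c:] * pcompose (map_poly lconst Q) [:g, lconst c:]"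
      by (simp only: equivariantD(3-5)[OF F] img_const img_z img_map_poly img_mult pCons.IH g(3) c(2))
    also have "\<dots> = pcompose (map_poly lconst (pCons b Q)) [:g, lconst c:]"
      by (simp only: map_poly_pCons lconst_hom(1) pcompose_pCons)
    finally show ?case unfolding eq .
  qed
  \<comment> \<open>With this choice \<open>y^k X\<close> equals
    \<open>P(c z + g) - c^d P(z)\<close> for the normalised \<open>P\<close>. The top terms cancel,
    so \<open>X\<close> is an element of the image of degree below \<open>d\<close> and its
    coefficients lie in \<open>A\<close>.\<close>
  let ?X = "F Y1 * [:lconst c:] - smult (lconst (c ^ d)) Y1"
  have FY1: "F Y1 \<in> img" by (rule equivariantD(1)[OF F img_Y1])
  have X: "?X \<in> img" by (intro img_diff img_mult img_const img_smult lpos_const img_Y1 FY1)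
  have "F ([:yk:] * Y1) = F [:yk:] * F Y1" by (intro equivariantD(4)[OF F] img_lpos yk_lpos img_Y1)
  moreover have "[:yk:] * Y1 = PL" by (simp add: yk_Y1)
  ultimately have "F PL = [:yk * lconst c:] * F Y1"
    by (simp only: equivariant_restr(1)[OF F yk_lpos] g(4) c(2))
  then have FPL: "pcompose PL [:g, lconst c:] = smult yk (F Y1 * [:lconst c:])"
    using Fmap[of Pn] by (simp add: PL_def mult.commute)
  have Xeq: "smult yk ?X = pcompose PL [:g, lconst c:] - smult (lconst (c ^ d)) PL"
    unfolding FPL by (simp add: smult_diff_right mult.commute flip: yk_Y1)
  have d1: "Suc (d - 1) = d" using d_pos by simp
  have degX: "degree ?X < d"
  proof -
    have "degree (pcompose PL [:g, lconst c:]) \<le> d"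
      using degree_pcompose_le[of PL "[:g, lconst c:]"] by (auto split: if_splits)
    then have "degree (smult yk ?X) \<le> d"
      unfolding Xeq by (intro degree_diff_le) auto
    moreover have "coeff (smult yk ?X) d = 0"
      unfolding Xeq using coeff_pcompose_linear_lead[of PL d g "lconst c"] by simp
    ultimately have "degree (smult yk ?X) < d"
      using d_pos by (metis degree_0 eq_zero_or_degree_less)
    then show ?thesis by simp
  qed
  have Xlpos: "coeff ?X i \<in> lpos m" for i by (rule img_low_degree[OF X degX])
  \<comment> \<open>The normalised polynomial has no term of degree \<open>d - 1\<close>, so the
    coefficient of \<open>y^k X\<close> there is \<open>n g\<close>. The constant \<open>n\<close>
    is invertible in characteristic zero, which exhibits \<open>g\<close> as \<open>y^k\<close>
    times an element of \<open>A\<close>.\<close>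
  define n where "n = lconst (of_nat d * c ^ (d - 1))"
  define n' where "n' = lconst (1 / (of_nat d * c ^ (d - 1)))"
  have nn': "n' * n = 1" using c d_pos unfolding n_def n'_def by (simp flip: lconst_hom(4))
  have "yk * coeff ?X (d - 1) = coeff (smult yk ?X) (d - 1)" by simp
  also have "\<dots> = n * g"
    using coeff_pcompose_linear_sublead[of PL "d - 1" g "lconst c"] coeff_Pn_sublead
    unfolding Xeq d1 by (simp add: n_def)
  finally have "g = n' * (yk * coeff ?X (d - 1))" by (simp add: nn' flip: mult.assoc)
  define f where "f = n' * coeff ?X (d - 1)"
  have f: "f \<in> lpos m" unfolding f_def n'_def by (intro lpos_mult lpos_const Xlpos)
  have gf: "g = yk * f" unfolding f_def using \<open>g = _\<close> by (simp add: mult_ac)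
  \<comment> \<open>Now the shift by \<open>g = y^k f\<close> can be removed at the cost of
    \<open>y^k h\<close>: the difference \<open>P(c z) - c^d P(z)\<close> is
    \<open>y^k (X - h)\<close>, with \<open>X - h\<close> in the image and again of degree below
    \<open>d\<close>.\<close>
  obtain h where h: "h \<in> img" "pcompose PL [:yk * f, lconst c:] = pcompose PL [:0, lconst c:] + smult yk h"
    using pcompose_shift_divisible[OF f, of Pn c] by (auto simp: PL_def)
  have c0: "coeff (pcompose PL [:0, lconst c:]) i = lconst (c ^ i * coeff Pn i)" for i
    by (simp add: coeff_pcompose_linear)
  have Yeq: "smult yk (?X - h) = pcompose PL [:0, lconst c:] - smult (lconst (c ^ d)) PL"
    using Xeq h(2) by (simp add: gf smult_diff_right)
  have degXh: "degree (?X - h) < d"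
  proof -
    have "degree (pcompose PL [:0, lconst c:]) \<le> d"
      using degree_pcompose_le[of PL "[:0, lconst c:]"] by (auto split: if_splits)
    then have "degree (smult yk (?X - h)) \<le> d"
      unfolding Yeq by (intro degree_diff_le) auto
    moreover have "coeff (smult yk (?X - h)) d = 0"
      unfolding Yeq by (simp add: c0)
    ultimately have "degree (smult yk (?X - h)) < d"
      using d_pos by (metis degree_0 eq_zero_or_degree_less)
    then show ?thesis by simp
  qed
  have "scaling c"
    unfolding scaling_iff
  proof (intro allI impI)
    fix i assume i: "coeff Pn i \<noteq> 0"
    \<comment> \<open>The coefficient is a constant of \<open>K\<close> and at the same time
      \<open>y^k\<close> times an element of \<open>A\<close>, so it must vanish.\<close>
    have "coeff (smult yk (?X - h)) i = lconst (c ^ i * coeff Pn i - c ^ d * coeff Pn i)"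
      unfolding Yeq by (simp add: c0)
    then have "lconst (c ^ i * coeff Pn i - c ^ d * coeff Pn i) = yk * coeff (?X - h) i" by simp
    then have "c ^ i * coeff Pn i - c ^ d * coeff Pn i = 0"
      by (rule lconst_eq_yk_multD) (rule img_low_degree[OF img_diff[OF X h(1)] degXh])
    with i show "c ^ i = c ^ d" by simp
  qed
  then have p: "params \<sigma> l f"
    unfolding params_def using perm kk su(2) f by (auto simp: \<sigma>_def l_def[of] mu)
  moreover have "F q = E \<sigma> l f q" if "q \<in> img" for q
  proof (rule E_unique[OF _ _ _ _ _ p that])
    show "F [:0, 1:] = [:yk * f, lconst (mu l):]" by (simp add: g(3) gf mu c)
    show "F [:lvar j:] = [:lconst (l j) * lvar (\<sigma> j):]" if "j \<in> {2..m}" for j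
      using that by (simp add: equivariant_restr(1)[OF F lpos_lvar] su(3) l_def \<sigma>_def)
  qed (use equivariantD[OF F] in auto)
  ultimately show ?thesis by blast
qed


subsection \<open>The automorphism group\<close>

definition Tr :: "(nat \<Rightarrow> nat) \<Rightarrow> (nat \<Rightarrow> 'a) \<Rightarrow> 'a laurent \<Rightarrow> 'a mpoly set \<Rightarrow> 'a mpoly set"
  where "Tr \<sigma> l f = lift (E \<sigma> l f)"

abbreviation A where "A \<equiv> Aut_D m k P"

lemma Tr_B [simp]: "params \<sigma> l f \<Longrightarrow> b \<in> carrier B \<Longrightarrow> Tr \<sigma> l f b \<in> carrier B"
  by (simp add: Tr_def lift_apply E_img)

lemma psi_Tr [simp]: "params \<sigma> l f \<Longrightarrow> b \<in> carrier B \<Longrightarrow> psi (Tr \<sigma> l f b) = E \<sigma> l f (psi b)"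
  by (simp add: Tr_def lift_apply E_img)

lemma Tr_compose:
  assumes p1: "params \<sigma>1 l1 f1" and p2: "params \<sigma>2 l2 f2"
  shows "compose (carrier B) (Tr \<sigma>1 l1 f1) (Tr \<sigma>2 l2 f2) =
    Tr (\<sigma>1 \<circ> \<sigma>2) (\<lambda>j. l2 j * l1 (\<sigma>2 j)) (lconst (mu l2) * f1 + lconst (mu l1) * lsub \<sigma>1 l1 f2)"
proof (rule ext)
  fix b
  show "compose (carrier B) (Tr \<sigma>1 l1 f1) (Tr \<sigma>2 l2 f2) b =
    Tr (\<sigma>1 \<circ> \<sigma>2) (\<lambda>j. l2 j * l1 (\<sigma>2 j)) (lconst (mu l2) * f1 + lconst (mu l1) * lsub \<sigma>1 l1 f2) b"
  proof (cases "b \<in> carrier B")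
    case True
    then show ?thesis
      using p1 p2 params_comp[OF p1 p2]
      by (subst psi_eq_iff) (simp_all add: compose_def E_comp[OF p1 p2])
  qed (simp add: compose_def Tr_def lift_def)
qed

lemma Tr_id: "Tr id (\<lambda>_. 1) 0 = (\<lambda>b\<in>carrier B. b)"
  by (auto simp: Tr_def lift_def fun_eq_iff E_id)

lemma Tr_inj:
  assumes p: "params \<sigma> l f" and p': "params \<sigma>' l' f'" and eq: "Tr \<sigma> l f = Tr \<sigma>' l' f'"
  shows "\<sigma> = \<sigma>' \<and> l = l' \<and> f = f'"
proof -
  have E: "E \<sigma> l f q = E \<sigma>' l' f' q" if "q \<in> img" for q
  proof -
    have "psi (Tr \<sigma> l f (unpsi q)) = psi (Tr \<sigma>' l' f' (unpsi q))" by (simp add: eq)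
    with that p p' show ?thesis by simp
  qed
  have f: "f = f'"
    using E[OF img_z] by (simp add: E_hom(6)[OF paramsD(3)[OF p]] E_hom(6)[OF paramsD(3)[OF p']])
  have "\<sigma> j = \<sigma>' j \<and> l j = l' j" for j
  proof (cases "j \<in> {2..m}")
    case True
    have "lconst (l j) * lvar (\<sigma> j) = lconst (l' j) * lvar (\<sigma>' j)"
      using E[OF img_lvar[OF True]] paramsD(3)[OF p] paramsD(3)[OF p'] by simp
    then have eq: "single (single (\<sigma> j) (1::int)) (l j) = single (single (\<sigma>' j) 1) (l' j)"
      by (simp add: lvar_def lconst_mult_single)
    then have "lookup (single (single (\<sigma>' j) (1::int)) (l' j)) (single (\<sigma> j) 1) \<noteq> 0"
      using paramsD(3)[OF p] by (metis lookup_single_eq)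
    then have e: "single (\<sigma>' j) (1::int) = single (\<sigma> j) 1" by (simp add: lookup_single when_def split: if_splits)
    then have "lookup (single (\<sigma>' j) (1::int)) (\<sigma> j) = 1" by simp
    then have "\<sigma> j = \<sigma>' j" by (simp add: lookup_single when_def split: if_splits)
    moreover have "l j = l' j" using eq e by (metis lookup_single_eq)
    ultimately show ?thesis by simp
  next
    case False
    then show ?thesis
      using permutes_not_in[OF paramsD(1)[OF p] False] permutes_not_in[OF paramsD(1)[OF p'] False]
        paramsD(4)[OF p False] paramsD(4)[OF p' False] by simp
  qed
  with f show ?thesis by auto
qed

lemma Tr_inverse:
  assumes p: "params \<sigma> l f"
  obtains \<sigma>' l' f' where "params \<sigma>' l' f'"
    "\<And>b. b \<in> carrier B \<Longrightarrow> Tr \<sigma>' l' f' (Tr \<sigma> l f b) = b" "\<And>b. b \<in> carrier B \<Longrightarrow> Tr \<sigma> l f (Tr \<sigma>' l' f' b) = b"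
proof -
  obtain \<sigma>' l' f' where 1: "params \<sigma>' l' f'" "\<And>q. q \<in> img \<Longrightarrow> E \<sigma>' l' f' (E \<sigma> l f q) = q"
    "\<And>q. q \<in> img \<Longrightarrow> E \<sigma> l f (E \<sigma>' l' f' q) = q" by (rule E_inverse[OF p]) (rule that, assumption+)
  show thesis
  proof (rule that[OF 1(1)])
    fix b assume "b \<in> carrier B"
    then show "Tr \<sigma>' l' f' (Tr \<sigma> l f b) = b" "Tr \<sigma> l f (Tr \<sigma>' l' f' b) = b"
      using p 1 by (subst psi_eq_iff, simp_all)+
  qed
qed

lemma Tr_Bij: assumes p: "params \<sigma> l f" shows "Tr \<sigma> l f \<in> Bij (carrier B)"
proof -
  obtain \<sigma>' l' f' where 1: "params \<sigma>' l' f'"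
    "\<And>b. b \<in> carrier B \<Longrightarrow> Tr \<sigma>' l' f' (Tr \<sigma> l f b) = b" "\<And>b. b \<in> carrier B \<Longrightarrow> Tr \<sigma> l f (Tr \<sigma>' l' f' b) = b"
    by (rule Tr_inverse[OF p]) (rule that, assumption+)
  have "bij_betw (Tr \<sigma> l f) (carrier B) (carrier B)"
    by (rule bij_betw_byWitness[where f' = "Tr \<sigma>' l' f'"]) (use p 1 in auto)
  then show ?thesis by (auto simp: Bij_def Tr_def lift_def)
qed

lemma Tr_alg: assumes p: "params \<sigma> l f" shows "Tr \<sigma> l f \<in> alg_automorphisms m k P"
  unfolding alg_automorphisms_def
proof (intro CollectI conjI allI)
  note l = paramsD(3)[OF p]
  show "Tr \<sigma> l f \<in> ring_hom B B"
  proof (rule ring_hom_memI)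
    show "Tr \<sigma> l f \<one>\<^bsub>B\<^esub> = \<one>\<^bsub>B\<^esub>" using p l by (subst psi_eq_iff) simp_all
    show "Tr \<sigma> l f (x \<otimes>\<^bsub>B\<^esub> y) = Tr \<sigma> l f x \<otimes>\<^bsub>B\<^esub> Tr \<sigma> l f y"
      "Tr \<sigma> l f (x \<oplus>\<^bsub>B\<^esub> y) = Tr \<sigma> l f x \<oplus>\<^bsub>B\<^esub> Tr \<sigma> l f y" if "x \<in> carrier B" "y \<in> carrier B" for x y
      using p l that by (subst psi_eq_iff, simp_all)+
  qed (use p in auto)
  show "Tr \<sigma> l f (cls (mconst c)) = cls (mconst c)" for c
    using p l by (subst psi_eq_iff) simp_all
qed (rule Tr_Bij[OF p])

lemma Tr_A: assumes p: "params \<sigma> l f" shows "Tr \<sigma> l f \<in> carrier A"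
  unfolding Aut_D_def using Tr_alg[OF p]
proof (simp, intro ballI)
  fix b assume "b \<in> carrier B"
  then show "Tr \<sigma> l f (D b) = D (Tr \<sigma> l f b)"
    using p by (subst psi_eq_iff) (simp_all add: E_Delta[OF p])
qed

lemma equivariant_conj:
  assumes c: "\<And>b. b \<in> carrier B \<Longrightarrow> \<phi> b \<in> carrier B" and h: "\<phi> \<in> ring_hom B B"
    and k: "\<And>c. \<phi> (cls (mconst c)) = cls (mconst c)" and D: "\<And>b. b \<in> carrier B \<Longrightarrow> \<phi> (D b) = D (\<phi> b)"
  shows "equivariant (\<lambda>q. psi (\<phi> (unpsi q)))"
  unfolding equivariant_def
proof (intro conjI ballI allI)
  fix q assume q: "q \<in> img"
  show "psi (\<phi> (unpsi q)) \<in> img" using q c by simp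
  have "unpsi (Delta q) = D (unpsi q)" using q by (subst psi_eq_iff) simp_all
  then show "psi (\<phi> (unpsi (Delta q))) = Delta (psi (\<phi> (unpsi q)))" using q c D by simp
  fix p assume p: "p \<in> img"
  have "unpsi (p + q) = unpsi p \<oplus>\<^bsub>B\<^esub> unpsi q" using q p by (subst psi_eq_iff) (simp_all add: img_add)
  then show "psi (\<phi> (unpsi (p + q))) = psi (\<phi> (unpsi p)) + psi (\<phi> (unpsi q))"
    using q p c ring_hom_add[OF h] by simp
  have "unpsi (p * q) = unpsi p \<otimes>\<^bsub>B\<^esub> unpsi q" using q p by (subst psi_eq_iff) (simp_all add: img_mult)
  then show "psi (\<phi> (unpsi (p * q))) = psi (\<phi> (unpsi p)) * psi (\<phi> (unpsi q))"
    using q p c ring_hom_mult[OF h] by simp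
next
  fix a
  have "unpsi [:lconst a:] = cls (mconst a)" by (subst psi_eq_iff) (simp_all add: img_const)
  then show "psi (\<phi> (unpsi [:lconst a:])) = [:lconst a:]" by (simp add: k)
qed

text \<open>The classification asks for an equivariant inverse. Every law for the inverse of
  \<open>\<phi>\<close> follows from the law for \<open>\<phi>\<close> by injectivity, so both can
  be transported to the image.\<close>

lemma A_cases:
  assumes "\<phi> \<in> carrier A"
  obtains \<sigma> l f where "params \<sigma> l f" "\<phi> = Tr \<sigma> l f"
proof -
  have \<phi>: "\<phi> \<in> Bij (carrier B)" "\<phi> \<in> ring_hom B B" "\<And>c. \<phi> (cls (mconst c)) = cls (mconst c)"
    "\<And>b. b \<in> carrier B \<Longrightarrow> \<phi> (D b) = D (\<phi> b)"
    using assms by (auto simp: Aut_D_def alg_automorphisms_def)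
  have bij: "bij_betw \<phi> (carrier B) (carrier B)" and ext: "\<phi> \<in> extensional (carrier B)"
    using \<phi>(1) by (auto simp: Bij_def)
  define \<theta> where "\<theta> = inv_into (carrier B) \<phi>"
  have \<phi>B: "b \<in> carrier B \<Longrightarrow> \<phi> b \<in> carrier B" for b using bij by (rule bij_betw_apply)
  have \<theta>B: "b \<in> carrier B \<Longrightarrow> \<theta> b \<in> carrier B" for b
    unfolding \<theta>_def using bij_betw_inv_into[OF bij] by (rule bij_betw_apply)
  have \<phi>\<theta>: "b \<in> carrier B \<Longrightarrow> \<phi> (\<theta> b) = b" for b unfolding \<theta>_def by (rule bij_betw_inv_into_right[OF bij])
  have \<theta>\<phi>: "b \<in> carrier B \<Longrightarrow> \<theta> (\<phi> b) = b" for b unfolding \<theta>_def by (rule bij_betw_inv_into_left[OF bij])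
  have inj: "x = y" if "\<phi> x = \<phi> y" "x \<in> carrier B" "y \<in> carrier B" for x y
    using bij that by (auto simp: bij_betw_def dest: inj_onD)
  have \<theta>h: "\<theta> \<in> ring_hom B B"
  proof (rule ring_hom_memI)
    show "\<theta> \<one>\<^bsub>B\<^esub> = \<one>\<^bsub>B\<^esub>" by (rule inj) (use \<theta>B \<phi>\<theta> ring_hom_one[OF \<phi>(2)] in auto)
    fix x y assume xy: "x \<in> carrier B" "y \<in> carrier B"
    show "\<theta> (x \<otimes>\<^bsub>B\<^esub> y) = \<theta> x \<otimes>\<^bsub>B\<^esub> \<theta> y"
      by (rule inj) (simp_all add: xy \<theta>B \<phi>\<theta> ring_hom_mult[OF \<phi>(2)])
    show "\<theta> (x \<oplus>\<^bsub>B\<^esub> y) = \<theta> x \<oplus>\<^bsub>B\<^esub> \<theta> y"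
      by (rule inj) (simp_all add: xy \<theta>B \<phi>\<theta> ring_hom_add[OF \<phi>(2)])
  qed (rule \<theta>B)
  have F: "equivariant (\<lambda>q. psi (\<phi> (unpsi q)))" by (rule equivariant_conj[OF \<phi>B \<phi>(2-4)])
  have F': "equivariant (\<lambda>q. psi (\<theta> (unpsi q)))"
  proof (rule equivariant_conj[OF \<theta>B \<theta>h])
    show "\<theta> (cls (mconst c)) = cls (mconst c)" for c by (rule inj) (use \<theta>B \<phi>\<theta> \<phi>(3) in auto)
    show "\<theta> (D b) = D (\<theta> b)" if "b \<in> carrier B" for b by (rule inj) (use that \<theta>B \<phi>\<theta> \<phi>(4) in auto)
  qed
  obtain \<sigma> l f where p: "params \<sigma> l f" and e: "\<forall>q\<in>img. psi (\<phi> (unpsi q)) = E \<sigma> l f q"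
    using equivariant_is_E[OF F F'] \<phi>B \<theta>B by (auto simp: \<phi>\<theta> \<theta>\<phi>)
  have "\<phi> = Tr \<sigma> l f"
  proof (rule extensionalityI[OF ext])
    show "Tr \<sigma> l f \<in> extensional (carrier B)" by (simp add: Tr_def lift_def)
    fix b assume b: "b \<in> carrier B"
    then have "psi (\<phi> b) = E \<sigma> l f (psi b)" using e psi_img[OF b] by fastforce
    with b p \<phi>B show "\<phi> b = Tr \<sigma> l f b" by (subst psi_eq_iff) simp_all
  qed
  with p show thesis by (rule that)
qed

lemma Tr_mult:
  assumes "params \<sigma>1 l1 f1" "params \<sigma>2 l2 f2"
  shows "Tr \<sigma>1 l1 f1 \<otimes>\<^bsub>A\<^esub> Tr \<sigma>2 l2 f2 =
    Tr (\<sigma>1 \<circ> \<sigma>2) (\<lambda>j. l2 j * l1 (\<sigma>2 j)) (lconst (mu l2) * f1 + lconst (mu l1) * lsub \<sigma>1 l1 f2)"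
  using Tr_compose[OF assms] assms by (simp add: Aut_D_def BijGroup_def Tr_Bij)

lemma A_one: "\<one>\<^bsub>A\<^esub> = Tr id (\<lambda>_. 1) 0"
  by (simp add: Tr_id Aut_D_def BijGroup_def)

lemma group_A: "group A"
proof (rule groupI)
  fix x y z assume x: "x \<in> carrier A"
  obtain \<sigma> l f where p: "params \<sigma> l f" "x = Tr \<sigma> l f" by (rule A_cases[OF x])
  show "\<one>\<^bsub>A\<^esub> \<otimes>\<^bsub>A\<^esub> x = x"
  proof -
    have "\<one>\<^bsub>BijGroup (carrier B)\<^esub> \<otimes>\<^bsub>BijGroup (carrier B)\<^esub> x = x"
      by (rule monoid.l_one[OF group.is_monoid[OF group_BijGroup]]) (simp add: BijGroup_def p Tr_Bij)
    then show ?thesis by (simp add: Aut_D_def)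
  qed
  obtain \<sigma>' l' f' where p': "params \<sigma>' l' f'" "\<And>b. b \<in> carrier B \<Longrightarrow> Tr \<sigma>' l' f' (Tr \<sigma> l f b) = b"
    by (rule Tr_inverse[OF p(1)]) (rule that, assumption+)
  have "(\<lambda>b\<in>carrier B. Tr \<sigma>' l' f' (Tr \<sigma> l f b)) = (\<lambda>b\<in>carrier B. b)"
    by (rule restrict_ext) (rule p'(2))
  then have "Tr \<sigma>' l' f' \<otimes>\<^bsub>A\<^esub> x = \<one>\<^bsub>A\<^esub>"
    using p p' by (auto simp: Aut_D_def BijGroup_def Tr_Bij compose_def)
  then show "\<exists>y\<in>carrier A. y \<otimes>\<^bsub>A\<^esub> x = \<one>\<^bsub>A\<^esub>" using Tr_A[OF p'(1)] by blast
  assume y: "y \<in> carrier A"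
  obtain \<sigma>2 l2 f2 where p2: "params \<sigma>2 l2 f2" "y = Tr \<sigma>2 l2 f2" by (rule A_cases[OF y])
  show "x \<otimes>\<^bsub>A\<^esub> y \<in> carrier A" unfolding p(2) p2(2) Tr_mult[OF p(1) p2(1)] by (rule Tr_A[OF params_comp[OF p(1) p2(1)]])
  assume z: "z \<in> carrier A"
  obtain \<sigma>3 l3 f3 where p3: "params \<sigma>3 l3 f3" "z = Tr \<sigma>3 l3 f3" by (rule A_cases[OF z])
  have "(x \<otimes>\<^bsub>BijGroup (carrier B)\<^esub> y) \<otimes>\<^bsub>BijGroup (carrier B)\<^esub> z = x \<otimes>\<^bsub>BijGroup (carrier B)\<^esub> (y \<otimes>\<^bsub>BijGroup (carrier B)\<^esub> z)"
    by (rule monoid.m_assoc[OF group.is_monoid[OF group_BijGroup]]) (simp_all add: BijGroup_def p p2 p3 Tr_Bij)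
  then show "x \<otimes>\<^bsub>A\<^esub> y \<otimes>\<^bsub>A\<^esub> z = x \<otimes>\<^bsub>A\<^esub> (y \<otimes>\<^bsub>A\<^esub> z)" by (simp add: Aut_D_def)
qed (simp add: A_one Tr_A params_id)

section \<open>Permutations, diagonal substitutions and shears as subgroups\<close>

abbreviation "Perm \<sigma> \<equiv> Tr \<sigma> (\<lambda>_. 1) 0"
abbreviation "Diag l \<equiv> Tr id l 0"
abbreviation "Shear c \<equiv> Tr id (\<lambda>_. 1) c"

definition perms where "perms = {Perm \<sigma> | \<sigma>. params \<sigma> (\<lambda>_. 1) 0}"
definition diags where "diags = {Diag l | l. params id l 0}"
definition shears where "shears = {Shear c | c. c \<in> lpos m}"

lemma mu_1 [simp]: "mu (\<lambda>_. 1) = 1"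
  by (simp add: mu_def)

lemma params_S: "params \<sigma> (\<lambda>_. 1) 0 \<longleftrightarrow> \<sigma> permutes {2..m} \<and> (\<forall>j\<in>{2..m}. k (\<sigma> j) = k j)"
  by (simp add: params_def)

lemma params_V: "params id l 0 \<longleftrightarrow> (\<forall>j. l j \<noteq> 0) \<and> (\<forall>j. j \<notin> {2..m} \<longrightarrow> l j = 1) \<and> scaling (mu l)"
  by (auto simp add: params_def permutes_id)

lemma params_U: "params id (\<lambda>_. 1) c \<longleftrightarrow> c \<in> lpos m"
  by (simp add: params_def permutes_id)

lemma lsub_id: "c \<in> lpos m \<Longrightarrow> lsub id (\<lambda>_. 1) c = c"
  by (induction c rule: lpos_induct) simp_all

lemma subgroup_AI:
  assumes "H \<subseteq> carrier A" "\<one>\<^bsub>A\<^esub> \<in> H" "\<And>x y. x \<in> H \<Longrightarrow> y \<in> H \<Longrightarrow> x \<otimes>\<^bsub>A\<^esub> y \<in> H"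
    and inv: "\<And>x. x \<in> H \<Longrightarrow> \<exists>y\<in>H. y \<otimes>\<^bsub>A\<^esub> x = \<one>\<^bsub>A\<^esub>"
  shows "subgroup H A"
proof (rule subgroup.intro)
  fix x assume x: "x \<in> H"
  then obtain y where y: "y \<in> H" "y \<otimes>\<^bsub>A\<^esub> x = \<one>\<^bsub>A\<^esub>" using inv by blast
  then have "inv\<^bsub>A\<^esub> x = y" using x assms(1) by (intro group.inv_equality[OF group_A]) auto
  with y show "inv\<^bsub>A\<^esub> x \<in> H" by simp
qed (use assms in auto)

lemma subgroup_perms: "subgroup perms A"
proof (rule subgroup_AI)
  show "perms \<subseteq> carrier A" by (auto simp: perms_def intro: Tr_A)
  show "\<one>\<^bsub>A\<^esub> \<in> perms" using params_id by (auto simp: A_one perms_def)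
  have mult: "Perm \<sigma> \<otimes>\<^bsub>A\<^esub> Perm \<tau> = Perm (\<sigma> \<circ> \<tau>)"
    if "params \<sigma> (\<lambda>_. 1) 0" "params \<tau> (\<lambda>_. 1) 0" for \<sigma> \<tau>
    using Tr_mult[OF that] by simp
  show "x \<otimes>\<^bsub>A\<^esub> y \<in> perms" if "x \<in> perms" "y \<in> perms" for x y
    using that params_comp mult unfolding perms_def by (auto dest: params_comp) (use params_comp in fastforce)
  fix x assume "x \<in> perms"
  then obtain \<sigma> where s: "params \<sigma> (\<lambda>_. 1) 0" "x = Perm \<sigma>" by (auto simp: perms_def)
  define \<tau> where "\<tau> = inv_into UNIV \<sigma>"
  have perm: "\<sigma> permutes {2..m}" by (rule paramsD(1)[OF s(1)])
  have \<tau>: "\<tau> permutes {2..m}" unfolding \<tau>_def by (rule permutes_inv[OF perm])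
  have "k (\<tau> j) = k j" if "j \<in> {2..m}" for j
    using paramsD(2)[OF s(1), of "\<tau> j"] permutes_in_image[OF \<tau>, of j] that permutes_inverses[OF perm] by (simp add: \<tau>_def)
  then have p: "params \<tau> (\<lambda>_. 1) 0" using \<tau> by (simp add: params_S)
  have "\<tau> \<circ> \<sigma> = id" using permutes_inv_o[OF perm] by (simp add: \<tau>_def)
  then show "\<exists>y\<in>perms. y \<otimes>\<^bsub>A\<^esub> x = \<one>\<^bsub>A\<^esub>"
    using p s mult by (intro bexI[of _ "Perm \<tau>"]) (auto simp: perms_def A_one)
qed

lemma diag_mult:
  assumes "params id l 0" "params id l' 0"
  shows "Diag l \<otimes>\<^bsub>A\<^esub> Diag l' = Diag (\<lambda>j. l j * l' j)" "params id (\<lambda>j. l j * l' j) 0"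
  using Tr_mult[OF assms] params_comp[OF assms] paramsD(3)[OF assms(1)] by (simp_all add: mult.commute)

lemma subgroup_diags: "subgroup diags A"
proof (rule subgroup_AI)
  show "diags \<subseteq> carrier A" by (auto simp: diags_def intro: Tr_A)
  show "\<one>\<^bsub>A\<^esub> \<in> diags" using params_id by (auto simp: A_one diags_def)
  show "x \<otimes>\<^bsub>A\<^esub> y \<in> diags" if "x \<in> diags" "y \<in> diags" for x y
    using that diag_mult unfolding diags_def by blast
  fix x assume "x \<in> diags"
  then obtain l where l: "params id l 0" "x = Diag l" by (auto simp: diags_def)
  have "mu (\<lambda>j. 1 / l j) = 1 / mu l" by (simp add: mu_def power_divide prod_dividef)
  then have "params id (\<lambda>j. 1 / l j) 0" using l(1) scaling_inverse by (simp add: params_V)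
  then show "\<exists>y\<in>diags. y \<otimes>\<^bsub>A\<^esub> x = \<one>\<^bsub>A\<^esub>"
    using l diag_mult(1)[of "\<lambda>j. 1 / l j" l] paramsD(3)[OF l(1)]
    by (intro bexI[of _ "Diag (\<lambda>j. 1 / l j)"]) (auto simp: diags_def A_one)
qed

lemma shear_mult:
  assumes "c \<in> lpos m" "c' \<in> lpos m"
  shows "Shear c \<otimes>\<^bsub>A\<^esub> Shear c' = Shear (c + c')"
  using Tr_mult[of id "\<lambda>_. 1" c id "\<lambda>_. 1" c'] assms by (simp add: params_U lsub_id)

lemma subgroup_shears: "subgroup shears A"
proof (rule subgroup_AI)
  show "shears \<subseteq> carrier A" by (auto simp: shears_def params_U intro: Tr_A)
  show "\<one>\<^bsub>A\<^esub> \<in> shears" by (auto simp: A_one shears_def)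
  show "x \<otimes>\<^bsub>A\<^esub> y \<in> shears" if "x \<in> shears" "y \<in> shears" for x y
    using that shear_mult lpos_add unfolding shears_def by blast
  fix x assume "x \<in> shears"
  then obtain c where c: "c \<in> lpos m" "x = Shear c" by (auto simp: shears_def)
  then show "\<exists>y\<in>shears. y \<otimes>\<^bsub>A\<^esub> x = \<one>\<^bsub>A\<^esub>"
    using shear_mult[OF lpos_minus[OF c(1)] c(1)] lpos_minus[OF c(1)]
    by (intro bexI[of _ "Shear (- c)"]) (auto simp: shears_def A_one)
qed

text \<open>An automorphism \<open>g\<close> commuting with the derivation \<open>D\<close>
  conjugates \<open>Exp(c D)\<close> into \<open>Exp(g(c) D)\<close>. In parameters this is the
  identity \<open>g (Shear c) = (Shear (lsub \<sigma> l c)) g\<close>.\<close>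

lemma normal_shears:
  assumes "g \<in> carrier A" "u \<in> shears"
  shows "g \<otimes>\<^bsub>A\<^esub> u \<otimes>\<^bsub>A\<^esub> inv\<^bsub>A\<^esub> g \<in> shears"
proof -
  interpret A: group A by (rule group_A)
  obtain \<sigma> l f where g: "params \<sigma> l f" "g = Tr \<sigma> l f" by (rule A_cases[OF assms(1)])
  obtain c where c: "c \<in> lpos m" "u = Shear c" using assms(2) by (auto simp: shears_def)
  let ?c = "lsub \<sigma> l c"
  have c': "?c \<in> lpos m"
    using permutes_image[OF paramsD(1)[OF g(1)]] by (intro lsub_lpos paramsD(3)[OF g(1)] c(1)) simp
  have "g \<otimes>\<^bsub>A\<^esub> u = Tr \<sigma> l (f + lconst (mu l) * ?c)"
    using Tr_mult[of \<sigma> l f id "\<lambda>_. 1" c] g c by (simp add: params_U)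
  moreover have "Shear ?c \<otimes>\<^bsub>A\<^esub> g = Tr \<sigma> l (lconst (mu l) * ?c + f)"
    using Tr_mult[of id "\<lambda>_. 1" ?c \<sigma> l f] g c' paramsD(6)[OF g(1)] by (simp add: params_U lsub_id)
  ultimately have eq: "g \<otimes>\<^bsub>A\<^esub> u = Shear ?c \<otimes>\<^bsub>A\<^esub> g" by (simp add: add.commute)
  have "Shear ?c \<in> carrier A" using c' by (simp add: params_U Tr_A)
  then have "g \<otimes>\<^bsub>A\<^esub> u \<otimes>\<^bsub>A\<^esub> inv\<^bsub>A\<^esub> g = Shear ?c"
    unfolding eq using assms(1) by (simp add: A.m_assoc)
  with c' show ?thesis by (auto simp: shears_def)
qed

lemma diag_perm_mult:
  assumes "params id l 0" "params \<sigma> (\<lambda>_. 1) 0"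
  shows "Diag l \<otimes>\<^bsub>A\<^esub> Perm \<sigma> = Tr \<sigma> (\<lambda>j. l (\<sigma> j)) 0" "params \<sigma> (\<lambda>j. l (\<sigma> j)) 0"
    "mu (\<lambda>j. l (\<sigma> j)) = mu l"
  using Tr_mult[OF assms] params_comp[OF assms] paramsD(3)[OF assms(1)]
    mu_comp[OF paramsD(1,2)[OF assms(2)], of "\<lambda>_. 1" l] by simp_all

text \<open>The product \<open>Diag l' Perm \<sigma>\<close> sends \<open>y_j\<close> to
  \<open>l' (\<sigma> j) y_(\<sigma> j)\<close>; hence \<open>l'\<close> has to be \<open>l\<close>
  composed with the inverse of \<open>\<sigma>\<close>.\<close>

lemma diag_perm_decomposition:
  assumes p: "params \<sigma> l f"
  shows "\<exists>l'. params id l' 0 \<and> params \<sigma> (\<lambda>_. 1) 0 \<and> l = (\<lambda>j. l' (\<sigma> j)) \<and> mu l' = mu l"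
proof -
  define l' where "l' i = l (inv_into UNIV \<sigma> i)" for i
  have perm: "\<sigma> permutes {2..m}" by (rule paramsD(1)[OF p])
  have iperm: "inv_into UNIV \<sigma> permutes {2..m}" by (rule permutes_inv[OF perm])
  have eq: "l = (\<lambda>j. l' (\<sigma> j))" using permutes_inverses[OF perm] by (simp add: l'_def)
  have mu: "mu l' = mu l" using mu_comp[OF paramsD(1,2)[OF p], of "\<lambda>_. 1" l'] by (simp add: eq)
  have "l' j = 1" if "j \<notin> {2..m}" for j
    using permutes_not_in[OF iperm that] paramsD(4)[OF p that] by (simp add: l'_def)
  then have "params id l' 0"
    using paramsD(3,5)[OF p] by (simp add: params_V mu) (simp add: l'_def)
  moreover have "params \<sigma> (\<lambda>_. 1) 0" using p by (simp add: params_S params_def)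
  ultimately show ?thesis using eq mu by blast
qed

lemma perm_conj_diag:
  assumes "s \<in> perms" "v \<in> diags"
  shows "s \<otimes>\<^bsub>A\<^esub> v \<otimes>\<^bsub>A\<^esub> inv\<^bsub>A\<^esub> s \<in> diags"
proof -
  interpret A: group A by (rule group_A)
  obtain \<sigma> where s: "params \<sigma> (\<lambda>_. 1) 0" "s = Perm \<sigma>" using assms by (auto simp: perms_def)
  obtain l where l: "params id l 0" "v = Diag l" using assms by (auto simp: diags_def)
  have p: "params \<sigma> l 0" using params_comp[OF s(1) l(1)] by simp
  obtain l' where l': "params id l' 0" "l = (\<lambda>j. l' (\<sigma> j))" using diag_perm_decomposition[OF p] by blast
  have "s \<otimes>\<^bsub>A\<^esub> v = Tr \<sigma> l 0" unfolding s(2) l(2) using Tr_mult[OF s(1) l(1)] by simp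
  also have "Tr \<sigma> l 0 = Diag l' \<otimes>\<^bsub>A\<^esub> s"
    using diag_perm_mult(1)[OF l'(1) s(1)] by (simp only: s(2) l'(2)[symmetric])
  finally have eq: "s \<otimes>\<^bsub>A\<^esub> v = Diag l' \<otimes>\<^bsub>A\<^esub> s" .
  have "s \<otimes>\<^bsub>A\<^esub> v \<otimes>\<^bsub>A\<^esub> inv\<^bsub>A\<^esub> s = Diag l'"
    unfolding eq using Tr_A[OF s(1)] Tr_A[OF l'(1)] by (simp add: s(2) A.m_assoc)
  with l' show ?thesis by (auto simp: diags_def)
qed

lemma shear_diag_perm_mult:
  assumes "c \<in> lpos m" "params id l 0" "params \<sigma> (\<lambda>_. 1) 0"
  shows "Shear c \<otimes>\<^bsub>A\<^esub> Diag l \<otimes>\<^bsub>A\<^esub> Perm \<sigma> = Tr \<sigma> (\<lambda>j. l (\<sigma> j)) (lconst (mu l) * c)"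
    "params \<sigma> (\<lambda>j. l (\<sigma> j)) (lconst (mu l) * c)"
proof -
  interpret A: group A by (rule group_A)
  have c: "params id (\<lambda>_. 1) c" using assms(1) by (simp add: params_U)
  note p = diag_perm_mult[OF assms(2,3)]
  have "Shear c \<otimes>\<^bsub>A\<^esub> Diag l \<otimes>\<^bsub>A\<^esub> Perm \<sigma> = Shear c \<otimes>\<^bsub>A\<^esub> Tr \<sigma> (\<lambda>j. l (\<sigma> j)) 0"
    using Tr_A[OF c] Tr_A[OF assms(2)] Tr_A[OF assms(3)] p(1) by (simp add: A.m_assoc)
  also have "\<dots> = Tr \<sigma> (\<lambda>j. l (\<sigma> j)) (lconst (mu l) * c)"
    using Tr_mult[OF c p(2)] p(3) by simp
  finally show "Shear c \<otimes>\<^bsub>A\<^esub> Diag l \<otimes>\<^bsub>A\<^esub> Perm \<sigma> = Tr \<sigma> (\<lambda>j. l (\<sigma> j)) (lconst (mu l) * c)" .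
  show "params \<sigma> (\<lambda>j. l (\<sigma> j)) (lconst (mu l) * c)"
    using params_comp[OF c p(2)] p(3) by simp
qed

lemma gen_A:
  assumes "g \<in> carrier A"
  shows "\<exists>u\<in>shears. \<exists>v\<in>diags. \<exists>s\<in>perms. g = u \<otimes>\<^bsub>A\<^esub> v \<otimes>\<^bsub>A\<^esub> s"
proof -
  obtain \<sigma> l f where g: "params \<sigma> l f" "g = Tr \<sigma> l f" by (rule A_cases[OF assms])
  obtain l' where l': "params id l' 0" "params \<sigma> (\<lambda>_. 1) 0" "l = (\<lambda>j. l' (\<sigma> j))" "mu l' = mu l"
    using diag_perm_decomposition[OF g(1)] by blast
  \<comment> \<open>The diagonal factor multiplies the shear parameter by
    \<open>mu l' = mu l\<close>; dividing beforehand compensates.\<close>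
  let ?c = "lconst (1 / mu l) * f"
  have c: "?c \<in> lpos m" using paramsD(6)[OF g(1)] by (intro lpos_mult lpos_const)
  have "lconst (mu l) * ?c = lconst (mu l * (1 / mu l)) * f" by (simp only: lconst_hom(4) mult.assoc)
  then have "lconst (mu l) * ?c = f" using paramsD(7)[OF g(1)] by simp
  then have "g = Shear ?c \<otimes>\<^bsub>A\<^esub> Diag l' \<otimes>\<^bsub>A\<^esub> Perm \<sigma>"
    unfolding g(2) using shear_diag_perm_mult(1)[OF c l'(1,2)] by (simp only: l'(3)[symmetric] l'(4))
  then show ?thesis using c l' unfolding shears_def diags_def perms_def by blast
qed

lemma unique_A:
  assumes "u \<in> shears" "v \<in> diags" "s \<in> perms" "u' \<in> shears" "v' \<in> diags" "s' \<in> perms"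
    and eq: "u \<otimes>\<^bsub>A\<^esub> v \<otimes>\<^bsub>A\<^esub> s = u' \<otimes>\<^bsub>A\<^esub> v' \<otimes>\<^bsub>A\<^esub> s'"
  shows "u = u' \<and> v = v' \<and> s = s'"
proof -
  obtain c l \<sigma> where 1: "c \<in> lpos m" "params id l 0" "params \<sigma> (\<lambda>_. 1) 0"
    "u = Shear c" "v = Diag l" "s = Perm \<sigma>"
    using assms(1-3) by (auto simp: shears_def diags_def perms_def)
  obtain c' l' \<sigma>' where 2: "c' \<in> lpos m" "params id l' 0" "params \<sigma>' (\<lambda>_. 1) 0"
    "u' = Shear c'" "v' = Diag l'" "s' = Perm \<sigma>'"
    using assms(4-6) by (auto simp: shears_def diags_def perms_def)
  have e: "\<sigma> = \<sigma>' \<and> (\<lambda>j. l (\<sigma> j)) = (\<lambda>j. l' (\<sigma>' j)) \<and> lconst (mu l) * c = lconst (mu l') * c'"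
    using eq unfolding 1(4-6) 2(4-6) shear_diag_perm_mult(1)[OF 1(1-3)] shear_diag_perm_mult(1)[OF 2(1-3)]
    by (rule Tr_inj[OF shear_diag_perm_mult(2)[OF 1(1-3)] shear_diag_perm_mult(2)[OF 2(1-3)]])
  have l: "l = l'"
  proof
    fix j
    have "l (\<sigma> (inv_into UNIV \<sigma> j)) = l' (\<sigma> (inv_into UNIV \<sigma> j))" using e by metis
    then show "l j = l' j" using permutes_inverses[OF paramsD(1)[OF 1(3)]] by simp
  qed
  then have "lconst (mu l) * c = lconst (mu l) * c'" using e by simp
  then have "c = c'" using paramsD(7)[OF 1(2)] by simp
  with e l show ?thesis by (simp add: 1 2)
qed


subsection \<open>The symmetric group\<close>

lemma alg_automorphism_eqI:
  assumes "\<phi> \<in> alg_automorphisms m k P" "\<theta> \<in> alg_automorphisms m k P"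
    and gens: "\<And>j. j \<in> {0..m} \<Longrightarrow> \<phi> (cls (mvar j)) = \<theta> (cls (mvar j))"
  shows "\<phi> = \<theta>"
proof -
  have \<phi>: "\<phi> \<in> Bij (carrier B)" "\<phi> \<in> ring_hom B B" "\<And>c. \<phi> (cls (mconst c)) = cls (mconst c)"
    and \<theta>: "\<theta> \<in> Bij (carrier B)" "\<theta> \<in> ring_hom B B" "\<And>c. \<theta> (cls (mconst c)) = cls (mconst c)"
    using assms(1,2) by (auto simp: alg_automorphisms_def)
  have "\<phi> (cls p) = \<theta> (cls p)" if "p \<in> MP" for p
    using that
  proof (induction p rule: mpoly_on_induct)
    case (add p q)
    then show ?case
      by (simp only: cls_add[symmetric] ring_hom_add[OF \<phi>(2)] ring_hom_add[OF \<theta>(2)] cls_in_B)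
  next
    case (mult p q)
    then show ?case
      by (simp only: cls_mult[symmetric] ring_hom_mult[OF \<phi>(2)] ring_hom_mult[OF \<theta>(2)] cls_in_B)
  qed (simp_all only: \<phi>(3) \<theta>(3) gens)
  then show ?thesis
    by (intro extensionalityI[OF Bij_imp_extensional[OF \<phi>(1)] Bij_imp_extensional[OF \<theta>(1)]])
      (auto simp: carrier_B)
qed

text \<open>The case of \<open>y_1\<close> is indirect: \<open>P(z)\<close> is fixed because
  \<open>z\<close> and the constants are, \<open>y^k\<close> is fixed because
  \<open>\<sigma>\<close> respects the exponents, and \<open>y_1\<close> is their quotient.\<close>

lemma Perm_gens:
  assumes p: "params \<sigma> (\<lambda>_. 1) 0"
  shows "Perm \<sigma> (cls Zvar) = cls Zvar" "j \<in> {1..m} \<Longrightarrow> Perm \<sigma> (cls (mvar j)) = cls (mvar (\<sigma> j))"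
proof -
  note l = paramsD(3)[OF p] and h = E_hom[OF paramsD(3)[OF p], of \<sigma> 0]
  have perm: "\<sigma> permutes {2..m}" by (rule paramsD(1)[OF p])
  have z: "gen 0 = [:- lconst r:] + [:0, 1:]" by (simp add: gen_0)
  have "lsub \<sigma> (\<lambda>_. 1) (- lconst r) = - lconst r"
    using lsub_lconst[OF l, of \<sigma> "- r"] by simp
  then have "E \<sigma> (\<lambda>_. 1) 0 (gen 0) = gen 0"
    unfolding z by (simp only: h) simp
  then show "Perm \<sigma> (cls Zvar) = cls Zvar"
    using p MP_mvar(2) by (subst psi_eq_iff) simp_all
  assume j: "j \<in> {1..m}"
  show "Perm \<sigma> (cls (mvar j)) = cls (mvar (\<sigma> j))"
  proof (cases "j = 1")
    case True
    have \<sigma>1: "\<sigma> 1 = 1" by (rule permutes_not_in[OF perm]) simp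
    have "E \<sigma> (\<lambda>_. 1) 0 ([:yk:] * Y1) = E \<sigma> (\<lambda>_. 1) 0 PL" by (simp add: yk_Y1)
    also have "\<dots> = PL" unfolding PL_def h(8) by simp
    also have "\<dots> = [:yk:] * Y1" by (simp add: yk_Y1)
    finally have "[:yk:] * E \<sigma> (\<lambda>_. 1) 0 Y1 = [:yk:] * Y1"
      using lsub_yk[OF l paramsD(1,2)[OF p]] by (simp only: h(4,5)) simp
    then have "E \<sigma> (\<lambda>_. 1) 0 Y1 = Y1" by (simp add: smult_yk_cancel)
    then show ?thesis using True \<sigma>1 p MP_mvar(1)[OF j] by (subst psi_eq_iff) simp_all
  next
    case False
    then have j2: "j \<in> {2..m}" using j by auto
    then have \<sigma>j: "\<sigma> j \<in> {2..m}" using permutes_in_image[OF perm, of j] by simp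
    have "mvar (\<sigma> j) \<in> MP" by (rule MP_mvar(1)) (use \<sigma>j in auto)
    with j2 \<sigma>j show ?thesis using p l MP_mvar(1)[OF j] by (subst psi_eq_iff) (simp_all add: gen_lvar)
  qed
qed

lemma perm_monomial_eq:
  "perm_monomial m k \<sigma> = (single (single (\<sigma> 1) 1 + (\<Sum>j\<in>{2..m}. single (\<sigma> j) (k j))) 1 :: 'a mpoly)"
  unfolding perm_monomial_def mvar_power prod_single_1 by (simp add: mvar_def mult_single)

text \<open>The exponent of \<open>Y_(\<sigma> i)\<close> is compared on both sides. The value 1
  occurs at index 1 only, since the other exponents are at least 2; so \<open>\<sigma>\<close> fixes
  1 and permutes the remaining indices among equal exponents.\<close>

lemma perm_monomial_stable:
  assumes perm: "\<sigma> permutes {1..m}" and eq: "(perm_monomial m k \<sigma> :: 'a mpoly) = perm_monomial m k id"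
  shows "\<sigma> permutes {2..m}" "j \<in> {2..m} \<Longrightarrow> k (\<sigma> j) = k j"
proof -
  let ?e = "\<lambda>\<sigma>. single (\<sigma> 1) 1 + (\<Sum>j\<in>{2..m}. single (\<sigma> j) (k j)) :: nat \<Rightarrow>\<^sub>0 nat"
  have e: "?e \<sigma> = ?e id" using eq unfolding perm_monomial_eq
    by (metis (no_types, lifting) lookup_single_eq lookup_single_not_eq zero_neq_one)
  have inj: "\<sigma> i = \<sigma> j \<longleftrightarrow> i = j" for i j using permutes_inj[OF perm] by (auto dest: injD)
  have L: "lookup (?e \<sigma>) (\<sigma> i) = (if i = 1 then 1 else if i \<in> {2..m} then k i else 0)" for i
    by (simp add: lookup_add lookup_sum lookup_single when_def inj)
  have R: "lookup (?e id) i = (if i = 1 then 1 else if i \<in> {2..m} then k i else 0)" for i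
    by (simp add: lookup_add lookup_sum lookup_single when_def)
  have LR: "(if i = 1 then 1 else if i \<in> {2..m} then k i else 0) =
      (if \<sigma> i = 1 then 1 else if \<sigma> i \<in> {2..m} then k (\<sigma> i) else 0)" for i
    using L[of i] R[of "\<sigma> i"] unfolding e by simp
  have \<sigma>1: "\<sigma> 1 = 1"
  proof (rule ccontr)
    assume ne: "\<sigma> 1 \<noteq> 1"
    then have 1: "1 = (if \<sigma> 1 \<in> {2..m} then k (\<sigma> 1) else 0)" using LR[of 1] by (simp only: if_True if_False refl)
    show False
    proof (cases "\<sigma> 1 \<in> {2..m}")
      case True
      then show False using 1 k[OF True] by (simp only: if_True)
    qed (use 1 in \<open>simp only: if_False\<close>)
  qed
  show p: "\<sigma> permutes {2..m}"
  proof (rule permutes_superset[OF perm])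
    fix x assume "x \<in> {1..m} - {2..m}"
    then have "x = 1" by auto
    with \<sigma>1 show "\<sigma> x = x" by simp
  qed
  show "k (\<sigma> j) = k j" if j: "j \<in> {2..m}"
  proof -
    have "\<sigma> j \<in> {2..m}" using permutes_in_image[OF p, of j] j by simp
    moreover from this j have "j \<noteq> 1" "\<sigma> j \<noteq> 1" by auto
    ultimately show ?thesis using LR[of j] j by (simp only: if_True if_False)
  qed
qed

text \<open>Membership in the symmetric group says nothing about the derivation; it comes for free,
  because such an automorphism agrees on the generators with some \<open>Perm \<sigma>\<close> and
  therefore equals it.\<close>

lemma sym_group_eq: "sym_group m k P = A\<lparr>carrier := perms\<rparr>"
proof -
  let ?S = "{\<phi> \<in> alg_automorphisms m k P. \<phi> (cls Zvar) = cls Zvar \<and>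
       (\<exists>\<sigma>. \<sigma> permutes {1..m} \<and> (perm_monomial m k \<sigma> :: 'a mpoly) = perm_monomial m k id \<and>
          (\<forall>j\<in>{1..m}. \<phi> (cls (mvar j)) = cls (mvar (\<sigma> j))))}"
  have "?S \<subseteq> perms"
  proof
    fix \<phi> assume "\<phi> \<in> ?S"
    then obtain \<sigma> where \<phi>: "\<phi> \<in> alg_automorphisms m k P" "\<phi> (cls Zvar) = cls Zvar" "\<sigma> permutes {1..m}"
      "(perm_monomial m k \<sigma> :: 'a mpoly) = perm_monomial m k id"
      "\<And>j. j \<in> {1..m} \<Longrightarrow> \<phi> (cls (mvar j)) = cls (mvar (\<sigma> j))" by auto
    have p: "params \<sigma> (\<lambda>_. 1) 0" using perm_monomial_stable[OF \<phi>(3,4)] by (simp add: params_S)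
    have "\<phi> = Perm \<sigma>"
    proof (rule alg_automorphism_eqI[OF \<phi>(1) Tr_alg[OF p]])
      fix j assume "j \<in> {0..m}"
      then consider "j = 0" | "j \<in> {1..m}" by fastforce
      then show "\<phi> (cls (mvar j)) = Perm \<sigma> (cls (mvar j))"
        using \<phi>(2,5) Perm_gens[OF p] by cases simp_all
    qed
    with p show "\<phi> \<in> perms" by (auto simp: perms_def)
  qed
  moreover have "perms \<subseteq> ?S"
  proof
    fix \<phi> assume "\<phi> \<in> perms"
    then obtain \<sigma> where p: "params \<sigma> (\<lambda>_. 1) 0" "\<phi> = Perm \<sigma>" by (auto simp: perms_def)
    have perm: "\<sigma> permutes {2..m}" by (rule paramsD(1)[OF p(1)])
    have \<sigma>1: "\<sigma> 1 = 1" by (rule permutes_not_in[OF perm]) simp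
    have perm1: "\<sigma> permutes {1..m}" by (rule permutes_subset[OF perm]) auto
    have "(\<Prod>j\<in>{2..m}. mvar (\<sigma> j) ^ k j) = (\<Prod>j\<in>{2..m}. mvar (\<sigma> j) ^ k (\<sigma> j) :: 'a mpoly)"
      using paramsD(2)[OF p(1)] by (intro prod.cong) auto
    also have "\<dots> = (\<Prod>j\<in>{2..m}. mvar j ^ k j)"
      by (rule prod.permute[OF perm, of "\<lambda>j. mvar j ^ k j", unfolded o_def, symmetric])
    finally have "(perm_monomial m k \<sigma> :: 'a mpoly) = perm_monomial m k id"
      using \<sigma>1 by (simp add: perm_monomial_def)
    with perm1 show "\<phi> \<in> ?S" using Perm_gens[OF p(1)] Tr_alg[OF p(1)] unfolding p(2) by blast
  qed
  ultimately have "?S = perms" by (rule equalityI)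
  then show ?thesis by (simp add: sym_group_def Aut_D_def)
qed

subsection \<open>The big unipotent group\<close>

lemma higher_pderiv_eq_0:
  fixes q :: "'b::{comm_semiring_1,semiring_no_zero_divisors,semiring_char_0} poly"
  shows "degree q < n \<Longrightarrow> (pderiv ^^ n) q = 0"
proof (induction n arbitrary: q)
  case (Suc n)
  show ?case
  proof (cases "degree q = 0")
    case True
    then have "pderiv q = 0" by (simp add: pderiv_eq_0_iff)
    moreover have "(pderiv ^^ n) 0 = (0 :: 'b poly)" by (induction n) auto
    ultimately show ?thesis by (simp add: funpow_swap1 del: funpow.simps add: funpow_Suc_right)
  next
    case False
    then have "degree (pderiv q) < n" using Suc.prems by (simp add: degree_pderiv)
    then show ?thesis using Suc.IH by (simp del: funpow.simps add: funpow_Suc_right)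
  qed
qed simp

text \<open>Leibniz' rule for \<open>a + z q\<close>, where only the first derivative of
  \<open>z\<close> survives; this is the recursion step for Taylor's formula.\<close>

lemma higher_pderiv_pCons:
  fixes q :: "'b::idom poly"
  shows "(pderiv ^^ Suc n) (pCons a q) = pCons 0 ((pderiv ^^ Suc n) q) + smult (of_nat (Suc n)) ((pderiv ^^ n) q)"
proof (induction n)
  case (Suc n)
  have "(pderiv ^^ Suc (Suc n)) (pCons a q) = pderiv ((pderiv ^^ Suc n) (pCons a q))" by simp
  also have "\<dots> = pderiv (pCons 0 ((pderiv ^^ Suc n) q)) + smult (of_nat (Suc n)) ((pderiv ^^ Suc n) q)"
    unfolding Suc.IH by (simp only: pderiv_add pderiv_smult) simp
  also have "\<dots> = pCons 0 ((pderiv ^^ Suc (Suc n)) q) + smult (of_nat (Suc (Suc n))) ((pderiv ^^ Suc n) q)"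
    by (simp only: pderiv_pCons of_nat_Suc[of "Suc n"] smult_add_left smult_1_left ac_simps) simp
  finally show ?case .
qed (simp add: pderiv_pCons)

text \<open>Horner induction: Leibniz' rule splits the sum for \<open>a + z q\<close> into
  \<open>a\<close> plus \<open>z\<close> times and \<open>t\<close> times the sum for
  \<open>q\<close>, that is \<open>a + (z + t) q(z + t)\<close>.\<close>

lemma Taylor_pcompose:
  fixes q :: "'a laurent poly"
  assumes "degree q < N"
  shows "(\<Sum>i<N. smult (lconst (1 / fact i) * t ^ i) ((pderiv ^^ i) q)) = pcompose q [:t, 1:]"
  using assms
proof (induction q arbitrary: N)
  case (pCons a q)
  show ?case
  proof (cases "q = 0")
    case True
    have "(pderiv ^^ i) [:a:] = 0" if "i > 0" for i using that by (intro higher_pderiv_eq_0) simp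
    then have "(\<Sum>i<N. smult (lconst (1 / fact i) * t ^ i) ((pderiv ^^ i) [:a:])) = (\<Sum>i<N. if i = 0 then [:a:] else 0)"
      by (intro sum.cong) auto
    also have "\<dots> = [:a:]" using pCons.prems by simp
    finally show ?thesis using True by simp
  next
    case False
    then obtain M where N: "N = Suc M" "degree q < M" using pCons.prems by (cases N) auto
    let ?c = "\<lambda>i. lconst (1 / fact i) * t ^ i :: 'a laurent"
    have c: "?c (Suc i) * of_nat (Suc i) = t * ?c i" for i
    proof -
      have "(1 / fact (Suc i)) * of_nat (Suc i) = (1 / fact i :: 'a)"
        by (simp only: fact_Suc) (simp del: of_nat_Suc add: field_simps)
      then have "lconst (1 / fact (Suc i)) * of_nat (Suc i) = lconst (1 / fact i :: 'a)"
        by (simp only: lconst_hom(4)[symmetric] lconst_of_nat[symmetric])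
      then have "t * t ^ i * (lconst (1 / fact (Suc i)) * of_nat (Suc i)) = t * t ^ i * lconst (1 / fact i)" by (simp only:)
      then show ?thesis by (simp only: power_Suc mult_ac)
    qed
    have step: "smult (?c (Suc i)) ((pderiv ^^ Suc i) (pCons a q)) =
        [:0, 1:] * smult (?c (Suc i)) ((pderiv ^^ Suc i) q) + [:t:] * smult (?c i) ((pderiv ^^ i) q)" for i
    proof -
      have "smult (?c (Suc i)) (smult (of_nat (Suc i)) ((pderiv ^^ i) q)) = [:t:] * smult (?c i) ((pderiv ^^ i) q)"
        by (simp only: smult_smult c) (simp add: mult.commute)
      then show ?thesis unfolding higher_pderiv_pCons by (simp only: smult_add_right) simp
    qed
    \<comment> \<open>The sums multiplied by \<open>z\<close> and by \<open>t\<close> have lengths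
      \<open>M + 1\<close> and \<open>M\<close>; they agree because the last term of the longer one
      vanishes.\<close>
    have top: "smult (?c M) ((pderiv ^^ M) q) = 0" using higher_pderiv_eq_0[OF N(2)] by simp
    have "(\<Sum>i<N. smult (?c i) ((pderiv ^^ i) (pCons a q))) =
        pCons a q + (\<Sum>i<M. smult (?c (Suc i)) ((pderiv ^^ Suc i) (pCons a q)))"
      unfolding N by (simp only: sum.lessThan_Suc_shift) simp
    also have "\<dots> = [:a:] + [:0, 1:] * (q + (\<Sum>i<M. smult (?c (Suc i)) ((pderiv ^^ Suc i) q))) +
        [:t:] * (\<Sum>i<M. smult (?c i) ((pderiv ^^ i) q))"
      by (simp only: step sum.distrib sum_distrib_left[symmetric] distrib_left add.assoc) simp
    also have "q + (\<Sum>i<M. smult (?c (Suc i)) ((pderiv ^^ Suc i) q)) = (\<Sum>i<Suc M. smult (?c i) ((pderiv ^^ i) q))"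
      by (simp only: sum.lessThan_Suc_shift) simp
    also have "\<dots> = (\<Sum>i<M. smult (?c i) ((pderiv ^^ i) q))"
      using top by (simp only: sum.lessThan_Suc) simp
    also have "(\<Sum>i<M. smult (?c i) ((pderiv ^^ i) q)) = pcompose q [:t, 1:]" by (rule pCons.IH[OF N(2)])
    finally show ?thesis by (simp add: pcompose_pCons algebra_simps)
  qed
qed simp

lemma E_U: "q \<in> img \<Longrightarrow> c \<in> lpos m \<Longrightarrow> E id (\<lambda>_. 1) c q = pcompose q [:yk * c, 1:]"
  by (rule E_unique[where F = "\<lambda>q. pcompose q [:yk * c, 1:]", symmetric])
    (simp_all add: pcompose_add pcompose_mult params_U pcompose_pCons)

lemma psi_finsum:
  assumes "finite S" "\<And>i. i \<in> S \<Longrightarrow> g i \<in> carrier B"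
  shows "finsum B g S \<in> carrier B \<and> psi (finsum B g S) = (\<Sum>i\<in>S. psi (g i))"
  using assms
proof (induction S)
  case empty
  interpret cring B by (rule cring_B)
  show ?case by simp
next
  case (insert i S)
  interpret cring B by (rule cring_B)
  have "finsum B g (insert i S) = g i \<oplus>\<^bsub>B\<^esub> finsum B g S"
    using insert by (intro finsum_insert) auto
  with insert show ?case by simp
qed

text \<open>Since \<open>y^k c\<close> is free of \<open>z\<close>, the \<open>i\<close>-th iterate
  of \<open>f D\<close> becomes \<open>(y^k c)^i\<close> times the \<open>i\<close>-th derivative.
  The exponential series is then the Taylor expansion of the shift
  \<open>z \<mapsto> z + y^k c\<close>; indices with a vanishing iterate may be added to the sum,
  and those beyond the degree are absent.\<close>

lemma Exp_eq_Tr: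
  assumes f: "f \<in> carrier B" "psi f = [:c:]" "c \<in> lpos m"
  shows "Exp m k P (\<lambda>b. f \<otimes>\<^bsub>B\<^esub> D b) = Shear c"
proof (rule extensionalityI[of _ "carrier B"])
  show "Exp m k P (\<lambda>b. f \<otimes>\<^bsub>B\<^esub> D b) \<in> extensional (carrier B)" by (simp add: Exp_def Let_def)
  show "Shear c \<in> extensional (carrier B)" by (simp add: Tr_def lift_def)
  fix b assume b: "b \<in> carrier B"
  let ?\<delta> = "\<lambda>b. f \<otimes>\<^bsub>B\<^esub> D b" and ?t = "yk * c"
  have it: "(?\<delta> ^^ i) b \<in> carrier B \<and> psi ((?\<delta> ^^ i) b) = smult (?t ^ i) ((pderiv ^^ i) (psi b))" for i
  proof (induction i)
    case (Suc i)
    then show ?case using f by (simp add: Delta_def pderiv_smult mult_ac)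
  qed (simp add: b)
  let ?N = "Suc (degree (psi b))" and ?I = "{i. (?\<delta> ^^ i) b \<noteq> \<zero>\<^bsub>B\<^esub>}"
  have sub: "?I \<subseteq> {..<?N}"
  proof (rule subsetI)
    fix i assume "i \<in> ?I"
    then have ne: "(?\<delta> ^^ i) b \<noteq> \<zero>\<^bsub>B\<^esub>" by simp
    show "i \<in> {..<?N}"
    proof (rule ccontr)
      assume "i \<notin> {..<?N}"
      then have "(pderiv ^^ i) (psi b) = 0" by (intro higher_pderiv_eq_0) simp
      then have "psi ((?\<delta> ^^ i) b) = psi \<zero>\<^bsub>B\<^esub>" using it by simp
      then show False using ne it psi_eq_iff by auto
    qed
  qed
  then have fin: "finite ?I" by (rule finite_subset) simp
  let ?g = "\<lambda>i. cls (mconst (1 / fact i)) \<otimes>\<^bsub>B\<^esub> (?\<delta> ^^ i) b"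
  have gB: "?g i \<in> carrier B" and psig: "psi (?g i) = smult (lconst (1 / fact i) * ?t ^ i) ((pderiv ^^ i) (psi b))" for i
    using it[of i] by (simp_all add: mult.commute)
  have fs: "finsum B ?g ?I \<in> carrier B \<and> psi (finsum B ?g ?I) = (\<Sum>i\<in>?I. psi (?g i))"
    by (rule psi_finsum[OF fin]) (rule gB)
  have E: "Exp m k P ?\<delta> b = finsum B ?g ?I" using b by (simp add: Exp_def Let_def)
  have "psi (finsum B ?g ?I) = (\<Sum>i\<in>?I. smult (lconst (1 / fact i) * ?t ^ i) ((pderiv ^^ i) (psi b)))"
    using fs by (simp only: psig)
  also have "\<dots> = (\<Sum>i<?N. smult (lconst (1 / fact i) * ?t ^ i) ((pderiv ^^ i) (psi b)))"
  proof (rule sum.mono_neutral_left[OF _ sub])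
    show "\<forall>i\<in>{..<?N} - ?I. smult (lconst (1 / fact i) * ?t ^ i) ((pderiv ^^ i) (psi b)) = 0"
    proof
      fix i assume "i \<in> {..<?N} - ?I"
      then have "(?\<delta> ^^ i) b = \<zero>\<^bsub>B\<^esub>" by blast
      then have "smult (?t ^ i) ((pderiv ^^ i) (psi b)) = 0" using it[of i] by simp
      then show "smult (lconst (1 / fact i) * ?t ^ i) ((pderiv ^^ i) (psi b)) = 0" by (simp only: smult_smult[symmetric] smult_0_right)
    qed
  qed simp
  also have "\<dots> = pcompose (psi b) [:?t, 1:]" by (rule Taylor_pcompose) simp
  also have "\<dots> = psi (Shear c b)" using b f by (simp add: params_U E_U)
  finally have "psi (finsum B ?g ?I) = psi (Shear c b)" .
  moreover have "finsum B ?g ?I \<in> carrier B" using fs by blast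
  moreover have "Shear c b \<in> carrier B" using b f by (simp add: params_U)
  ultimately show "Exp m k P ?\<delta> b = Shear c b" unfolding E using psi_eq_iff by blast
qed

lemma big_unipotent_eq: "big_unipotent m k P = A\<lparr>carrier := shears\<rparr>"
proof -
  let ?U = "{Exp m k P (\<lambda>b. f \<otimes>\<^bsub>B\<^esub> D b) | f. f \<in> Ker_D m k P}"
  have "?U = shears"
  proof
    show "?U \<subseteq> shears" by (auto simp: Ker_D_iff shears_def Exp_eq_Tr)
    show "shears \<subseteq> ?U"
    proof
      fix x assume "x \<in> shears"
      then obtain c where c: "c \<in> lpos m" "x = Shear c" by (auto simp: shears_def)
      let ?f = "unpsi [:c:]"
      have f: "?f \<in> carrier B" "psi ?f = [:c:]" using img_lpos[OF c(1)] by simp_all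
      then have "x = Exp m k P (\<lambda>b. ?f \<otimes>\<^bsub>B\<^esub> D b)" "?f \<in> Ker_D m k P"
        using c by (auto simp: Exp_eq_Tr Ker_D_iff)
      then show "x \<in> ?U" by blast
    qed
  qed
  then show ?thesis by (simp add: big_unipotent_def Aut_D_def)
qed

end

subsection \<open>Periods of a polynomial\<close>

text \<open>By Bezout's identity the exponents with \<open>c^n = 1\<close> are closed under
  gcd.\<close>

lemma power_Gcd_eq_1:
  fixes c :: "'b::field"
  assumes "finite S" "c \<noteq> 0" "\<And>n. n \<in> S \<Longrightarrow> c ^ n = 1"
  shows "c ^ (Gcd S :: nat) = 1"
  using assms(1,3)
proof (induction S)
  case (insert a S)
  then have 1: "c ^ a = 1" "c ^ Gcd S = 1" by auto
  show ?case
  proof (cases "a = 0")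
    case False
    then obtain x y where "a * x = Gcd S * y + gcd a (Gcd S)" using bezout_nat by blast
    then have "c ^ (a * x) = c ^ (Gcd S * y) * c ^ gcd a (Gcd S)" by (simp add: power_add)
    then show ?thesis using 1 by (simp add: power_mult)
  qed (use 1 in simp)
qed simp

lemma pcompose_monom: "pcompose (monom c n) q = smult c (q ^ n)"
  by (induction n) (simp_all add: monom_0 monom_Suc pcompose_pCons mult.commute)

text \<open>A polynomial has the form \<open>Z^u Q(Z^v)\<close> exactly when its exponents lie in
  the progression \<open>u, u + v, u + 2 v, ...\<close>; conversely \<open>Q\<close> collects the
  coefficients at the cofactors of \<open>v\<close>.\<close>

lemma has_period_form_iff:
  "has_period_form p v \<longleftrightarrow> (\<exists>u. \<forall>i. coeff p i \<noteq> 0 \<longrightarrow> (\<exists>j. i = u + v * j))"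
proof
  assume "has_period_form p v"
  then obtain u Q where p: "p = monom 1 u * pcompose Q (monom 1 v)" by (auto simp: has_period_form_def)
  have "pcompose Q (monom 1 v) = pcompose (\<Sum>j\<le>degree Q. monom (coeff Q j) j) (monom 1 v)"
    by (simp add: poly_as_sum_of_monoms)
  also have "\<dots> = (\<Sum>j\<le>degree Q. monom (coeff Q j) (v * j))"
    by (simp only: pcompose_sum pcompose_monom monom_power power_one smult_monom mult_1_right mult_1_left mult.commute)
  finally have "p = (\<Sum>j\<le>degree Q. monom (coeff Q j) (u + v * j))"
    by (simp add: p sum_distrib_left mult_monom)
  then have "coeff p i = (\<Sum>j\<le>degree Q. if u + v * j = i then coeff Q j else 0)" for i
    by (simp add: coeff_sum)
  note coeff = this
  have "\<exists>j. i = u + v * j" if nz: "coeff p i \<noteq> 0" for i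
  proof (rule ccontr)
    assume "\<nexists>j. i = u + v * j"
    then have "coeff p i = 0" unfolding coeff by (intro sum.neutral) auto
    with nz show False by simp
  qed
  then show "\<exists>u. \<forall>i. coeff p i \<noteq> 0 \<longrightarrow> (\<exists>j. i = u + v * j)" by blast
next
  assume "\<exists>u. \<forall>i. coeff p i \<noteq> 0 \<longrightarrow> (\<exists>j. i = u + v * j)"
  then obtain u h where h: "\<And>i. coeff p i \<noteq> 0 \<Longrightarrow> i = u + v * h i" by metis
  let ?Q = "\<Sum>i\<le>degree p. monom (coeff p i) (h i)"
  have "monom 1 u * pcompose ?Q (monom 1 v) = (\<Sum>i\<le>degree p. monom (coeff p i) (u + v * h i))"
    by (simp add: pcompose_sum pcompose_monom monom_power smult_monom sum_distrib_left mult_monom mult.commute)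
  also have "\<dots> = (\<Sum>i\<le>degree p. monom (coeff p i) i)"
  proof (rule sum.cong)
    fix i
    show "monom (coeff p i) (u + v * h i) = monom (coeff p i) i"
      by (cases "coeff p i = 0") (use h[of i] in simp_all)
  qed simp
  also have "\<dots> = p" by (rule poly_as_sum_of_monoms)
  finally show "has_period_form p v" unfolding has_period_form_def by metis
qed

text \<open>The maximal period is the gcd of the differences between the degree and the exponents
  that occur; it is positive because a lower exponent does occur. For c \<noteq> 0 the condition
  says that \<open>c\<close> to each of these differences is 1, which is the same for their
  gcd.\<close>

lemma power_eq_power_degree_iff:
  fixes p :: "'b::field_char_0 poly" and c :: 'b
  assumes monic: "lead_coeff p = 1" and ne: "p \<noteq> monom 1 (degree p)"
    and v: "has_period_form p v" and vmax: "\<And>w. has_period_form p w \<Longrightarrow> w \<le> v"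
  shows "v > 0" "c \<noteq> 0 \<Longrightarrow> (\<forall>i. coeff p i \<noteq> 0 \<longrightarrow> c ^ i = c ^ degree p) \<longleftrightarrow> c ^ v = 1"
proof -
  have "has_period_form p 1" unfolding has_period_form_iff by (intro exI[of _ 0]) simp
  with vmax show v0: "v > 0" by fastforce
  obtain u where u: "\<And>i. coeff p i \<noteq> 0 \<Longrightarrow> \<exists>j. i = u + v * j" using v unfolding has_period_form_iff by blast
  define S where "S = {i. coeff p i \<noteq> 0}"
  have S: "i \<le> degree p" if "i \<in> S" for i using that by (simp add: S_def le_degree)
  have fin: "finite S" by (rule finite_subset[of _ "{..degree p}"]) (use S in auto)
  have dS: "degree p \<in> S" using monic by (simp add: S_def)
  let ?D = "(\<lambda>i. degree p - i) ` S"
  have vd: "v dvd degree p - i" if i: "i \<in> S" for i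
  proof -
    obtain a where "i = u + v * a" using u[of i] i unfolding S_def by blast
    moreover obtain b where "degree p = u + v * b" using u[of "degree p"] dS unfolding S_def by blast
    ultimately have "degree p - i = v * (b - a)" by (simp add: diff_mult_distrib2)
    then show ?thesis by simp
  qed
  have "\<exists>i\<in>S. i \<noteq> degree p"
  proof (rule ccontr)
    assume "\<not> ?thesis"
    then have "coeff p i = (if i = degree p then 1 else 0)" for i using monic by (auto simp: S_def)
    then have "p = monom 1 (degree p)" by (intro poly_eqI) auto
    with ne show False by simp
  qed
  then obtain i0 where i0: "i0 \<in> S" "i0 < degree p" using S by fastforce
  have gv: "Gcd ?D = v"
  proof (rule antisym)
    have dv: "Gcd ?D dvd degree p - i" if "i \<in> S" for i using that by (intro Gcd_dvd) auto
    \<comment> \<open>All exponents in the support are congruent to the degree modulo the gcd. The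
      residue serves as offset because it is small enough for every cofactor to be a natural
      number.\<close>
    show "Gcd ?D \<le> v"
    proof (rule vmax, unfold has_period_form_iff, rule exI[of _ "degree p mod Gcd ?D"], intro allI impI)
      fix i assume "coeff p i \<noteq> 0"
      then have i: "i \<in> S" by (simp add: S_def)
      then have "i mod Gcd ?D = degree p mod Gcd ?D"
        using dv[OF i] S[OF i] by (metis mod_eq_dvd_iff_nat)
      then have "i = degree p mod Gcd ?D + Gcd ?D * (i div Gcd ?D)" by (metis mod_mult_div_eq)
      then show "\<exists>j. i = degree p mod Gcd ?D + Gcd ?D * j" by blast
    qed
    have "v dvd Gcd ?D" using vd by (intro Gcd_greatest) auto
    moreover have "Gcd ?D \<noteq> 0"
    proof
      assume 0: "Gcd ?D = 0"
      have "degree p - i0 = 0" using dv[OF i0(1)] unfolding 0 by (simp only: dvd_0_left_iff)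
      with i0(2) show False by simp
    qed
    ultimately show "v \<le> Gcd ?D" by (intro dvd_imp_le) (simp_all only: neq0_conv)
  qed
  assume c: "c \<noteq> 0"
  show "(\<forall>i. coeff p i \<noteq> 0 \<longrightarrow> c ^ i = c ^ degree p) \<longleftrightarrow> c ^ v = 1"
  proof
    assume L: "\<forall>i. coeff p i \<noteq> 0 \<longrightarrow> c ^ i = c ^ degree p"
    have "c ^ n = 1" if n: "n \<in> ?D" for n
    proof -
      obtain i where i: "i \<in> S" "n = degree p - i" using n by blast
      then have dn: "degree p = i + n" using S[OF i(1)] by simp
      have "c ^ degree p = c ^ i * c ^ n" by (subst dn) (rule power_add)
      moreover have "c ^ i = c ^ degree p" using L i by (simp add: S_def)
      ultimately show ?thesis using c by simp
    qed
    then have "c ^ Gcd ?D = 1" using fin c by (intro power_Gcd_eq_1) auto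
    then show "c ^ v = 1" by (simp only: gv)
  next
    assume R: "c ^ v = 1"
    show "\<forall>i. coeff p i \<noteq> 0 \<longrightarrow> c ^ i = c ^ degree p"
    proof (intro allI impI)
      fix i assume "coeff p i \<noteq> 0"
      then have i: "i \<in> S" by (simp add: S_def)
      obtain j where "degree p - i = v * j" using vd[OF i] by (rule dvdE)
      then have "degree p = i + v * j" using S[OF i] by simp
      then show "c ^ i = c ^ degree p" using R by (simp add: power_add power_mult)
    qed
  qed
qed

context danielewski begin

subsection \<open>The diagonal subgroup\<close>

definition wt :: "nat \<Rightarrow> nat" where "wt i = k (Suc i)"

text \<open>The diagonal subgroup in torus coordinates. The case distinction on \<open>P\<close>
  enters only through the set of \<open>c\<close> with \<open>scaling c\<close>.\<close>

definition diag_torus :: "(nat \<Rightarrow> 'a) monoid"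
  where "diag_torus = (torus (m - 1))\<lparr>carrier := {t \<in> carrier (torus (m - 1)). scaling (\<Prod>i\<in>{1..m - 1}. t i ^ wt i)}\<rparr>"

text \<open>The coordinate \<open>t i\<close> of the torus scales \<open>y\<^bsub>i+1\<^esub>\<close>.\<close>

definition ext :: "(nat \<Rightarrow> 'a) \<Rightarrow> nat \<Rightarrow> 'a"
  where "ext t j = (if j \<in> {2..m} then t (j - 1) else 1)"

lemma prod_shift: "(\<Prod>j\<in>{2..m}. h j) = (\<Prod>i\<in>{1..m - 1}. h (Suc i))" for h :: "nat \<Rightarrow> 'b::comm_monoid_mult"
proof -
  have "{2..m} = {Suc 1..Suc (m - 1)}" using m by simp
  then show ?thesis by (simp only: prod.shift_bounds_cl_Suc_ivl)
qed

lemma mu_ext: "mu (ext t) = (\<Prod>i\<in>{1..m - 1}. t i ^ wt i)"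
  unfolding mu_def prod_shift by (intro prod.cong) (auto simp: ext_def wt_def)

lemma params_ext: "t \<in> carrier diag_torus \<Longrightarrow> params id (ext t) 0"
proof -
  assume t: "t \<in> carrier diag_torus"
  then have nz: "t i \<noteq> 0" if "i \<in> {1..m - 1}" for i using that by (auto simp: diag_torus_def carrier_torus)
  have "ext t j \<noteq> 0" for j
  proof (cases "j \<in> {2..m}")
    case True
    then have "j - 1 \<in> {1..m - 1}" by auto
    with True nz show ?thesis by (simp add: ext_def)
  next
    case False
    then show ?thesis unfolding ext_def by (simp only: if_False) simp
  qed
  then show ?thesis using t by (auto simp: params_V mu_ext diag_torus_def) (auto simp: ext_def)
qed

lemma diag_torus_iso: "(\<lambda>t. Diag (ext t)) \<in> iso diag_torus (A\<lparr>carrier := diags\<rparr>)"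
proof (rule isoI)
  show "(\<lambda>t. Diag (ext t)) \<in> hom diag_torus (A\<lparr>carrier := diags\<rparr>)"
  proof (rule homI)
    fix x y assume xy: "x \<in> carrier diag_torus" "y \<in> carrier diag_torus"
    have "ext (x \<otimes>\<^bsub>diag_torus\<^esub> y) = (\<lambda>j. ext x j * ext y j)"
      by (auto simp: fun_eq_iff ext_def diag_torus_def mult_torus)
    then show "Diag (ext (x \<otimes>\<^bsub>diag_torus\<^esub> y)) = Diag (ext x) \<otimes>\<^bsub>A\<lparr>carrier := diags\<rparr>\<^esub> Diag (ext y)"
      using diag_mult(1)[OF params_ext[OF xy(1)] params_ext[OF xy(2)]] by simp
  qed (auto simp: diags_def intro: params_ext)
  show "bij_betw (\<lambda>t. Diag (ext t)) (carrier diag_torus) (carrier (A\<lparr>carrier := diags\<rparr>))"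
  proof (rule bij_betw_imageI)
    show "inj_on (\<lambda>t. Diag (ext t)) (carrier diag_torus)"
    proof (rule inj_onI)
      fix x y assume xy: "x \<in> carrier diag_torus" "y \<in> carrier diag_torus" "Diag (ext x) = Diag (ext y)"
      have e: "ext x = ext y" using Tr_inj[OF params_ext[OF xy(1)] params_ext[OF xy(2)] xy(3)] by simp
      show "x = y"
      proof (rule extensionalityI[of _ "{1..m - 1}"])
        fix i assume "i \<in> {1..m - 1}"
        then have "Suc i \<in> {2..m}" by auto
        then show "x i = y i" using fun_cong[OF e, of "Suc i"] by (simp add: ext_def)
      qed (use xy in \<open>auto simp: diag_torus_def carrier_torus PiE_iff\<close>)
    qed
    have "x \<in> (\<lambda>t. Diag (ext t)) ` carrier diag_torus" if x: "x \<in> diags" for x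
    proof -
      obtain l where l: "params id l 0" "x = Diag l" using x by (auto simp: diags_def)
      define t where "t = (\<lambda>i\<in>{1..m - 1}. l (Suc i))"
      have e: "ext t = l"
      proof
        fix j
        show "ext t j = l j" using paramsD(4)[OF l(1), of j] by (auto simp: ext_def t_def)
      qed
      have "t \<in> carrier (torus (m - 1))" using paramsD(3)[OF l(1)] by (simp add: carrier_torus t_def)
      then have "t \<in> carrier diag_torus" using paramsD(5)[OF l(1)] mu_ext[of t] by (simp add: diag_torus_def e)
      with l e show ?thesis by (auto intro!: image_eqI[of _ _ t])
    qed
    moreover have "(\<lambda>t. Diag (ext t)) ` carrier diag_torus \<subseteq> diags" by (auto simp: diags_def intro: params_ext)
    ultimately show "(\<lambda>t. Diag (ext t)) ` carrier diag_torus = carrier (A\<lparr>carrier := diags\<rparr>)" by auto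
  qed
qed

lemma iterated_semidirect:
  assumes "group T" "T \<cong> diag_torus"
  shows "iso_iterated_semidirect A (sym_group m k P) T (big_unipotent m k P)"
proof -
  obtain \<tau> where "\<tau> \<in> iso T diag_torus" using assms(2) by (auto simp: is_iso_def)
  then have \<tau>': "(\<lambda>t. Diag (ext t)) \<circ> \<tau> \<in> iso T (A\<lparr>carrier := diags\<rparr>)"
    by (rule iso_set_trans[OF _ diag_torus_iso])
  show ?thesis
    unfolding sym_group_eq big_unipotent_eq
    by (rule iso_iterated_semidirectI[OF group_A subgroup_perms subgroup_diags subgroup_shears assms(1) \<tau>'
          normal_shears perm_conj_diag gen_A unique_A])
qed

lemma diag_torus_full:
  assumes "normalised P = monom 1 d"
  shows "diag_torus = torus (m - 1)"
proof -
  have "scaling c" for c unfolding scaling_iff Pn_def assms by simp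
  then show ?thesis by (simp add: diag_torus_def)
qed

text \<open>Here \<open>scaling c\<close> amounts to \<open>c^v = 1\<close> for c \<noteq> 0, so the
  condition on the product of the \<open>t_i^(wt i)\<close> is that the character with exponents
  \<open>wt i * v\<close> is trivial.\<close>

lemma diag_torus_ker:
  assumes "normalised P \<noteq> monom 1 d" "has_period_form (normalised P) v"
    "\<forall>w. has_period_form (normalised P) w \<longrightarrow> w \<le> v"
  shows "diag_torus = torus_ker (m - 1) (\<lambda>i. wt i * v)" "v > 0"
proof -
  have "lead_coeff Pn = 1" by simp
  note pw = power_eq_power_degree_iff[OF this _ assms(2)[folded Pn_def], unfolded degree_Pn, OF assms(1)[folded Pn_def]]
  show "v > 0" using pw(1) assms(3) by (simp add: Pn_def)
  have sc: "scaling c \<longleftrightarrow> c ^ v = 1" if "c \<noteq> 0" for c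
    using pw(2)[OF _ that] assms(3) by (simp add: scaling_iff Pn_def)
  have "scaling (\<Prod>i\<in>{1..m - 1}. t i ^ wt i) \<longleftrightarrow> (\<Prod>i\<in>{1..m - 1}. t i ^ (wt i * v)) = 1"
    if "t \<in> carrier (torus (m - 1))" for t :: "nat \<Rightarrow> 'a"
  proof -
    have "(\<Prod>i\<in>{1..m - 1}. t i ^ wt i) \<noteq> 0" using that by (auto simp: carrier_torus PiE_iff)
    then show ?thesis by (simp add: sc prod_power_distrib power_mult)
  qed
  then show "diag_torus = torus_ker (m - 1) (\<lambda>i. wt i * v)" unfolding diag_torus_def torus_ker_def by (intro arg_cong[where f = "\<lambda>S. (torus (m - 1))\<lparr>carrier := S\<rparr>"]) blast
qed

text \<open>The origin of the order \<open>s v\<close> of the cyclic factor.\<close>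

lemma Gcd_wt: "Gcd ((\<lambda>i. wt i * v) ` {1..m - 1}) = Gcd (k ` {2..m}) * v"
proof -
  have "{2..m} = Suc ` {1..m - 1}" using m by (simp only: image_Suc_atLeastAtMost) simp
  then have "k ` {2..m} = wt ` {1..m - 1}" by (simp only: image_image) (simp add: wt_def)
  moreover have "(\<lambda>i. wt i * v) ` {1..m - 1} = (*) v ` wt ` {1..m - 1}" by (simp add: image_image mult.commute)
  ultimately show ?thesis by (simp only: Gcd_mult) (simp add: mult.commute)
qed

end

theorem theorem5p9:
  fixes P :: "'a::{alg_closed_field, field_char_0} poly"
    and k :: "nat \<Rightarrow> nat" and d m :: nat
  assumes "d \<ge> 2" and "m \<ge> 2" and "\<forall>j\<in>{2..m}. k j \<ge> 2"
    and "degree P = d" and "lead_coeff P = 1"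
  shows "(normalised P = monom 1 d \<longrightarrow>
      iso_iterated_semidirect (Aut_D m k P) (sym_group m k P)
        (torus (m - 1) :: (nat \<Rightarrow> 'a) monoid) (big_unipotent m k P)) \<and>
    (\<forall>v. normalised P \<noteq> monom 1 d \<and> has_period_form (normalised P) v \<and>
        (\<forall>w. has_period_form (normalised P) w \<longrightarrow> w \<le> v) \<longrightarrow>
      iso_iterated_semidirect (Aut_D m k P) (sym_group m k P)
        ((torus (m - 2) :: (nat \<Rightarrow> 'a) monoid)
          \<times>\<times> integer_mod_group (Gcd (k ` {2..m}) * v))
        (big_unipotent m k P))"
proof -
  interpret danielewski P k m
    by unfold_locales (use assms in auto)
  show ?thesis
  proof (intro conjI allI impI)
    assume "normalised P = monom 1 d"
    then have "diag_torus = torus (m - 1)" using diag_torus_full assms(4) by simp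
    then have "(torus (m - 1) :: (nat \<Rightarrow> 'a) monoid) \<cong> diag_torus" by (simp add: iso_refl)
    then show "iso_iterated_semidirect (Aut_D m k P) (sym_group m k P)
        (torus (m - 1) :: (nat \<Rightarrow> 'a) monoid) (big_unipotent m k P)"
      by (rule iterated_semidirect[OF group_torus])
  next
    fix v assume v: "normalised P \<noteq> monom 1 d \<and> has_period_form (normalised P) v \<and>
        (\<forall>w. has_period_form (normalised P) w \<longrightarrow> w \<le> v)"
    let ?T = "(torus (m - 2) :: (nat \<Rightarrow> 'a) monoid) \<times>\<times> integer_mod_group (Gcd (k ` {2..m}) * v)"
    have diag_torus: "diag_torus = torus_ker (m - 1) (\<lambda>i. wt i * v)" "v > 0" using diag_torus_ker[of v] v assms(4) by auto
    \<comment> \<open>The character needs a positive exponent; \<open>y_2\<close> is present because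
      m \<ge> 2, and it corresponds to torus index 1. The cyclic factor then uses up one rank, from
      \<open>m - 1\<close> to \<open>m - 2\<close>.\<close>
    have "k 2 > 0" using assms(2,3) by force
    then have "wt 1 * v > 0" using diag_torus(2) by (simp add: wt_def numeral_2_eq_2)
    moreover have "1 \<in> {1..m - 1}" using assms(2) by simp
    ultimately have "(torus (m - 1 - 1) :: (nat \<Rightarrow> 'a) monoid) \<times>\<times> integer_mod_group (Gcd ((\<lambda>i. wt i * v) ` {1..m - 1})) \<cong> diag_torus"
      unfolding diag_torus(1) by (intro torus_ker_iso) blast
    moreover have "m - 1 - 1 = m - 2" by simp
    ultimately have "?T \<cong> diag_torus" by (simp only: Gcd_wt)
    moreover have "group ?T" by (intro DirProd_group group_torus) simp
    ultimately show "iso_iterated_semidirect (Aut_D m k P) (sym_group m k P) ?T (big_unipotent m k P)"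
      by (intro iterated_semidirect)
  qed
qed

end
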